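(* Let $n\ge1$, let $P$ be a finite partially ordered set, let $\mathcal J$ be a poset ideal in $\mathrm{Hom}(P,[n])$, and let $\mathcal J^c=\mathrm{Hom}(P,[n])\setminus\mathcal J$. Then the Alexander dual $L(n,P;\mathcal J)$ of $L(P,n;\mathcal J)$ is $$L(n,P;\mathcal J)=L(n,P)+K(\mathcal J^c).$$ This is a Cohen-Macaulay ideal of codimension $|P|$.
   Context: $\Bbbk$ is a field and $[n]=\{1<2<\cdots<n\}$ is the chain on $n$ elements. For a set $A$, $\Bbbk[x_A]$ is the polynomial ring in variables $x_a$, $a\in A$. $\mathrm{Hom}(P,[n])$ is the set of isotone (order preserving) maps $P\to[n]$, partially ordered by $\phi\le\psi$ iff $\phi(p)\le\psi(p)$ for all $p\in P$. A poset ideal of a poset is a subset $J$ such that $q\in J$ and $p\le q$ imply $p\in J$. The Alexander dual of a squarefree monomial ideal $I\subseteq\Bbbk[x_A]$ is the monomial ideal of $\Bbbk[x_A]$ whose monomials are those having a nontrivial common divisor with every monomial in $I$. The letterplace ideal $L(n,P)\subseteq\Bbbk[x_{[n]\times P}]$ is generated by all monomials $x_{1,p_1}x_{2,p_2}\cdots x_{n,p_n}$ with $p_1\le p_2\le\cdots\le p_n$ in $P$. The co-letterplace ideal $L(P,n;\mathcal J)\subseteq\Bbbk[x_{P\times[n]}]$ is generated by all monomials $\prod_{p\in P}x_{p,\phi(p)}$ with $\phi\in\mathcal J$. The ideal $L(n,P;\mathcal J)\subseteq\Bbbk[x_{[n]\times P}]$ denotes its Alexander dual, where $\Bbbk[x_{P\times[n]}]$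 and $\Bbbk[x_{[n]\times P}]$ are identified by $x_{p,i}\leftrightarrow x_{i,p}$. For $\phi\in\mathrm{Hom}(P,[n])$ let $\Lambda\phi=\{(p,i)\in P\times[n] : i<\phi(p)\text{ and }\phi(q)\le i\text{ for all }q<p\}$. For a subset $\mathcal S\subseteq\mathrm{Hom}(P,[n])$, $K(\mathcal S)\subseteq\Bbbk[x_{[n]\times P}]$ is the ideal generated by the monomials $\prod_{(p,i)\in\Lambda\phi}x_{i,p}$ for $\phi\in\mathcal S$. An ideal is called Cohen-Macaulay if its quotient ring is Cohen-Macaulay.
   Formalization: The codimension claim is stated only for nonempty 𝒥: for 𝒥 = ∅ the Alexander dual is the unit ideal, which lies in no prime and so does not have codimension |P|; the equation and Cohen-Macaulayness are stated for all 𝒥. *)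

theory Defs
  imports
    "HOL-Library.Poly_Mapping"
    "HOL-Library.FuncSet"
    "HOL-Library.Extended_Nat"
    "HOL-Algebra.QuotRing"
    "HOL-Algebra.Divisibility"
    "HOL-Algebra.Ring_Divisibility"
begin

section \<open>Polynomial rings\<close>

type_synonym ('v, 'k) mpoly = "('v \<Rightarrow>\<^sub>0 nat) \<Rightarrow>\<^sub>0 'k"

definition var :: "'v \<Rightarrow> ('v, 'k::field) mpoly" where
  "var v = Poly_Mapping.single (Poly_Mapping.single v 1) 1"

text \<open>
  The ring \<open>k[x\<^sub>A]\<close>, with an explicit set \<open>A\<close> of variables because the index sets
  \<open>P \<times> [n]\<close> depend on \<open>n\<close> and may be empty. The operations are those of the type class
  instance of \<open>\<Rightarrow>\<^sub>0\<close> (convolution product).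
\<close>

definition mpoly_ring :: "'v set \<Rightarrow> ('v, 'k::field) mpoly ring" where
  "mpoly_ring A =
    \<lparr>carrier = {f. \<forall>m \<in> Poly_Mapping.keys f. Poly_Mapping.keys m \<subseteq> A},
     mult = (*), one = 1, zero = 0, add = (+)\<rparr>"

definition monomials :: "'v set \<Rightarrow> ('v, 'k::field) mpoly set" where
  "monomials A = {Poly_Mapping.single m 1 | m. Poly_Mapping.keys m \<subseteq> A}"

text \<open>The generating set is closed under multiplication by monomials of \<open>k[x\<^sub>A]\<close>, hence
  consists of all the monomials of the ideal.\<close>

definition alexander_dual :: "'v set \<Rightarrow> ('v, 'k::field) mpoly set \<Rightarrow> ('v, 'k) mpoly set" where
  "alexander_dual A I = Idl\<^bsub>mpoly_ring A\<^esub>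
    {u \<in> monomials A. \<forall>w \<in> monomials A \<inter> I.
       \<exists>d \<in> monomials A. d \<noteq> 1 \<and> d divides\<^bsub>mpoly_ring A\<^esub> u \<and> d divides\<^bsub>mpoly_ring A\<^esub> w}"

text \<open>The identification \<open>k[x\<^bsub>P \<times> [n]\<^esub>] \<rightarrow> k[x\<^bsub>[n] \<times> P\<^esub>]\<close>, \<open>x\<^bsub>p,i\<^esub> \<mapsto> x\<^bsub>i,p\<^esub>\<close>. The inner
  \<open>map_key\<close> acts on exponent vectors; \<open>map_key\<close> precomposes, so it goes in the
  opposite direction.\<close>

definition swap_vars :: "('a \<times> 'b, 'k::field) mpoly \<Rightarrow> ('b \<times> 'a, 'k) mpoly" where
  "swap_vars = Poly_Mapping.map_key (Poly_Mapping.map_key prod.swap)"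

lemma inj_map_key_swap:
  "inj (Poly_Mapping.map_key prod.swap :: ('a \<times> 'b \<Rightarrow>\<^sub>0 nat) \<Rightarrow> ('b \<times> 'a \<Rightarrow>\<^sub>0 nat))"
proof (rule injI)
  fix f g :: "'a \<times> 'b \<Rightarrow>\<^sub>0 nat"
  assume "Poly_Mapping.map_key prod.swap f = Poly_Mapping.map_key prod.swap g"
  then have "Poly_Mapping.lookup f (prod.swap x) = Poly_Mapping.lookup g (prod.swap x)" for x
    by (metis inj_swap map_key.rep_eq comp_apply)
  then show "f = g"
    by (intro poly_mapping_eqI) (metis swap_swap)
qed

lemma swap_vars_var: "swap_vars (var (p, i)) = var (i, p)"
proof -
  have "Poly_Mapping.map_key prod.swap (Poly_Mapping.single (i, p) (1::nat))
      = Poly_Mapping.single (p, i) 1"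
    using map_key_single[OF inj_swap, of "(p, i)" "1::nat"] by simp
  then show ?thesis
    unfolding swap_vars_def var_def
    by (metis map_key_single[OF inj_map_key_swap])
qed


section \<open>Codimension and Cohen--Macaulay rings\<close>

definition height :: "('a, 'm) ring_scheme \<Rightarrow> 'a set \<Rightarrow> enat" where
  "height R p = (SUP k \<in> {k. \<exists>c :: nat \<Rightarrow> 'a set.
      (\<forall>i\<le>k. primeideal (c i) R) \<and> (\<forall>i<k. c i \<subset> c (Suc i)) \<and> c k = p}. enat k)"

text \<open>The codimension of the unit ideal is \<open>\<infinity>\<close>, the infimum of the empty set.\<close>

definition codim :: "('a, 'm) ring_scheme \<Rightarrow> 'a set \<Rightarrow> enat" where
  "codim R I = (INF p \<in> {p. primeideal p R \<and> I \<subseteq> p}. height R p)"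

definition regular_sequence :: "('a, 'm) ring_scheme \<Rightarrow> 'a list \<Rightarrow> bool" where
  "regular_sequence R fs \<longleftrightarrow>
     set fs \<subseteq> carrier R \<and> Idl\<^bsub>R\<^esub> (set fs) \<noteq> carrier R \<and>
     (\<forall>i < length fs. \<forall>a \<in> carrier R.
        fs ! i \<otimes>\<^bsub>R\<^esub> a \<in> Idl\<^bsub>R\<^esub> (set (take i fs)) \<longrightarrow> a \<in> Idl\<^bsub>R\<^esub> (set (take i fs)))"

definition depth :: "('a, 'm) ring_scheme \<Rightarrow> 'a set \<Rightarrow> enat" where
  "depth R I = (SUP fs \<in> {fs. regular_sequence R fs \<and> set fs \<subseteq> I}. enat (length fs))"

text \<open>The definition of Eisenbud, \<^emph>\<open>Commutative Algebra\<close>, Section 18.2. Depth and height are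
  those of the ideal \<open>M\<close> in \<open>R\<close>, so no localization is needed. The zero ring is
  Cohen--Macaulay, having no maximal ideals.\<close>

definition cohen_macaulay_ring :: "('a, 'm) ring_scheme \<Rightarrow> bool" where
  "cohen_macaulay_ring R \<longleftrightarrow> cring R \<and> noetherian_ring R \<and>
     (\<forall>M. maximalideal M R \<longrightarrow> depth R M = height R M)"

definition cohen_macaulay_ideal :: "('a, 'm) ring_scheme \<Rightarrow> 'a set \<Rightarrow> bool" where
  "cohen_macaulay_ideal R I \<longleftrightarrow> ideal I R \<and> cohen_macaulay_ring (R Quot I)"


section \<open>Letterplace and co-letterplace ideals\<close>

text \<open>Posets are subsets of types of class \<^class>\<open>order\<close> with the induced order. Maps are
  extensional, so that each map \<open>P \<rightarrow> Q\<close> is represented exactly once.\<close>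

definition isotone_maps :: "'a::order set \<Rightarrow> 'b::order set \<Rightarrow> ('a \<Rightarrow> 'b) set" where
  "isotone_maps P Q = {\<phi> \<in> P \<rightarrow>\<^sub>E Q. mono_on P \<phi>}"

definition pointwise_le :: "'a set \<Rightarrow> ('a \<Rightarrow> 'b::order) \<Rightarrow> ('a \<Rightarrow> 'b) \<Rightarrow> bool" where
  "pointwise_le P \<phi> \<psi> \<longleftrightarrow> (\<forall>p\<in>P. \<phi> p \<le> \<psi> p)"

definition poset_ideal :: "'a set \<Rightarrow> ('a \<Rightarrow> 'a \<Rightarrow> bool) \<Rightarrow> 'a set \<Rightarrow> bool" where
  "poset_ideal H leq J \<longleftrightarrow> J \<subseteq> H \<and> (\<forall>q\<in>J. \<forall>p\<in>H. leq p q \<longrightarrow> p \<in> J)"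

definition letterplace_ideal :: "nat \<Rightarrow> 'p::order set \<Rightarrow> (nat \<times> 'p, 'k::field) mpoly set" where
  "letterplace_ideal n P = Idl\<^bsub>mpoly_ring ({1..n} \<times> P)\<^esub>
     {\<Prod>i\<in>{1..n}. var (i, \<rho> i) | \<rho>. \<rho> \<in> isotone_maps {1..n} P}"

definition coletterplace_ideal ::
    "'p::order set \<Rightarrow> nat \<Rightarrow> ('p \<Rightarrow> nat) set \<Rightarrow> ('p \<times> nat, 'k::field) mpoly set" where
  "coletterplace_ideal P n J = Idl\<^bsub>mpoly_ring (P \<times> {1..n})\<^esub>
     {\<Prod>p\<in>P. var (p, \<phi> p) | \<phi>. \<phi> \<in> J}"

definition dual_letterplace_ideal ::
    "nat \<Rightarrow> 'p::order set \<Rightarrow> ('p \<Rightarrow> nat) set \<Rightarrow> (nat \<times> 'p, 'k::field) mpoly set" where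
  "dual_letterplace_ideal n P J =
     swap_vars ` alexander_dual (P \<times> {1..n}) (coletterplace_ideal P n J)"

definition Lambda :: "'p::order set \<Rightarrow> nat \<Rightarrow> ('p \<Rightarrow> nat) \<Rightarrow> ('p \<times> nat) set" where
  "Lambda P n \<phi> = {(p, i) \<in> P \<times> {1..n}. i < \<phi> p \<and> (\<forall>q\<in>P. q < p \<longrightarrow> \<phi> q \<le> i)}"

definition K_ideal ::
    "nat \<Rightarrow> 'p::order set \<Rightarrow> ('p \<Rightarrow> nat) set \<Rightarrow> (nat \<times> 'p, 'k::field) mpoly set" where
  "K_ideal n P S = Idl\<^bsub>mpoly_ring ({1..n} \<times> P)\<^esub>
     {\<Prod>(p, i)\<in>Lambda P n \<phi>. var (i, p) | \<phi>. \<phi> \<in> S}"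

end

theory Submission
  imports Defs "HOL-Computational_Algebra.Polynomial"
begin

text \<open>
  Write \<open>V = [n] \<times> P\<close>, \<open>S = k[x\<^sub>V]\<close> and \<open>x\<^sup>\<phi> = {x\<^bsub>\<phi>(p),p\<^esub> : p \<in> P}\<close> for the variables on the graph of an
  isotone map \<open>\<phi>\<close>.

  \<^emph>\<open>The equation.\<close> A monomial with support \<open>U \<subseteq> V\<close> lies in the Alexander dual iff \<open>U\<close> meets the graph of
  every \<open>\<phi> \<in> \<J>\<close>. Suppose it does, and that \<open>U\<close> contains no chain \<open>(1,p\<^sub>1), \<dots>, (n,p\<^sub>n)\<close> with
  \<open>p\<^sub>1 \<le> \<dots> \<le> p\<^sub>n\<close>. Let \<open>\<phi>(p) - 1\<close> be the largest \<open>m\<close> such that \<open>U\<close> contains \<open>(1,p\<^sub>1), \<dots>, (m,p\<^sub>m)\<close> with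
  \<open>p\<^sub>1 \<le> \<dots> \<le> p\<^sub>m \<le> p\<close>. Then \<open>\<phi>\<close> is isotone with values in \<open>[n]\<close>, its graph avoids \<open>U\<close>, so \<open>\<phi>\<close> is not in
  \<open>\<J>\<close>, and \<open>U\<close> contains \<open>\<Lambda>\<phi>\<close> (\<open>chain_or_avoiding_map\<close>). The converse is a fixed point argument for
  chains (\<open>chain_meets_graph\<close>) and a minimality argument for \<open>\<Lambda>\<psi>\<close> (\<open>Lambda_meets_graph\<close>).

  \<^emph>\<open>Freeness.\<close> Let \<open>L\<close> be the dual ideal and \<open>B\<close> the polynomial ring generated by the differences
  \<open>x\<^bsub>i,p\<^esub> - x\<^bsub>i+1,p\<^esub>\<close>. The monomials of \<open>\<Lambda>\<phi>\<close>, \<open>\<phi> \<in> \<J>\<close>, are a basis of \<open>S/L\<close> over \<open>B\<close>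
  (\<open>free_basis\<close>). To see this remove a maximal element \<open>\<psi>\<close> of \<open>\<J>\<close>. By the equation above the dual ideal
  of the smaller poset ideal is \<open>L\<close> plus the multiples of the monomial of \<open>\<Lambda>\<psi>\<close>, that monomial is
  annihilated modulo \<open>L\<close> by exactly the prime \<open>(x\<^sup>\<psi>)\<close>, and \<open>S/(x\<^sup>\<psi>)\<close> is a copy of \<open>B\<close>, since
  setting one of the variables \<open>x\<^bsub>1,p\<^esub>, \<dots>, x\<^bsub>n,p\<^esub>\<close> to zero leaves the differences as coordinates.

  \<^emph>\<open>Depth.\<close> Let \<open>M\<close> be a maximal ideal of \<open>S/L\<close>. By Zariski's lemma (\<open>zariski\<close>) each difference \<open>\<theta>\<close> is a
  root modulo \<open>M\<close> of a nonzero \<open>g\<^sub>\<theta> \<in> k[t]\<close>. The elements \<open>g\<^sub>\<theta>(\<theta>)\<close> lie in \<open>M\<close> and form a regular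
  sequence in \<open>B\<close>, being polynomials in distinct variables (\<open>univariate_regular\<close>), hence in the free
  module \<open>S/L\<close> (\<open>regular_mod_dual\<close>). So the depth of \<open>M\<close> is at least \<open>(n - 1)|P|\<close>.

  \<^emph>\<open>Height.\<close> A chain of primes in \<open>k[x\<^sub>A]\<close> has length at most \<open>|A|\<close>, because more than \<open>|A|\<close> polynomials
  are algebraically dependent (\<open>prime_chain_bound\<close>). A prime above \<open>L\<close> contains some \<open>(x\<^sup>\<phi>)\<close> with
  \<open>\<phi> \<in> \<J>\<close> (\<open>prime_above_dual\<close>), below which there is a chain of length \<open>|P|\<close>. So the height of \<open>M\<close> is at
  most \<open>n|P| - |P|\<close>. The depth of a prime in a Noetherian ring never exceeds its height
  (\<open>depth_le_height\<close>), and Noetherianity is Hilbert's basis theorem (\<open>hilbert_basis\<close>). This gives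
  Cohen-Macaulayness, and the same two facts about chains give the codimension.
\<close>

abbreviation keys :: "('a \<Rightarrow>\<^sub>0 'b::zero) \<Rightarrow> 'a set" where "keys \<equiv> Poly_Mapping.keys"
abbreviation lookup :: "('a \<Rightarrow>\<^sub>0 'b::zero) \<Rightarrow> 'a \<Rightarrow> 'b" where "lookup \<equiv> Poly_Mapping.lookup"
abbreviation single :: "'a \<Rightarrow> 'b \<Rightarrow> 'a \<Rightarrow>\<^sub>0 'b::zero" where "single \<equiv> Poly_Mapping.single"
abbreviation pcoeff :: "'a::zero poly \<Rightarrow> nat \<Rightarrow> 'a" where "pcoeff \<equiv> Polynomial.coeff"
abbreviation pdegree :: "'a::zero poly \<Rightarrow> nat" where "pdegree \<equiv> Polynomial.degree"
abbreviation pmonom :: "'a::zero \<Rightarrow> nat \<Rightarrow> 'a poly" where "pmonom \<equiv> Polynomial.monom"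
abbreviation psmult :: "'a::comm_semiring_0 \<Rightarrow> 'a poly \<Rightarrow> 'a poly" where "psmult \<equiv> Polynomial.smult"

section \<open>Subrings and ideals as subsets of a commutative ring\<close>

text \<open>A polynomial ring and all its subrings considered below are subsets of one commutative ring type, so
  their ideals are treated as plain sets. \<open>ideal_ring_on_iff\<close> and \<open>primeideal_ring_on_iff\<close> translate to the
  record-based notions.\<close>

definition subring_set :: "'a::comm_ring_1 set \<Rightarrow> bool" where
  "subring_set B \<longleftrightarrow> 1 \<in> B \<and> (\<forall>x\<in>B. - x \<in> B) \<and> (\<forall>x\<in>B. \<forall>y\<in>B. x + y \<in> B \<and> x * y \<in> B)"

definition ring_on :: "'a::comm_ring_1 set \<Rightarrow> 'a ring" where
  "ring_on B = \<lparr>carrier = B, mult = (*), one = 1, zero = 0, add = (+)\<rparr>"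

definition ideal_in :: "'a::comm_ring_1 set \<Rightarrow> 'a set \<Rightarrow> bool" where
  "ideal_in B I \<longleftrightarrow> I \<subseteq> B \<and> 0 \<in> I \<and> (\<forall>x\<in>I. \<forall>y\<in>I. x + y \<in> I) \<and> (\<forall>b\<in>B. \<forall>x\<in>I. b * x \<in> I)"

definition prime_in :: "'a::comm_ring_1 set \<Rightarrow> 'a set \<Rightarrow> bool" where
  "prime_in B I \<longleftrightarrow> ideal_in B I \<and> 1 \<notin> I \<and> (\<forall>a\<in>B. \<forall>b\<in>B. a * b \<in> I \<longrightarrow> a \<in> I \<or> b \<in> I)"

text \<open>The \<open>B\<close>-submodule generated by \<open>G\<close>; for \<open>G \<subseteq> B\<close> the ideal generated by \<open>G\<close> (\<open>Idl_ring_on\<close>). As an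
  inductive set it comes with the induction principle by which membership in generated ideals is
  used below, for finite and infinite \<open>G\<close> alike.\<close>

inductive_set lspan :: "'a::comm_ring_1 set \<Rightarrow> 'a set \<Rightarrow> 'a set" for B G where
  zero: "0 \<in> lspan B G"
| step: "b \<in> B \<Longrightarrow> g \<in> G \<Longrightarrow> x \<in> lspan B G \<Longrightarrow> b * g + x \<in> lspan B G"

lemma ring_on_simps [simp]:
  "carrier (ring_on B) = B" "x \<otimes>\<^bsub>ring_on B\<^esub> y = x * y" "\<one>\<^bsub>ring_on B\<^esub> = 1"
  "\<zero>\<^bsub>ring_on B\<^esub> = 0" "x \<oplus>\<^bsub>ring_on B\<^esub> y = x + y"
  by (simp_all add: ring_on_def)

lemma subring_setD:
  assumes "subring_set B"
  shows "1 \<in> B" "0 \<in> B" "x \<in> B \<Longrightarrow> - x \<in> B" "x \<in> B \<Longrightarrow> y \<in> B \<Longrightarrow> x + y \<in> B"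
    "x \<in> B \<Longrightarrow> y \<in> B \<Longrightarrow> x * y \<in> B" "x \<in> B \<Longrightarrow> y \<in> B \<Longrightarrow> x - y \<in> B" "x \<in> B \<Longrightarrow> x ^ k \<in> B"
proof -
  show 1: "1 \<in> B" "x \<in> B \<Longrightarrow> - x \<in> B" "x \<in> B \<Longrightarrow> y \<in> B \<Longrightarrow> x + y \<in> B" "x \<in> B \<Longrightarrow> y \<in> B \<Longrightarrow> x * y \<in> B" for x y
    using assms by (auto simp: subring_set_def)
  show "0 \<in> B" using 1(3)[of 1 "- 1"] 1(1,2) by simp
  show "x \<in> B \<Longrightarrow> y \<in> B \<Longrightarrow> x - y \<in> B" using 1(3)[of x "- y"] 1(2)[of y] by simp
  show "x \<in> B \<Longrightarrow> x ^ k \<in> B" by (induction k) (auto intro: 1)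
qed

lemma subring_set_sum: "subring_set B \<Longrightarrow> (\<And>i. i \<in> I \<Longrightarrow> f i \<in> B) \<Longrightarrow> sum f I \<in> B"
  by (induction I rule: infinite_finite_induct) (auto intro: subring_setD)

lemma subring_set_prod: "subring_set B \<Longrightarrow> (\<And>i. i \<in> I \<Longrightarrow> f i \<in> B) \<Longrightarrow> prod f I \<in> B"
  by (induction I rule: infinite_finite_induct) (auto intro: subring_setD)

lemma cring_ring_on: assumes "subring_set B" shows "cring (ring_on B)"
proof (rule cringI)
  show "abelian_group (ring_on B)"
  proof (rule abelian_groupI)
    fix x assume "x \<in> carrier (ring_on B)"
    then show "\<exists>y\<in>carrier (ring_on B). y \<oplus>\<^bsub>ring_on B\<^esub> x = \<zero>\<^bsub>ring_on B\<^esub>"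
      using assms by (intro bexI[of _ "- x"]) (auto intro: subring_setD)
  qed (use assms in \<open>auto intro: subring_setD simp: algebra_simps\<close>)
  show "Group.comm_monoid (ring_on B)"
    by (rule comm_monoidI) (use assms in \<open>auto intro: subring_setD simp: algebra_simps\<close>)
qed (auto simp: algebra_simps)

lemma ideal_inD:
  assumes "ideal_in B I"
  shows "I \<subseteq> B" "0 \<in> I" "x \<in> I \<Longrightarrow> y \<in> I \<Longrightarrow> x + y \<in> I" "b \<in> B \<Longrightarrow> x \<in> I \<Longrightarrow> b * x \<in> I"
    "b \<in> B \<Longrightarrow> x \<in> I \<Longrightarrow> x * b \<in> I"
  using assms by (auto simp: ideal_in_def mult.commute)

lemma ideal_in_sub: "ideal_in B I \<Longrightarrow> x \<in> I \<Longrightarrow> x \<in> B"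
  by (auto simp: ideal_in_def)

lemma ideal_in_minus:
  assumes "ideal_in B I" "subring_set B" shows "x \<in> I \<Longrightarrow> - x \<in> I" "x \<in> I \<Longrightarrow> y \<in> I \<Longrightarrow> x - y \<in> I"
proof -
  show 1: "x \<in> I \<Longrightarrow> - x \<in> I" for x
    using ideal_inD(4)[OF assms(1), of "- 1" x] assms(2) by (auto intro: subring_setD)
  show "x \<in> I \<Longrightarrow> y \<in> I \<Longrightarrow> x - y \<in> I"
    using ideal_inD(3)[OF assms(1), of x "- y"] 1[of y] by simp
qed

lemma ideal_in_sum: "ideal_in B I \<Longrightarrow> (\<And>i. i \<in> A \<Longrightarrow> f i \<in> I) \<Longrightarrow> sum f A \<in> I"
  by (induction A rule: infinite_finite_induct) (auto intro: ideal_inD)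

lemma ideal_in_eq_carrier: "ideal_in B I \<Longrightarrow> 1 \<in> I \<Longrightarrow> I = B"
  using ideal_inD(4)[of B I _ 1] ideal_inD(1)[of B I] by auto

lemma ideal_ring_on_iff:
  assumes "subring_set B" shows "ideal I (ring_on B) \<longleftrightarrow> ideal_in B I"
proof
  assume "ideal I (ring_on B)"
  then interpret ideal I "ring_on B" .
  show "ideal_in B I"
    using a_subset additive_subgroup.zero_closed[OF is_additive_subgroup]
      additive_subgroup.a_closed[OF is_additive_subgroup] I_l_closed unfolding ideal_in_def by auto
next
  assume I: "ideal_in B I"
  interpret cring "ring_on B" using assms by (rule cring_ring_on)
  show "ideal I (ring_on B)"
  proof (rule idealI)
    show "subgroup I (add_monoid (ring_on B))"
    proof (rule add.subgroupI)
      show "I \<subseteq> carrier (ring_on B)" "I \<noteq> {}" using ideal_inD[OF I] by auto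
      show "\<ominus>\<^bsub>ring_on B\<^esub> a \<in> I" if "a \<in> I" for a
      proof -
        have "\<ominus>\<^bsub>ring_on B\<^esub> a = - a"
          by (rule minus_equality) (use that ideal_in_sub[OF I] subring_setD(3)[OF assms] in auto)
        then show ?thesis using ideal_in_minus[OF I assms] that by simp
      qed
    qed (use ideal_inD[OF I] in auto)
  qed (use ideal_inD[OF I] ring_axioms in auto)
qed

lemma prime_in_ideal: "prime_in B I \<Longrightarrow> ideal_in B I"
  by (simp add: prime_in_def)

lemma prime_in_mult: "prime_in B I \<Longrightarrow> a \<in> B \<Longrightarrow> b \<in> B \<Longrightarrow> a * b \<in> I \<Longrightarrow> a \<in> I \<or> b \<in> I"
  by (simp add: prime_in_def)

lemma prime_in_power: "prime_in B I \<Longrightarrow> subring_set B \<Longrightarrow> a \<in> B \<Longrightarrow> a ^ k \<in> I \<Longrightarrow> a \<in> I"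
  by (induction k) (auto simp: prime_in_def intro: subring_setD)

lemma prime_in_prod:
  "finite A \<Longrightarrow> prime_in B I \<Longrightarrow> subring_set B \<Longrightarrow> (\<And>i. i \<in> A \<Longrightarrow> f i \<in> B) \<Longrightarrow> prod f A \<in> I \<Longrightarrow> \<exists>i\<in>A. f i \<in> I"
proof (induction A rule: finite_induct)
  case (insert i A)
  then have "f i \<in> I \<or> prod f A \<in> I"
    by (intro prime_in_mult[of B]) (auto intro: subring_set_prod)
  with insert show ?case by auto
qed (simp add: prime_in_def)

lemma primeideal_ring_on_iff:
  assumes "subring_set B" shows "primeideal I (ring_on B) \<longleftrightarrow> prime_in B I"
proof
  assume I: "primeideal I (ring_on B)"
  then interpret primeideal I "ring_on B" .
  have "ideal_in B I" using ideal_ring_on_iff[OF assms] is_ideal by simp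
  with I_notcarr I_prime show "prime_in B I"
    using ideal_in_eq_carrier by (fastforce simp: prime_in_def)
next
  assume "prime_in B I"
  then show "primeideal I (ring_on B)"
    using assms subring_setD(1)[OF assms] cring_ring_on[OF assms] ideal_ring_on_iff[OF assms, of I]
    by (intro primeidealI) (auto simp: prime_in_def)
qed

lemma lspan_subset: "ideal_in B I \<Longrightarrow> G \<subseteq> I \<Longrightarrow> lspan B G \<subseteq> I"
proof
  fix x assume "ideal_in B I" "G \<subseteq> I" "x \<in> lspan B G"
  from this(3,1,2) show "x \<in> I" by induction (auto intro: ideal_inD)
qed

lemma lspan_add: "x \<in> lspan B G \<Longrightarrow> y \<in> lspan B G \<Longrightarrow> x + y \<in> lspan B G"
  by (induction rule: lspan.induct) (auto simp: add.assoc intro: lspan.step)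

lemma lspan_scale: "x \<in> lspan B G \<Longrightarrow> subring_set B \<Longrightarrow> b \<in> B \<Longrightarrow> b * x \<in> lspan B G"
  by (induction rule: lspan.induct)
    (auto simp: distrib_left mult.assoc[symmetric] intro: lspan.intros subring_setD)

lemma lspan_base: "subring_set B \<Longrightarrow> g \<in> G \<Longrightarrow> g \<in> lspan B G"
  using lspan.step[of 1 B g G 0] by (auto intro: subring_setD lspan.zero)

lemma lspan_mono: "x \<in> lspan B G \<Longrightarrow> B \<subseteq> B' \<Longrightarrow> G \<subseteq> G' \<Longrightarrow> x \<in> lspan B' G'"
  by (induction rule: lspan.induct) (auto intro: lspan.intros)

lemma lspan_ideal: "subring_set B \<Longrightarrow> G \<subseteq> B \<Longrightarrow> ideal_in B (lspan B G)"
proof -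
  assume *: "subring_set B" "G \<subseteq> B"
  have "x \<in> B" if "x \<in> lspan B G" for x
    using that * by induction (auto intro: subring_setD)
  then show ?thesis using * lspan_add[of _ B G] lspan_scale[of _ B G]
    by (auto simp: ideal_in_def intro: lspan.zero)
qed

lemma lspan_sum: "(\<And>i. i \<in> A \<Longrightarrow> f i \<in> lspan B G) \<Longrightarrow> sum f A \<in> lspan B G"
  by (induction A rule: infinite_finite_induct) (auto intro: lspan.zero lspan_add)

lemma Idl_ring_on:
  assumes "subring_set B" "G \<subseteq> B" shows "Idl\<^bsub>ring_on B\<^esub> G = lspan B G"
proof -
  interpret cring "ring_on B" using assms by (intro cring_ring_on)
  have "ideal (lspan B G) (ring_on B)" using assms lspan_ideal ideal_ring_on_iff by blast
  then have "Idl\<^bsub>ring_on B\<^esub> G \<subseteq> lspan B G"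
    by (rule genideal_minimal) (use assms lspan_base in auto)
  moreover have "ideal_in B (Idl\<^bsub>ring_on B\<^esub> G)" "G \<subseteq> Idl\<^bsub>ring_on B\<^esub> G"
    using genideal_ideal[of G] genideal_self[of G] assms ideal_ring_on_iff by auto
  then have "lspan B G \<subseteq> Idl\<^bsub>ring_on B\<^esub> G" by (rule lspan_subset)
  ultimately show ?thesis by auto
qed

section \<open>Polynomials and monomial ideals\<close>

definition polys :: "'v set \<Rightarrow> ('v, 'k::field) mpoly set" where
  "polys A = {f. \<forall>m\<in>keys f. keys m \<subseteq> A}"

abbreviation cst :: "'k \<Rightarrow> ('v, 'k::field) mpoly" where
  "cst \<equiv> single 0"

lemma mpoly_ring_eq: "mpoly_ring A = ring_on (polys A)"
  by (simp add: mpoly_ring_def ring_on_def polys_def)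

lemma keys_add_nat: "keys (m + l :: 'v \<Rightarrow>\<^sub>0 nat) = keys m \<union> keys l"
  by (auto simp: in_keys_iff lookup_add)

lemma exp_split_var:
  "v \<in> keys m \<Longrightarrow> m = (m - single v 1) + single v (1::nat)"
  by (intro poly_mapping_eqI) (auto simp: lookup_add lookup_minus lookup_single when_def in_keys_iff)

lemma single_in_polys: "keys m \<subseteq> A \<Longrightarrow> single m c \<in> polys A"
  by (simp add: polys_def)

lemma cst_in_polys [simp]: "cst c \<in> polys A"
  by (simp add: polys_def)

lemma var_in_polys: "v \<in> A \<Longrightarrow> var v \<in> polys A"
  by (simp add: polys_def var_def)

lemma keys_minus_eq: "keys (- f :: 'a \<Rightarrow>\<^sub>0 'b::ab_group_add) = keys f"
  by (auto simp: in_keys_iff)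

lemma polys_mult: "f \<in> polys A \<Longrightarrow> g \<in> polys A \<Longrightarrow> f * g \<in> polys A"
  using keys_mult[of f g] by (fastforce simp: polys_def keys_add_nat)

lemma polys_add: "f \<in> polys A \<Longrightarrow> g \<in> polys A \<Longrightarrow> f + g \<in> polys A"
  using keys_add[of f g] by (fastforce simp: polys_def)

lemma subring_polys: "subring_set (polys A)"
  unfolding subring_set_def
  by (auto intro: polys_mult polys_add) (auto simp: polys_def keys_minus_eq)

lemmas polys_one = subring_setD(1)[OF subring_polys]
  and polys_zero = subring_setD(2)[OF subring_polys]
  and polys_diff = subring_setD(6)[OF subring_polys]
  and polys_power = subring_setD(7)[OF subring_polys]
  and polys_sum = subring_set_sum[OF subring_polys]
  and polys_prod = subring_set_prod[OF subring_polys]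

lemma polys_mono: "A \<subseteq> A' \<Longrightarrow> polys A \<subseteq> polys A'"
  by (auto simp: polys_def)

lemma mpoly_eq_sum_single:
  "f = (\<Sum>m\<in>keys f. single m (lookup f m))"
  by (rule poly_mapping_eqI)
    (auto simp: lookup_sum lookup_single when_def in_keys_iff)

lemma polys_induct [consumes 1, case_names single add]:
  assumes "f \<in> polys A"
    and "\<And>m c. keys m \<subseteq> A \<Longrightarrow> Q (single m c)"
    and "\<And>f g. Q f \<Longrightarrow> Q g \<Longrightarrow> Q (f + g)"
  shows "Q f"
proof -
  have "Q (\<Sum>m\<in>M. single m (lookup f m))" if "finite M" "\<forall>m\<in>M. keys m \<subseteq> A" for M
    using that
  proof (induction M rule: finite_induct)
    case empty
    have "Q (single 0 0)" by (rule assms(2)) simp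
    then show ?case by simp
  qed (auto intro: assms(2,3))
  then have "Q (\<Sum>m\<in>keys f. single m (lookup f m))"
    using assms(1) by (simp add: polys_def)
  then show ?thesis by (simp only: mpoly_eq_sum_single[symmetric])
qed

lemma single_eq_prod_var:
  "single m c = cst c * (\<Prod>v\<in>keys m. var v ^ lookup m v)"
proof -
  have pow: "var v ^ k = single (single v k) (1::'b)" for v :: 'a and k
    by (induction k) (simp_all add: var_def mult_single single_add[symmetric])
  have "(\<Prod>v\<in>V. var v ^ lookup m v) = single (\<Sum>v\<in>V. single v (lookup m v)) (1::'b)"
    if "finite V" for V
    using that by (induction V rule: finite_induct) (simp_all add: pow mult_single)
  moreover have "(\<Sum>v\<in>keys m. single v (lookup m v)) = m"
    by (rule poly_mapping_eqI)
      (auto simp: lookup_sum lookup_single when_def in_keys_iff)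
  ultimately show ?thesis by (simp add: mult_single)
qed

lemma polys_subset_subring:
  fixes B :: "('v, 'k::field) mpoly set"
  assumes "subring_set B" "\<And>c. cst c \<in> B" "\<And>v. v \<in> A \<Longrightarrow> var v \<in> B"
  shows "polys A \<subseteq> B"
proof
  fix f :: "('v, 'k) mpoly" assume "f \<in> polys A"
  then show "f \<in> B"
  proof (induction rule: polys_induct)
    case (single m c)
    have "(\<Prod>v\<in>keys m. var v ^ lookup m v) \<in> B"
      using single by (intro subring_set_prod[OF assms(1)] subring_setD(7)[OF assms(1)] assms(3)) auto
    then show ?case
      unfolding single_eq_prod_var[of m c] by (intro subring_setD(5)[OF assms(1)] assms(2))
  next
    case (add f g)
    then show ?case by (rule subring_setD(4)[OF assms(1)])
  qed
qed

text \<open>The exponents of the monomial ideals below are best described by a predicate: whether a polynomial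
  lies in the ideal can then be read off from its monomials one at a time. The set is an ideal when
  \<open>E\<close> is inherited by multiples.\<close>

definition mono_ideal :: "'v set \<Rightarrow> (('v \<Rightarrow>\<^sub>0 nat) \<Rightarrow> bool) \<Rightarrow> ('v, 'k::field) mpoly set" where
  "mono_ideal A E = {f \<in> polys A. \<forall>m\<in>keys f. E m}"

lemma mono_ideal_ideal:
  assumes "\<And>m l. E m \<Longrightarrow> keys l \<subseteq> A \<Longrightarrow> E (m + l)"
  shows "ideal_in (polys A) (mono_ideal A E)"
proof -
  have "b * x \<in> mono_ideal A E" if bx: "b \<in> polys A" "x \<in> mono_ideal A E" for b x
  proof -
    have "E m" if m: "m \<in> keys (b * x)" for m
    proof -
      obtain m1 m2 where *: "m = m1 + m2" "m1 \<in> keys b" "m2 \<in> keys x"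
        using keys_mult[of b x] m by blast
      then have "E (m2 + m1)"
        using bx by (intro assms) (auto simp: mono_ideal_def polys_def)
      then show ?thesis by (simp only: *(1) add.commute)
    qed
    then show ?thesis using bx by (auto simp: mono_ideal_def polys_mult)
  qed
  moreover have "x + y \<in> mono_ideal A E" if "x \<in> mono_ideal A E" "y \<in> mono_ideal A E" for x y
    using that keys_add[of x y] polys_add[of x A y] unfolding mono_ideal_def by blast
  moreover have "mono_ideal A E \<subseteq> polys A" "0 \<in> mono_ideal A E"
    using polys_zero by (auto simp: mono_ideal_def)
  ultimately show ?thesis unfolding ideal_in_def by blast
qed

lemma mono_ideal_mem_single:
  "keys m \<subseteq> A \<Longrightarrow> E m \<Longrightarrow> single m c \<in> mono_ideal A E"
  by (simp add: mono_ideal_def single_in_polys)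

lemma Idl_monomials:
  assumes "\<And>g. g \<in> G \<Longrightarrow> keys g \<subseteq> A"
  shows "Idl\<^bsub>mpoly_ring A\<^esub> ((\<lambda>g. single g (1::'k::field)) ` G) = mono_ideal A (\<lambda>m. \<exists>g\<in>G. \<exists>l. m = g + l)"
proof -
  let ?E = "\<lambda>m. \<exists>g\<in>G. \<exists>l. m = g + l"
  let ?X = "(\<lambda>g. single g (1::'k)) ` G"
  have sub: "?X \<subseteq> polys A" using assms by (auto intro: single_in_polys)
  have "ideal_in (polys A) (mono_ideal A ?E)"
    by (rule mono_ideal_ideal) (metis add.assoc)
  moreover have "?X \<subseteq> mono_ideal A ?E"
    using assms by (force intro!: mono_ideal_mem_single intro: exI[of _ 0])
  ultimately have 1: "lspan (polys A) ?X \<subseteq> mono_ideal A ?E" by (rule lspan_subset)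
  have 2: "mono_ideal A ?E \<subseteq> lspan (polys A) ?X"
  proof
    fix f :: "('a, 'k) mpoly" assume f: "f \<in> mono_ideal A ?E"
    have "single m (lookup f m) \<in> lspan (polys A) ?X" if m: "m \<in> keys f" for m
    proof -
      obtain g l where gl: "g \<in> G" "m = g + l" using f m by (auto simp: mono_ideal_def)
      have "keys m \<subseteq> A" using f m by (auto simp: mono_ideal_def polys_def)
      then have "keys l \<subseteq> A" using gl by (simp add: keys_add_nat)
      then have "single l (lookup f m) * single g 1 \<in> lspan (polys A) ?X"
        using gl by (intro lspan_scale lspan_base subring_polys single_in_polys) auto
      then show ?thesis by (simp add: mult_single gl add.commute)
    qed
    then have "(\<Sum>m\<in>keys f. single m (lookup f m)) \<in> lspan (polys A) ?X"
      by (intro lspan_sum)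
    then show "f \<in> lspan (polys A) ?X" by (simp only: mpoly_eq_sum_single[symmetric])
  qed
  show ?thesis using 1 2 Idl_ring_on[OF subring_polys sub] by (auto simp: mpoly_ring_eq)
qed

definition sqfree_exp :: "'v set \<Rightarrow> 'v \<Rightarrow>\<^sub>0 nat" where
  "sqfree_exp U = (\<Sum>v\<in>U. single v 1)"

lemma lookup_sqfree_exp: "finite U \<Longrightarrow> lookup (sqfree_exp U) w = (if w \<in> U then 1 else 0)"
  by (auto simp: sqfree_exp_def lookup_sum lookup_single when_def)

lemma keys_sqfree_exp: "finite U \<Longrightarrow> keys (sqfree_exp U) = U"
  by (auto simp: in_keys_iff lookup_sqfree_exp split: if_splits)

lemma prod_var_eq_single: "finite U \<Longrightarrow> (\<Prod>v\<in>U. var v) = single (sqfree_exp U) 1"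
  unfolding sqfree_exp_def
  by (induction U rule: finite_induct) (simp_all add: var_def mult_single)

lemma sqfree_exp_dvd:
  assumes "finite U" shows "(\<exists>l. m = sqfree_exp U + l) \<longleftrightarrow> U \<subseteq> keys m"
proof
  assume "U \<subseteq> keys m"
  then have "m = sqfree_exp U + (m - sqfree_exp U)"
    using assms by (intro poly_mapping_eqI)
      (auto simp: lookup_add lookup_minus lookup_sqfree_exp in_keys_iff subset_eq)
  then show "\<exists>l. m = sqfree_exp U + l" ..
qed (use keys_sqfree_exp[OF assms] in \<open>auto simp: keys_add_nat\<close>)

text \<open>A squarefree monomial divides another monomial iff its support is contained in the other support,
  so ideals generated by squarefree monomials depend on supports only.\<close>

lemma Idl_sqfree:
  assumes "\<And>U. U \<in> \<U> \<Longrightarrow> finite U \<and> U \<subseteq> A"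
  shows "Idl\<^bsub>mpoly_ring A\<^esub> {\<Prod>v\<in>U. var v | U. U \<in> \<U>} = mono_ideal A (\<lambda>m. \<exists>U\<in>\<U>. U \<subseteq> keys m)"
proof -
  have "{\<Prod>v\<in>U. var v | U. U \<in> \<U>} = (\<lambda>g. single g (1::'b)) ` sqfree_exp ` \<U>"
    using assms unfolding image_image
    by (subst Setcompr_eq_image) (intro image_cong refl, auto simp: prod_var_eq_single)
  also have "Idl\<^bsub>mpoly_ring A\<^esub> \<dots> = mono_ideal A (\<lambda>m. \<exists>g\<in>sqfree_exp ` \<U>. \<exists>l. m = g + l)"
    by (rule Idl_monomials) (use assms keys_sqfree_exp in blast)
  also have "\<dots> = mono_ideal A (\<lambda>m. \<exists>U\<in>\<U>. U \<subseteq> keys m)"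
    by (simp add: assms sqfree_exp_dvd cong: bex_cong)
  finally show ?thesis .
qed

section \<open>Substitution homomorphisms\<close>

definition mono_val :: "('v \<Rightarrow> ('w, 'k::field) mpoly) \<Rightarrow> ('v \<Rightarrow>\<^sub>0 nat) \<Rightarrow> ('w, 'k) mpoly" where
  "mono_val \<sigma> m = (\<Prod>v\<in>keys m. \<sigma> v ^ lookup m v)"

definition subst :: "('v \<Rightarrow> ('w, 'k::field) mpoly) \<Rightarrow> ('v, 'k) mpoly \<Rightarrow> ('w, 'k) mpoly" where
  "subst \<sigma> f = (\<Sum>m\<in>keys f. cst (lookup f m) * mono_val \<sigma> m)"

lemma mono_val_superset:
  assumes "finite W" "keys m \<subseteq> W"
  shows "mono_val \<sigma> m = (\<Prod>v\<in>W. \<sigma> v ^ lookup m v)"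
  unfolding mono_val_def by (rule prod.mono_neutral_left) (use assms in \<open>auto simp: in_keys_iff\<close>)

lemma mono_val_add: "mono_val \<sigma> (m + l) = mono_val \<sigma> m * mono_val \<sigma> l"
proof -
  let ?W = "keys m \<union> keys l"
  have "mono_val \<sigma> (m + l) = (\<Prod>v\<in>?W. \<sigma> v ^ lookup (m + l) v)"
    by (rule mono_val_superset) (auto simp: keys_add_nat)
  also have "\<dots> = mono_val \<sigma> m * mono_val \<sigma> l"
    using mono_val_superset[of ?W m \<sigma>] mono_val_superset[of ?W l \<sigma>]
    by (simp add: lookup_add power_add prod.distrib)
  finally show ?thesis .
qed

lemma mono_val_single: "mono_val \<sigma> (single v k) = \<sigma> v ^ k"
  by (simp add: mono_val_def)

lemma subst_add: "subst \<sigma> (f + g) = subst \<sigma> f + subst \<sigma> g"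
  unfolding subst_def
  by (rule setsum_keys_plus_distrib) (simp_all add: single_add distrib_right)

lemma subst_single: "subst \<sigma> (single m c) = cst c * mono_val \<sigma> m"
  by (simp add: subst_def)

lemma polys_UNIV: "f \<in> polys UNIV"
  by (simp add: polys_def)

lemma subst_mult:
  fixes \<sigma> :: "'v \<Rightarrow> ('w, 'k::field) mpoly"
  shows "subst \<sigma> (f * g) = subst \<sigma> f * subst \<sigma> g"
  using polys_UNIV[of f]
proof (induction f rule: polys_induct)
  case (single m c)
  show ?case
    using polys_UNIV[of g]
  proof (induction g rule: polys_induct)
    case (single l d)
    have "single (0 :: 'w \<Rightarrow>\<^sub>0 nat) (c * d) = cst c * cst d" by (simp add: mult_single)
    then show ?case
      unfolding mult_single[of m c l d] subst_single mono_val_add by (simp only: mult_ac)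
  next
    case (add f g)
    then show ?case by (simp add: distrib_left subst_add)
  qed
next
  case (add f g)
  then show ?case by (simp add: distrib_right subst_add)
qed

lemma subst_zero [simp]: "subst \<sigma> 0 = 0"
  by (simp add: subst_def)

lemma subst_cst [simp]: "subst \<sigma> (cst c) = cst c"
  by (simp add: subst_single mono_val_def)

lemma subst_one [simp]: "subst \<sigma> 1 = 1"
  using subst_cst[of \<sigma> 1] by simp

lemma subst_var [simp]: "subst \<sigma> (var v) = \<sigma> v"
  by (simp add: var_def subst_single mono_val_single)

lemma subst_minus: "subst \<sigma> (f - g) = subst \<sigma> f - subst \<sigma> g"
  using subst_add[of \<sigma> "f - g" g] by (simp add: algebra_simps)

lemma subst_sum: "subst \<sigma> (sum f I) = (\<Sum>i\<in>I. subst \<sigma> (f i))"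
  by (induction I rule: infinite_finite_induct) (simp_all add: subst_add)

lemma subst_power: "subst \<sigma> (f ^ k) = subst \<sigma> f ^ k"
  by (induction k) (simp_all add: subst_mult)

lemma subst_in_subring:
  fixes B :: "('w, 'k::field) mpoly set"
  assumes "f \<in> polys A" "subring_set B" "\<And>c. cst c \<in> B" "\<And>v. v \<in> A \<Longrightarrow> \<sigma> v \<in> B"
  shows "subst \<sigma> f \<in> B"
  unfolding subst_def mono_val_def
  using assms(1,4)
  by (intro subring_set_sum subring_setD(5) subring_set_prod subring_setD(7) assms(2,3)) (auto simp: polys_def)

lemma subst_subst: "subst \<rho> (subst \<sigma> f) = subst (\<lambda>v. subst \<rho> (\<sigma> v)) f"
  using polys_UNIV[of f]
proof (induction f rule: polys_induct)
  case (single m c)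
  have "subst \<rho> (\<Prod>v\<in>V. \<sigma> v ^ lookup m v) = (\<Prod>v\<in>V. subst \<rho> (\<sigma> v) ^ lookup m v)" for V
    by (induction V rule: infinite_finite_induct) (simp_all add: subst_mult subst_power)
  then show ?case by (simp add: subst_single subst_mult mono_val_def)
qed (simp add: subst_add)

lemma subst_id:
  assumes "f \<in> polys A" "\<And>v. v \<in> A \<Longrightarrow> \<sigma> v = var v"
  shows "subst \<sigma> f = f"
  using assms(1)
proof (induction f rule: polys_induct)
  case (single m c)
  then have "mono_val \<sigma> m = (\<Prod>v\<in>keys m. var v ^ lookup m v)"
    using assms(2) unfolding mono_val_def by (intro prod.cong) auto
  then show ?case unfolding subst_single by (simp only: single_eq_prod_var[of m c])
qed (simp add: subst_add)

text \<open>With linearly ordered variables this follows from comparing leading terms. Pairs over a poset carry no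
  such order, so the finitely many variables are renamed to natural numbers.\<close>

lemma polys_no_zero_divisors:
  fixes f g :: "('v, 'k::field) mpoly"
  assumes "finite A" "f \<in> polys A" "g \<in> polys A" "f * g = 0"
  shows "f = 0 \<or> g = 0"
proof -
  obtain e :: "'v \<Rightarrow> nat" where e: "inj_on e A"
    using finite_imp_inj_to_nat_seg[OF assms(1)] by blast
  define \<sigma> :: "'v \<Rightarrow> (nat, 'k) mpoly" where "\<sigma> = (\<lambda>v. var (e v))"
  define \<rho> :: "nat \<Rightarrow> ('v, 'k) mpoly" where "\<rho> = (\<lambda>i. var (inv_into A e i))"
  have inv: "subst \<rho> (subst \<sigma> h) = h" if "h \<in> polys A" for h
    unfolding subst_subst by (rule subst_id[OF that]) (simp add: \<sigma>_def \<rho>_def e)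
  have "subst \<sigma> f * subst \<sigma> g = 0"
    using assms(4) by (simp flip: subst_mult)
  then have "subst \<sigma> f = 0 \<or> subst \<sigma> g = 0" by simp
  then show ?thesis using inv[OF assms(2)] inv[OF assms(3)] by auto
qed

section \<open>Coordinate primes\<close>

text \<open>The ideal generated by the variables in \<open>T\<close>.\<close>

definition coord_ideal :: "'v set \<Rightarrow> 'v set \<Rightarrow> ('v, 'k::field) mpoly set" where
  "coord_ideal A T = mono_ideal A (\<lambda>m. keys m \<inter> T \<noteq> {})"

definition kill :: "'v set \<Rightarrow> 'v \<Rightarrow> ('v, 'k::field) mpoly" where
  "kill T v = (if v \<in> T then 0 else var v)"

lemma coord_ideal_ideal: "ideal_in (polys A) (coord_ideal A T)"
  unfolding coord_ideal_def by (rule mono_ideal_ideal) (auto simp: keys_add_nat)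

lemma subst_eq_0_single:
  assumes "v \<in> keys m" "\<sigma> v = 0"
  shows "mono_val \<sigma> m = 0"
  unfolding mono_val_def using assms by (intro prod_zero) (auto simp: in_keys_iff power_0_left intro!: bexI[of _ v])

lemma lookup_subst_kill:
  fixes f :: "('a, 'b::field) mpoly"
  shows "lookup (subst (kill T) f) m = (if keys m \<inter> T = {} then lookup f m else 0)"
  using polys_UNIV[of f]
proof (induction f rule: polys_induct)
  case (single l c)
  show ?case
  proof (cases "keys l \<inter> T = {}")
    case True
    have "subst (kill T) (single l c) = single l c"
      by (rule subst_id[of _ "- T"]) (use True in \<open>auto simp: kill_def single_in_polys disjoint_eq_subset_Compl\<close>)
    then show ?thesis using True by (auto simp: lookup_single when_def)
  next
    case False
    then obtain v where "v \<in> keys l" "v \<in> T" by auto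
    then have "mono_val (kill T) l = (0 :: ('a, 'b) mpoly)"
      by (intro subst_eq_0_single[of v]) (auto simp: kill_def)
    then show ?thesis using False by (auto simp: subst_single lookup_single when_def)
  qed
qed (simp add: subst_add lookup_add)

lemma coord_ideal_iff: "f \<in> coord_ideal A T \<longleftrightarrow> f \<in> polys A \<and> subst (kill T) f = 0"
proof -
  have "subst (kill T) f = 0 \<longleftrightarrow> (\<forall>m. keys m \<inter> T = {} \<longrightarrow> lookup f m = 0)"
    by (auto simp: poly_mapping_eq_iff lookup_subst_kill fun_eq_iff split: if_splits)
  then show ?thesis by (auto simp: coord_ideal_def mono_ideal_def in_keys_iff)
qed

text \<open>The ideal is the kernel of the substitution that sets the variables in \<open>T\<close> to zero.\<close>

lemma coord_ideal_prime:
  assumes "finite A" shows "prime_in (polys A) (coord_ideal A T)"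
proof -
  have "a \<in> coord_ideal A T \<or> b \<in> coord_ideal A T"
    if ab: "a \<in> polys A" "b \<in> polys A" "a * b \<in> coord_ideal A T" for a b :: "('a, 'b) mpoly"
  proof -
    have "subst (kill T) f \<in> polys A" if "f \<in> polys A" for f :: "('a, 'b) mpoly"
      by (rule subst_in_subring[OF that subring_polys])
        (auto simp: kill_def var_in_polys polys_zero)
    then show ?thesis
      using polys_no_zero_divisors[OF assms, of "subst (kill T) a" "subst (kill T) b"] ab
      by (auto simp: coord_ideal_iff subst_mult)
  qed
  moreover have "1 \<notin> coord_ideal A T" by (simp add: coord_ideal_iff)
  ultimately show ?thesis by (auto simp: prime_in_def coord_ideal_ideal)
qed

lemma var_in_coord_ideal_iff: "v \<in> A \<Longrightarrow> (var v :: ('v, 'k::field) mpoly) \<in> coord_ideal A T \<longleftrightarrow> v \<in> T"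
  by (auto simp: coord_ideal_def mono_ideal_def var_in_polys) (auto simp: var_def)

lemma coord_ideal_mono: "T \<subseteq> T' \<Longrightarrow> coord_ideal A T \<subseteq> coord_ideal A T'"
  by (auto simp: coord_ideal_def mono_ideal_def)

lemma coord_ideal_strict_mono:
  "T \<subset> T' \<Longrightarrow> T' \<subseteq> A \<Longrightarrow> (coord_ideal A T :: ('v, 'k::field) mpoly set) \<subset> coord_ideal A T'"
  using coord_ideal_mono[of T T' A] var_in_coord_ideal_iff[where 'k='k, of _ A] by blast

text \<open>A monomial with support meeting \<open>T\<close> is a multiple of a variable in \<open>T\<close>.\<close>

lemma coord_ideal_subset:
  assumes "ideal_in (polys A) p" "\<And>v. v \<in> T \<Longrightarrow> var v \<in> p"
  shows "coord_ideal A T \<subseteq> p"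
proof
  fix f :: "('a, 'b) mpoly" assume f: "f \<in> coord_ideal A T"
  have "single m (lookup f m) \<in> p" if m: "m \<in> keys f" for m
  proof -
    obtain v where v: "v \<in> keys m" "v \<in> T"
      using f m by (auto simp: coord_ideal_def mono_ideal_def)
    have mA: "keys m \<subseteq> A" using f m by (auto simp: coord_ideal_def mono_ideal_def polys_def)
    define l where "l = m - single v 1"
    have l: "m = l + single v 1"
      unfolding l_def by (rule exp_split_var[OF v(1)])
    then have "keys l \<subseteq> A" using mA by (simp add: keys_add_nat)
    then have "single l (lookup f m) * var v \<in> p"
      using assms v by (intro ideal_inD(4)[OF assms(1)] single_in_polys) auto
    moreover have "single l (lookup f m) * var v = single m (lookup f m)"
      unfolding var_def mult_single l[symmetric] by simp
    ultimately show ?thesis by simp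
  qed
  then have "(\<Sum>m\<in>keys f. single m (lookup f m)) \<in> p"
    by (rule ideal_in_sum[OF assms(1)])
  then show "f \<in> p" by (simp only: mpoly_eq_sum_single[symmetric])
qed

section \<open>Regular sequences of univariate polynomials in distinct variables\<close>

text \<open>Division by the variable \<open>v\<close>, discarding the monomials that it does not divide. This is a left inverse
  of multiplication by \<open>v\<close> (\<open>shift_var_mult\<close>) and linear over the polynomials without \<open>v\<close> (\<open>shift_mult\<close>).\<close>

definition shift :: "'v \<Rightarrow> ('v, 'k::field) mpoly \<Rightarrow> ('v, 'k) mpoly" where
  "shift v = Poly_Mapping.map_key (\<lambda>m. m + single v 1)"

lemma lookup_shift:
  fixes v :: 'a
  shows "lookup (shift v f) m = lookup f (m + single v 1)"
proof -
  have "inj (\<lambda>m :: 'a \<Rightarrow>\<^sub>0 nat. m + single v 1)" by (auto intro: injI)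
  then show ?thesis by (simp add: shift_def map_key.rep_eq)
qed

lemma shift_add: "shift v (f + g) = shift v f + shift v g"
  by (rule poly_mapping_eqI) (simp add: lookup_shift lookup_add)

lemma shift_0 [simp]: "shift v 0 = 0"
  by (rule poly_mapping_eqI) (simp add: lookup_shift)

lemma shift_sum: "shift v (sum f I) = (\<Sum>i\<in>I. shift v (f i))"
  by (induction I rule: infinite_finite_induct) (simp_all add: shift_add)

lemma shift_in_polys: "f \<in> polys A \<Longrightarrow> shift v f \<in> polys A"
proof -
  assume f: "f \<in> polys A"
  have "keys m \<subseteq> A" if "m \<in> keys (shift v f)" for m
  proof -
    have "m + single v 1 \<in> keys f" using that by (simp add: in_keys_iff lookup_shift)
    then have "keys (m + single v 1) \<subseteq> A" using f by (auto simp: polys_def)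
    then show ?thesis by (simp add: keys_add_nat)
  qed
  then show ?thesis by (auto simp: polys_def)
qed

lemma shift_single:
  "shift v (single m c) =
    (if v \<in> keys m then single (m - single v 1) c else 0)"
proof (cases "v \<in> keys m")
  case True
  have *: "m = (m - single v 1) + single v 1"
    by (rule exp_split_var[OF True])
  have "m = k + single v 1 \<longleftrightarrow> m - single v 1 = k" for k
    by (subst *) simp
  then show ?thesis using True
    by (intro poly_mapping_eqI) (simp add: lookup_shift lookup_single when_def)
next
  case False
  then have "m \<noteq> k + single v 1" for k by (auto simp: keys_add_nat)
  then show ?thesis using False
    by (intro poly_mapping_eqI) (simp add: lookup_shift lookup_single when_def)
qed

lemma shift_var_mult: "shift v (var v * f) = f"
  using polys_UNIV[of f]
proof (induction f rule: polys_induct)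
  case (single m c)
  then show ?case by (simp add: var_def mult_single shift_single keys_add_nat)
qed (simp add: distrib_left shift_add)

lemma shift_mult:
  assumes "h \<in> polys (- {v})" shows "shift v (h * f) = h * shift v f"
  using assms
proof (induction h rule: polys_induct)
  case (single m c)
  show ?case
    using polys_UNIV[of f]
  proof (induction f rule: polys_induct)
    case (single l d)
    have "m + l - single v 1 = m + (l - single v 1)" if "v \<in> keys l"
      using that by (intro poly_mapping_eqI) (auto simp: lookup_add lookup_minus lookup_single when_def in_keys_iff)
    moreover have "v \<notin> keys m" using \<open>keys m \<subseteq> _\<close> by auto
    ultimately show ?case by (simp add: mult_single shift_single keys_add_nat)
  qed (simp add: distrib_left shift_add)
qed (simp add: distrib_right shift_add)

lemma shift_nilpotent: "\<exists>N. \<forall>k\<ge>N. (shift v ^^ k) f = 0"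
  using polys_UNIV[of f]
proof (induction f rule: polys_induct)
  case (single m c)
  have "(shift v ^^ k) (single m c) = 0" if "k > lookup m v" for k m and c :: 'b
    using that
  proof (induction k arbitrary: m)
    case (Suc k)
    have [simp]: "(shift v ^^ k) (0 :: ('a, 'b) mpoly) = 0" for k by (induction k) auto
    show ?case
    proof (cases "v \<in> keys m")
      case True
      then have "lookup (m - single v 1) v < k"
        using Suc.prems by (auto simp: lookup_minus in_keys_iff)
      then show ?thesis using True Suc.IH by (simp add: funpow_Suc_right shift_single del: funpow.simps)
    qed (simp add: funpow_Suc_right shift_single del: funpow.simps)
  qed simp
  then show ?case by (intro exI[of _ "Suc (lookup m v)"]) auto
next
  case (add f g)
  then obtain N N' where "\<forall>k\<ge>N. (shift v ^^ k) f = 0" "\<forall>k\<ge>N'. (shift v ^^ k) g = 0" by auto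
  moreover have "(shift v ^^ k) (f + g) = (shift v ^^ k) f + (shift v ^^ k) g" for k
    by (induction k) (simp_all add: shift_add)
  ultimately show ?case by (intro exI[of _ "max N N'"]) auto
qed

text \<open>Since the generators do not involve \<open>v\<close>, the ideal is stable under \<open>shift v\<close>. Shifting
  \<open>g a = \<Sum> c\<^sub>i v\<^sup>i a\<close> by \<open>N + n\<close> steps turns it into \<open>c\<^sub>n\<close> times the \<open>N\<close>-fold shift of \<open>a\<close> plus higher shifts
  of \<open>a\<close>. High shifts of \<open>a\<close> vanish, so descending induction on \<open>N\<close> puts all shifts of \<open>a\<close>, and finally \<open>a\<close>
  itself, into the ideal.\<close>

lemma univariate_regular:
  fixes c :: "nat \<Rightarrow> 'k::field" and G :: "('v, 'k) mpoly set"
  assumes G: "G \<subseteq> polys A" "G \<subseteq> polys (- {v})"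
    and c: "c n \<noteq> 0"
    and mem: "(\<Sum>i\<le>n. cst (c i) * var v ^ i) * a \<in> lspan (polys A) G"
  shows "a \<in> lspan (polys A) G"
proof -
  let ?I = "lspan (polys A) G"
  have I: "ideal_in (polys A) ?I" by (rule lspan_ideal[OF subring_polys G(1)])
  have shiftI: "shift v f \<in> ?I" if "f \<in> ?I" for f
    using that
  proof induction
    case (step b g x)
    have "shift v (b * g + x) = shift v b * g + shift v x"
      using shift_mult[of g v b] G step unfolding shift_add mult.commute[of b g] mult.commute[of "shift v b" g] by auto
    then show ?case using step by (simp add: lspan.step shift_in_polys)
  qed (auto intro: lspan.zero)
  have shiftkI: "(shift v ^^ k) f \<in> ?I" if "f \<in> ?I" for f k
    by (induction k) (auto intro: shiftI that)
  have shiftk_var: "(shift v ^^ k) (var v ^ i * f) = (shift v ^^ (k - i)) f" if "i \<le> k" for i k f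
    using that
  proof (induction i arbitrary: k)
    case (Suc i)
    then obtain k' where k: "k = Suc k'" by (cases k) auto
    then show ?case using Suc
      by (simp add: funpow_Suc_right shift_var_mult mult.assoc del: funpow.simps)
  qed simp
  have shiftk_cst: "(shift v ^^ k) (cst d * f) = cst d * (shift v ^^ k) f" for k d f
    by (induction k) (simp_all add: shift_mult)
  have shiftk_sum: "(shift v ^^ k) (sum f J) = (\<Sum>i\<in>J. (shift v ^^ k) (f i))" for k f and J :: "nat set"
    by (induction k) (simp_all add: shift_sum)
  obtain N where "\<forall>k\<ge>N. (shift v ^^ k) a = 0" using shift_nilpotent[of v a] by auto
  then have "\<forall>k\<ge>N. (shift v ^^ k) a \<in> ?I" by (simp add: lspan.zero)
  then have "\<forall>k\<ge>0. (shift v ^^ k) a \<in> ?I"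
  proof (induction N)
    case (Suc N)
    have "(shift v ^^ (N + n)) ((\<Sum>i\<le>n. cst (c i) * var v ^ i) * a) = (\<Sum>i\<le>n. cst (c i) * (shift v ^^ (N + n - i)) a)"
      by (simp add: sum_distrib_right shiftk_sum mult.assoc shiftk_cst shiftk_var)
    also have "\<dots> = cst (c n) * (shift v ^^ N) a + (\<Sum>i<n. cst (c i) * (shift v ^^ (N + n - i)) a)"
      by (simp add: lessThan_Suc_atMost[symmetric])
    finally have eq: "cst (c n) * (shift v ^^ N) a =
      (shift v ^^ (N + n)) ((\<Sum>i\<le>n. cst (c i) * var v ^ i) * a) - (\<Sum>i<n. cst (c i) * (shift v ^^ (N + n - i)) a)"
      by (simp add: algebra_simps)
    have "cst (c n) * (shift v ^^ N) a \<in> ?I"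
    proof -
      have "(\<Sum>i<n. cst (c i) * (shift v ^^ (N + n - i)) a) \<in> ?I"
        using Suc.prems by (intro ideal_in_sum[OF I] ideal_inD(4)[OF I]) auto
      then show ?thesis unfolding eq using shiftkI[OF mem] by (intro ideal_in_minus(2)[OF I subring_polys])
    qed
    then have "cst (inverse (c n)) * (cst (c n) * (shift v ^^ N) a) \<in> ?I"
      by (rule ideal_inD(4)[OF I cst_in_polys])
    then have "(shift v ^^ N) a \<in> ?I" using c by (simp add: mult.assoc[symmetric] mult_single)
    then have "(shift v ^^ k) a \<in> ?I" if "k \<ge> N" for k
      using that Suc.prems by (cases "k = N") auto
    then show ?case by (intro Suc.IH) auto
  qed
  from this[rule_format, of 0] show ?thesis by simp
qed

section \<open>Adjoining an element\<close>

definition coeffs_in :: "'a::comm_ring_1 set \<Rightarrow> 'a poly set" where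
  "coeffs_in B = {p. \<forall>i. pcoeff p i \<in> B}"

definition adj :: "'a::comm_ring_1 set \<Rightarrow> 'a \<Rightarrow> 'a set" where
  "adj B x = (\<lambda>p. poly p x) ` coeffs_in B"

lemma subring_coeffs_in: "subring_set B \<Longrightarrow> subring_set (coeffs_in B)"
  unfolding subring_set_def[of "coeffs_in B"]
  by (auto simp: coeffs_in_def coeff_mult Polynomial.coeff_1 intro!: subring_set_sum
      subring_setD(1,2) subring_setD(3) subring_setD(4) subring_setD(5))

lemma monom_in_coeffs_in: "subring_set B \<Longrightarrow> b \<in> B \<Longrightarrow> pmonom b n \<in> coeffs_in B"
  by (auto simp: coeffs_in_def Polynomial.coeff_monom intro: subring_setD(2))

lemma smult_in_coeffs_in: "subring_set B \<Longrightarrow> b \<in> B \<Longrightarrow> p \<in> coeffs_in B \<Longrightarrow> psmult b p \<in> coeffs_in B"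
  by (auto simp: coeffs_in_def intro: subring_setD(5))

lemma const_in_coeffs_in: "subring_set B \<Longrightarrow> b \<in> B \<Longrightarrow> [:b:] \<in> coeffs_in B"
  using monom_in_coeffs_in[of B b 0] by (simp add: Polynomial.monom_0)

lemma coeffs_inD: "p \<in> coeffs_in B \<Longrightarrow> pcoeff p i \<in> B"
  by (simp add: coeffs_in_def)

lemma adj_memI: "p \<in> coeffs_in B \<Longrightarrow> poly p x \<in> adj B x"
  by (simp add: adj_def)

lemma adj_memE: "y \<in> adj B x \<Longrightarrow> (\<And>p. p \<in> coeffs_in B \<Longrightarrow> y = poly p x \<Longrightarrow> thesis) \<Longrightarrow> thesis"
  by (auto simp: adj_def)

lemma subring_adj: assumes "subring_set B" shows "subring_set (adj B x)"
proof -
  note P = subring_setD[OF subring_coeffs_in[OF assms]]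
  have "1 \<in> adj B x" using adj_memI[OF P(1)] by simp
  moreover have "- y \<in> adj B x" if "y \<in> adj B x" for y
    using that adj_memI[OF P(3)] by (auto elim!: adj_memE simp flip: poly_minus)
  moreover have "y + z \<in> adj B x \<and> y * z \<in> adj B x" if "y \<in> adj B x" "z \<in> adj B x" for y z
  proof -
    obtain p q where pq: "p \<in> coeffs_in B" "y = poly p x" "q \<in> coeffs_in B" "z = poly q x"
      using \<open>y \<in> adj B x\<close> \<open>z \<in> adj B x\<close> by (blast elim: adj_memE)
    then show ?thesis
      using adj_memI[OF P(4)[of p q], of x] adj_memI[OF P(5)[of p q], of x] by simp
  qed
  ultimately show ?thesis by (auto simp: subring_set_def)
qed

lemma adj_base: "subring_set B \<Longrightarrow> b \<in> B \<Longrightarrow> b \<in> adj B x"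
  using adj_memI[OF const_in_coeffs_in, of B b x] by simp

lemma adj_gen: "subring_set B \<Longrightarrow> x \<in> adj B x"
  using adj_memI[OF monom_in_coeffs_in, of B 1 1 x] by (simp add: poly_monom subring_setD(1))

lemma poly_in_subring:
  assumes "subring_set C" "p \<in> coeffs_in C" "x \<in> C" shows "poly p x \<in> C"
  unfolding poly_altdef
  by (intro subring_set_sum[OF assms(1)] subring_setD(5)[OF assms(1)] subring_setD(7)[OF assms(1)]
      coeffs_inD[OF assms(2)] assms(3))

lemma coeffs_in_mono: "B \<subseteq> C \<Longrightarrow> p \<in> coeffs_in B \<Longrightarrow> p \<in> coeffs_in C"
  by (auto simp: coeffs_in_def)

lemma adj_subset: "subring_set C \<Longrightarrow> B \<subseteq> C \<Longrightarrow> x \<in> C \<Longrightarrow> adj B x \<subseteq> C"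
  unfolding adj_def by (blast intro: poly_in_subring coeffs_in_mono)

lemma poly_in_ideal:
  assumes "ideal_in C M" "subring_set C" "x \<in> C" "\<And>i. pcoeff p i \<in> M"
  shows "poly p x \<in> M"
  unfolding poly_altdef
  by (intro ideal_in_sum[OF assms(1)] ideal_inD(5)[OF assms(1)] subring_setD(7)[OF assms(2)] assms)

lemma polys_empty: "polys {} = range cst"
proof -
  have "f = cst (lookup f 0)" if "f \<in> polys {}" for f :: "('a, 'b) mpoly"
  proof (rule poly_mapping_eqI)
    fix m
    have "m = 0" if "m \<in> keys f"
      using \<open>f \<in> polys {}\<close> that by (auto simp: polys_def)
    then show "lookup f m = lookup (cst (lookup f 0)) m"
      by (auto simp: lookup_single when_def in_keys_iff)
  qed
  then show ?thesis using cst_in_polys by blast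
qed

section \<open>Hilbert's basis theorem\<close>

definition noeth :: "'a::comm_ring_1 set \<Rightarrow> bool" where
  "noeth B \<longleftrightarrow> (\<forall>I. ideal_in B I \<longrightarrow> (\<exists>G. finite G \<and> G \<subseteq> I \<and> I \<subseteq> lspan B G))"

definition submod_in :: "'a::comm_ring_1 set \<Rightarrow> 'a set \<Rightarrow> bool" where
  "submod_in B N \<longleftrightarrow> 0 \<in> N \<and> (\<forall>x\<in>N. \<forall>y\<in>N. x + y \<in> N) \<and> (\<forall>b\<in>B. \<forall>x\<in>N. b * x \<in> N)"

lemma lspan_subset_submod: "submod_in B N \<Longrightarrow> G \<subseteq> N \<Longrightarrow> lspan B G \<subseteq> N"
proof
  fix x assume "submod_in B N" "G \<subseteq> N" "x \<in> lspan B G"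
  from this(3,1,2) show "x \<in> N" by induction (auto simp: submod_in_def)
qed

lemma lspan_diff: "subring_set B \<Longrightarrow> x \<in> lspan B G \<Longrightarrow> y \<in> lspan B G \<Longrightarrow> x - y \<in> lspan B G"
  using lspan_add[of x B G "- 1 * y"] lspan_scale[of y B G "- 1"] by (simp add: subring_setD(1,3))

lemma lspan_insertE:
  assumes "x \<in> lspan B (insert v V)" "subring_set B"
  obtains b y where "b \<in> B" "y \<in> lspan B V" "x = b * v + y"
proof -
  have "\<exists>b y. b \<in> B \<and> y \<in> lspan B V \<and> x = b * v + y"
    using assms(1)
  proof induction
    case zero
    show ?case by (intro exI[of _ 0]) (simp add: subring_setD(2)[OF assms(2)] lspan.zero)
  next
    case (step b g x)
    then obtain b' y where b': "b' \<in> B" "y \<in> lspan B V" "x = b' * v + y" by auto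
    show ?case
    proof (cases "g = v")
      case True
      then have "b * g + x = (b + b') * v + y" using b' by (simp add: algebra_simps)
      then show ?thesis using b' step subring_setD(4)[OF assms(2)] by blast
    next
      case False
      then have "b * g + y \<in> lspan B V" using b' step by (intro lspan.step) auto
      moreover have "b * g + x = b' * v + (b * g + y)" using b' by (simp add: algebra_simps)
      ultimately show ?thesis using b' by blast
    qed
  qed
  then show thesis using that by blast
qed

text \<open>Induction on the number of generators: the coefficients at a new generator \<open>v\<close> of the elements of \<open>N\<close>
  form an ideal, and once these are matched by finitely many elements of \<open>N\<close>, what remains lies in the
  span of the old generators.\<close>

lemma submodule_finitely_generated:
  assumes B: "noeth B" "subring_set B" and "finite V" "submod_in B N" "N \<subseteq> lspan B V"
  shows "\<exists>G. finite G \<and> G \<subseteq> N \<and> N \<subseteq> lspan B G"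
  using assms(3-5)
proof (induction V arbitrary: N rule: finite_induct)
  case empty
  have "lspan B {} \<subseteq> {0}" by (rule lspan_subset_submod) (auto simp: submod_in_def)
  then show ?case using empty by (intro exI[of _ "{}"]) (auto intro: lspan.zero)
next
  case (insert v V)
  note N = \<open>submod_in B N\<close>[unfolded submod_in_def]
  define I where "I = {b \<in> B. \<exists>y\<in>lspan B V. b * v + y \<in> N}"
  have "ideal_in B I"
    unfolding ideal_in_def
  proof (intro conjI ballI)
    show "I \<subseteq> B" by (auto simp: I_def)
    show "0 \<in> I" unfolding I_def using N by (auto simp: subring_setD(2)[OF B(2)] intro!: bexI[of _ 0] lspan.zero)
    fix a b assume "a \<in> I" "b \<in> I"
    then obtain y z where yz: "a \<in> B" "b \<in> B" "y \<in> lspan B V" "z \<in> lspan B V" "a * v + y \<in> N" "b * v + z \<in> N"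
      by (auto simp: I_def)
    then have "(a * v + y) + (b * v + z) \<in> N" using N by blast
    then have "(a + b) * v + (y + z) \<in> N" by (simp add: algebra_simps)
    then show "a + b \<in> I" using yz lspan_add[of y B V z] subring_setD(4)[OF B(2)] by (auto simp: I_def)
  next
    fix c a assume c: "c \<in> B" and "a \<in> I"
    then obtain y where y: "a \<in> B" "y \<in> lspan B V" "a * v + y \<in> N" by (auto simp: I_def)
    then have "c * (a * v + y) \<in> N" using N c by blast
    then have "(c * a) * v + c * y \<in> N" by (simp add: algebra_simps)
    then show "c * a \<in> I" using y lspan_scale[OF y(2) B(2) c] subring_setD(5)[OF B(2) c] by (auto simp: I_def)
  qed
  then obtain G1 where G1: "finite G1" "G1 \<subseteq> I" "I \<subseteq> lspan B G1" using B(1) by (auto simp: noeth_def)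
  have "\<forall>b\<in>G1. \<exists>w. w \<in> N \<and> w - b * v \<in> lspan B V"
  proof
    fix b assume "b \<in> G1"
    then obtain y where "y \<in> lspan B V" "b * v + y \<in> N" using G1(2) by (auto simp: I_def)
    then show "\<exists>w. w \<in> N \<and> w - b * v \<in> lspan B V" by (intro exI[of _ "b * v + y"]) simp
  qed
  then obtain w where w: "\<And>b. b \<in> G1 \<Longrightarrow> w b \<in> N \<and> w b - b * v \<in> lspan B V" by metis
  have "submod_in B (N \<inter> lspan B V)"
    unfolding submod_in_def using N by (blast intro: lspan.zero lspan_add lspan_scale[OF _ B(2)])
  then obtain G2 where G2: "finite G2" "G2 \<subseteq> N \<inter> lspan B V" "N \<inter> lspan B V \<subseteq> lspan B G2"
    using insert.IH[of "N \<inter> lspan B V"] by auto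
  have wsub: "lspan B (w ` G1) \<subseteq> N" using w insert.prems by (intro lspan_subset_submod) auto
  have "N \<subseteq> lspan B (w ` G1 \<union> G2)"
  proof
    fix x assume x: "x \<in> N"
    then obtain b y where b: "b \<in> B" "y \<in> lspan B V" "x = b * v + y"
      using insert.prems lspan_insertE[OF _ B(2)] by blast
    then have "b \<in> lspan B G1" using G1(3) x by (auto simp: I_def)
    then have "\<exists>u\<in>lspan B (w ` G1). u - b * v \<in> lspan B V"
    proof induction
      case zero
      show ?case by (auto intro!: bexI[of _ 0] lspan.zero)
    next
      case (step c g r)
      then obtain u where u: "u \<in> lspan B (w ` G1)" "u - r * v \<in> lspan B V" by auto
      have "c * (w g - g * v) + (u - r * v) \<in> lspan B V"
        using step w u by (intro lspan_add lspan_scale B) auto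
      then have "(c * w g + u) - (c * g + r) * v \<in> lspan B V" by (simp add: algebra_simps)
      then show ?case using step u by (intro bexI[of _ "c * w g + u"]) (auto intro: lspan.step)
    qed
    then obtain u where u: "u \<in> lspan B (w ` G1)" "u - b * v \<in> lspan B V" by auto
    have eq: "x - u = y - (u - b * v)" using b by simp
    have "x - u \<in> lspan B V" unfolding eq by (rule lspan_diff[OF B(2) b(2) u(2)])
    moreover have "x + (- 1) * u \<in> N"
      using N x u wsub subring_setD(3)[OF B(2) subring_setD(1)[OF B(2)]] by blast
    ultimately have "x - u \<in> lspan B G2" using G2(3) by auto
    then have "u + (x - u) \<in> lspan B (w ` G1 \<union> G2)"
      using u by (intro lspan_add) (auto intro: lspan_mono)
    then show "x \<in> lspan B (w ` G1 \<union> G2)" by simp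
  qed
  then show ?case using G1 G2 w by (intro exI[of _ "w ` G1 \<union> G2"]) auto
qed

text \<open>The classical proof, for any \<open>x\<close>, transcendental over \<open>B\<close> or not: the leading coefficients of the
  polynomials \<open>p\<close> with \<open>p(x) \<in> I\<close> form an ideal of \<open>B\<close>. Its finitely many generators are attained in a common
  degree \<open>N\<close>; they reduce every degree to one below \<open>N\<close>, where the values lie in the finitely generated
  module spanned by \<open>1, x, \<dots>, x\<^bsup>N-1\<^esup>\<close>.\<close>

theorem hilbert_basis:
  assumes B: "noeth B" "subring_set B" shows "noeth (adj B x)"
  unfolding noeth_def
proof (intro allI impI)
  let ?C = "adj B x"
  note P = subring_setD[OF subring_coeffs_in[OF B(2)]]
  note PM = monom_in_coeffs_in[OF B(2)]
  have C: "subring_set ?C" by (rule subring_adj[OF B(2)])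
  have xC: "x \<in> ?C" by (rule adj_gen[OF B(2)])
  fix I assume I: "ideal_in ?C I"
  note ID = ideal_inD[OF I]
  define lead where "lead n b \<longleftrightarrow> (\<exists>p\<in>coeffs_in B. poly p x \<in> I \<and> (\<forall>i>n. pcoeff p i = 0) \<and> pcoeff p n = b)" for n b
  have lead_up: "lead (n + k) b" if lead: "lead n b" for n k b
  proof -
    obtain p where p: "p \<in> coeffs_in B" "poly p x \<in> I" "\<forall>i>n. pcoeff p i = 0" "pcoeff p n = b"
      using lead unfolding lead_def by blast
    have "pmonom 1 k * p \<in> coeffs_in B" using p by (intro P PM subring_setD(1)[OF B(2)])
    moreover have "poly (pmonom 1 k * p) x \<in> I"
      using ID(4)[of "x ^ k" "poly p x"] p subring_setD(7)[OF C xC] by (simp add: poly_monom)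
    moreover have "\<forall>i>n+k. pcoeff (pmonom 1 k * p) i = 0" "pcoeff (pmonom 1 k * p) (n + k) = b"
      using p by (auto simp: coeff_monom_mult)
    ultimately show ?thesis unfolding lead_def by blast
  qed
  have lead_add: "lead n (a + b)" if lead: "lead n a" "lead n b" for n a b
  proof -
    obtain p q where "p \<in> coeffs_in B" "poly p x \<in> I" "\<forall>i>n. pcoeff p i = 0" "pcoeff p n = a"
      "q \<in> coeffs_in B" "poly q x \<in> I" "\<forall>i>n. pcoeff q i = 0" "pcoeff q n = b"
      using lead unfolding lead_def by blast
    then show ?thesis unfolding lead_def by (intro bexI[of _ "p + q"] P) (auto intro: ID)
  qed
  have lead_smult: "lead n (c * b)" if lead: "lead n b" and c: "c \<in> B" for n c b
  proof -
    obtain p where p: "p \<in> coeffs_in B" "poly p x \<in> I" "\<forall>i>n. pcoeff p i = 0" "pcoeff p n = b"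
      using lead unfolding lead_def by blast
    have "poly (psmult c p) x \<in> I" using ID(4)[of c "poly p x"] p adj_base[OF B(2) c] by simp
    then show ?thesis unfolding lead_def using p c smult_in_coeffs_in[OF B(2)]
      by (intro bexI[of _ "psmult c p"]) auto
  qed
  define J where "J = {b \<in> B. \<exists>n. lead n b}"
  have "ideal_in B J"
    unfolding ideal_in_def
  proof (intro conjI ballI)
    show "J \<subseteq> B" by (auto simp: J_def)
    have "lead 0 0" unfolding lead_def by (intro bexI[of _ 0]) (auto simp: ID P)
    then show "0 \<in> J" by (auto simp: J_def subring_setD(2)[OF B(2)])
    fix a b assume ab: "a \<in> J" "b \<in> J"
    then obtain n m where "lead n a" "lead m b" by (auto simp: J_def)
    then have "lead (n + m) (a + b)" using lead_up[of n a m] lead_up[of m b n] lead_add by (simp add: add.commute)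
    then show "a + b \<in> J" using ab subring_setD(4)[OF B(2)] by (auto simp: J_def)
  next
    fix c a assume "c \<in> B" "a \<in> J"
    then show "c * a \<in> J" using lead_smult subring_setD(5)[OF B(2)] by (auto simp: J_def)
  qed
  then obtain G0 where G0: "finite G0" "G0 \<subseteq> J" "J \<subseteq> lspan B G0" using B(1) by (auto simp: noeth_def)
  have "\<exists>N. \<forall>b\<in>G0. lead N b"
    using G0(1,2)
  proof (induction G0 rule: finite_induct)
    case (insert b F)
    then obtain N n where "\<forall>b\<in>F. lead N b" "lead n b" by (auto simp: J_def)
    then show ?case using lead_up[of N _ n] lead_up[of n b N] by (intro exI[of _ "N + n"]) (auto simp: add.commute)
  qed simp
  then obtain N where N: "\<And>b. b \<in> G0 \<Longrightarrow> lead N b" by auto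
  then obtain p where p: "\<And>b. b \<in> G0 \<Longrightarrow> p b \<in> coeffs_in B \<and> poly (p b) x \<in> I \<and>
      (\<forall>i>N. pcoeff (p b) i = 0) \<and> pcoeff (p b) N = b"
    unfolding lead_def by metis
  define V where "V = (\<lambda>i. x ^ i) ` {..<N}"
  have "submod_in B (I \<inter> lspan B V)"
    using ID adj_base[OF B(2)] lspan_add[of _ B V] lspan_scale[OF _ B(2), of _ V]
    by (auto simp: submod_in_def intro: lspan.zero)
  then obtain G2 where G2: "finite G2" "G2 \<subseteq> I \<inter> lspan B V" "I \<inter> lspan B V \<subseteq> lspan B G2"
    using submodule_finitely_generated[OF B, of V "I \<inter> lspan B V"] by (auto simp: V_def)
  define G where "G = (\<lambda>b. poly (p b) x) ` G0 \<union> G2"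
  have BC: "B \<subseteq> ?C" using adj_base[OF B(2)] by auto
  have GI: "G \<subseteq> I" using p G2 by (auto simp: G_def)
  have top: "\<exists>q\<in>coeffs_in B. poly q x \<in> lspan ?C G \<and> (\<forall>i>N. pcoeff q i = 0) \<and> pcoeff q N = b"
    if "b \<in> lspan B G0" for b
    using that
  proof induction
    case zero
    show ?case by (intro bexI[of _ 0]) (auto simp: P lspan.zero)
  next
    case (step c g r)
    then obtain q where q: "q \<in> coeffs_in B" "poly q x \<in> lspan ?C G" "\<forall>i>N. pcoeff q i = 0" "pcoeff q N = r" by auto
    have "c * poly (p g) x + poly q x \<in> lspan ?C G"
      by (rule lspan.step) (use step q BC in \<open>auto simp: G_def\<close>)
    then show ?case using q step p[of g]
      by (intro bexI[of _ "psmult c (p g) + q"] P smult_in_coeffs_in[OF B(2)]) auto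
  qed
  have main: "poly f x \<in> lspan ?C G" if "f \<in> coeffs_in B" "\<forall>i\<ge>n. pcoeff f i = 0" "poly f x \<in> I" for f n
    using that
  proof (induction n arbitrary: f)
    case 0
    then have "f = 0" by (intro poly_eqI) auto
    then show ?case by (simp add: lspan.zero)
  next
    case (Suc k)
    show ?case
    proof (cases "Suc k \<le> N")
      case True
      have "poly f x = (\<Sum>i\<le>k. pcoeff f i * x ^ i)"
      proof (cases "f = 0")
        case False
        then have "pdegree f \<le> k" using Suc.prems by (intro Polynomial.degree_le) auto
        then show ?thesis
          unfolding poly_altdef by (intro sum.mono_neutral_left) (auto simp: coeff_eq_0)
      qed simp
      moreover have "(\<Sum>i\<le>k. pcoeff f i * x ^ i) \<in> lspan B V"
        using True Suc.prems by (intro lspan_sum lspan_scale lspan_base B coeffs_inD) (auto simp: V_def)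
      ultimately have "poly f x \<in> lspan B G2" using G2 Suc.prems by auto
      then show ?thesis using BC by (rule lspan_mono) (auto simp: G_def)
    next
      case False
      define b where "b = pcoeff f k"
      have "lead k b" unfolding lead_def b_def using Suc.prems by (intro bexI[of _ f]) auto
      then have "b \<in> J" using Suc.prems by (auto simp: J_def b_def coeffs_in_def)
      then obtain q where q: "q \<in> coeffs_in B" "poly q x \<in> lspan ?C G" "\<forall>i>N. pcoeff q i = 0" "pcoeff q N = b"
        using G0(3) top by blast
      define q' where "q' = pmonom 1 (k - N) * q"
      have q': "q' \<in> coeffs_in B" unfolding q'_def using q by (intro P PM subring_setD(1)[OF B(2)])
      have q'x: "poly q' x \<in> lspan ?C G"
        using lspan_scale[OF q(2) C subring_setD(7)[OF C xC, of "k - N"]] by (simp add: q'_def poly_monom)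
      then have "poly q' x \<in> I" using lspan_subset[OF I GI] by auto
      then have "poly (f - q') x \<in> I" using Suc.prems ideal_in_minus(2)[OF I C] by simp
      moreover have "\<forall>i\<ge>k. pcoeff (f - q') i = 0"
      proof (intro allI impI)
        fix i assume "i \<ge> k"
        then show "pcoeff (f - q') i = 0"
          using Suc.prems q False by (cases "i = k") (auto simp: q'_def coeff_monom_mult b_def)
      qed
      ultimately have "poly (f - q') x \<in> lspan ?C G" using Suc.IH P(6) Suc.prems q' by blast
      then show ?thesis using lspan_add[OF _ q'x] by fastforce
    qed
  qed
  have "I \<subseteq> lspan ?C G"
  proof
    fix y assume y: "y \<in> I"
    then obtain f where "f \<in> coeffs_in B" "y = poly f x" using ideal_in_sub[OF I] by (blast elim: adj_memE)
    then show "y \<in> lspan ?C G" using main[of f "Suc (pdegree f)"] y by (auto simp: coeff_eq_0)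
  qed
  moreover have "finite G" using G0 G2 by (simp add: G_def)
  ultimately show "\<exists>G. finite G \<and> G \<subseteq> I \<and> I \<subseteq> lspan ?C G" using GI by blast
qed

lemma polys_insert: "polys (insert v A) = adj (polys A) (var v)"
proof
  show "polys (insert v A) \<subseteq> adj (polys A) (var v)"
  proof (rule polys_subset_subring[OF subring_adj[OF subring_polys]])
    show "cst c \<in> adj (polys A) (var v)" for c by (rule adj_base[OF subring_polys]) simp
    show "var w \<in> adj (polys A) (var v)" if "w \<in> insert v A" for w
      using that adj_base[OF subring_polys var_in_polys] adj_gen[OF subring_polys] by auto
  qed
  show "adj (polys A) (var v) \<subseteq> polys (insert v A)"
    by (rule adj_subset[OF subring_polys polys_mono]) (auto intro: var_in_polys)
qed

lemma noeth_polys: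
  assumes "finite A" shows "noeth (polys A :: ('v, 'k::field) mpoly set)"
  using assms
proof (induction A rule: finite_induct)
  case empty
  show ?case
    unfolding noeth_def
  proof (intro allI impI)
    fix I :: "('v, 'k) mpoly set" assume I: "ideal_in (polys {}) I"
    show "\<exists>G. finite G \<and> G \<subseteq> I \<and> I \<subseteq> lspan (polys {}) G"
    proof (cases "I = {0}")
      case True
      then show ?thesis by (intro exI[of _ "{}"]) (auto intro: lspan.zero)
    next
      case False
      then obtain y where y: "y \<in> I" "y \<noteq> 0" using ideal_inD(2)[OF I] by auto
      then obtain d where "y = cst d" using ideal_in_sub[OF I] polys_empty by blast
      then have "cst d \<in> I" "d \<noteq> 0" using y by auto
      then obtain c where c: "cst c \<in> I" "c \<noteq> 0" by blast
      have "I \<subseteq> lspan (polys {}) {cst c}"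
      proof
        fix y assume "y \<in> I"
        then obtain d where "y = cst d" using ideal_in_sub[OF I] polys_empty by blast
        then have "y = cst (d / c) * cst c + 0" using c by (simp add: mult_single)
        moreover have "cst (d / c) * cst c + 0 \<in> lspan (polys {}) {cst c :: ('v, 'k) mpoly}"
          by (rule lspan.step) (auto intro: lspan.zero)
        ultimately show "y \<in> lspan (polys {}) {cst c}" by simp
      qed
      then show ?thesis using c by (intro exI[of _ "{cst c}"]) auto
    qed
  qed
next
  case (insert v A)
  then show ?case unfolding polys_insert by (intro hilbert_basis subring_polys)
qed

section \<open>Zariski's lemma\<close>

text \<open>Inverting the single element \<open>c\<close> turns the image of \<open>B\<close> modulo \<open>M\<close> into a field. This is the property
  of a polynomial ring modulo a maximal ideal that descends along the tower obtained by adjoining one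
  variable at a time; being a field does not descend.\<close>

definition locally_field :: "'a::comm_ring_1 set \<Rightarrow> 'a set \<Rightarrow> bool" where
  "locally_field M B \<longleftrightarrow> (\<exists>c\<in>B - M. \<forall>d\<in>B - M. \<exists>d'\<in>B. \<exists>s. c ^ s - d * d' \<in> M)"

definition algebraic_mod :: "'a::comm_ring_1 set \<Rightarrow> 'a set \<Rightarrow> 'a \<Rightarrow> bool" where
  "algebraic_mod M B x \<longleftrightarrow> (\<exists>p\<in>coeffs_in B. poly p x \<in> M \<and> (\<exists>i. pcoeff p i \<notin> M))"

text \<open>Coefficients matter only modulo \<open>M\<close>, so the degree is replaced by the last index with coefficient
  outside \<open>M\<close>.\<close>

lemma top_coeff_notin:
  assumes "0 \<in> M" "pcoeff p i \<notin> M"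
  obtains n where "pcoeff p n \<notin> M" "\<And>j. j > n \<Longrightarrow> pcoeff p j \<in> M"
proof -
  let ?S = "{i. pcoeff p i \<notin> M}"
  have fin: "finite ?S"
    by (rule finite_subset[of _ "{..pdegree p}"]) (use assms(1) in \<open>auto intro!: le_degree\<close>)
  have "?S \<noteq> {}" using assms(2) by auto
  then have "Max ?S \<in> ?S" using fin by (rule Max_in[rotated])
  moreover have "pcoeff p j \<in> M" if "j > Max ?S" for j
    using Max_ge[OF fin, of j] that by auto
  ultimately show thesis using that by blast
qed

lemma coeff_mult_top:
  assumes M: "ideal_in C M" "subring_set C" and pq: "p \<in> coeffs_in C" "q \<in> coeffs_in C"
    and top: "\<And>i. i > m \<Longrightarrow> pcoeff p i \<in> M" "\<And>i. i > n \<Longrightarrow> pcoeff q i \<in> M"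
  shows "pcoeff (p * q) (m + n) - pcoeff p m * pcoeff q n \<in> M"
proof -
  let ?f = "\<lambda>i. pcoeff p i * pcoeff q (m + n - i)"
  have "pcoeff (p * q) (m + n) = ?f m + (\<Sum>i\<in>{..m + n} - {m}. ?f i)"
    unfolding coeff_mult by (subst sum.remove[of _ m]) auto
  then have eq: "pcoeff (p * q) (m + n) - pcoeff p m * pcoeff q n = (\<Sum>i\<in>{..m + n} - {m}. ?f i)"
    by simp
  have "?f i \<in> M" if "i \<in> {..m + n} - {m}" for i
  proof (cases "i > m")
    case True
    then show ?thesis using ideal_inD(5)[OF M(1) coeffs_inD[OF pq(2)] top(1)] by blast
  next
    case False
    then have "m + n - i > n" using that by auto
    then show ?thesis using ideal_inD(4)[OF M(1) coeffs_inD[OF pq(1)] top(2)] by blast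
  qed
  then show ?thesis unfolding eq by (rule ideal_in_sum[OF M(1)])
qed

lemma coeff_mult_in_ideal:
  assumes "ideal_in C M" "p \<in> coeffs_in C" "\<And>i. pcoeff q i \<in> M"
  shows "pcoeff (p * q) i \<in> M"
  unfolding coeff_mult by (intro ideal_in_sum[OF assms(1)] ideal_inD(4)[OF assms(1)] coeffs_inD[OF assms(2)] assms(3))

lemma pseudo_division:
  assumes B: "subring_set B" and h: "h \<in> coeffs_in B" "pdegree h > 0" and p: "p \<in> coeffs_in B"
  shows "\<exists>s. \<exists>q\<in>coeffs_in B. \<exists>r\<in>coeffs_in B.
    psmult (lead_coeff h ^ s) p = q * h + r \<and> pdegree r < pdegree h"
proof -
  note P = subring_setD[OF subring_coeffs_in[OF B]]
  let ?a = "lead_coeff h" and ?m = "pdegree h"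
  have aB: "?a \<in> B" using h(1) by (rule coeffs_inD)
  have "\<exists>s. \<exists>q\<in>coeffs_in B. \<exists>r\<in>coeffs_in B. psmult (?a ^ s) p = q * h + r \<and> pdegree r < ?m"
    if "p \<in> coeffs_in B" "\<forall>i\<ge>n. pcoeff p i = 0" for n p
    using that
  proof (induction n arbitrary: p)
    case 0
    then have "p = 0" by (intro poly_eqI) auto
    then show ?case using h P(2) by (intro exI[of _ 0] bexI[of _ 0]) auto
  next
    case (Suc n)
    show ?case
    proof (cases "n < ?m")
      case True
      then have "pdegree p < ?m" using Suc.prems by (intro Polynomial.degree_lessI) auto
      then show ?thesis using Suc.prems P(2) by (intro exI[of _ 0] bexI[of _ 0] bexI[of _ p]) auto
    next
      case False
      let ?t = "pmonom (pcoeff p n) (n - ?m)"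
      have t: "?t \<in> coeffs_in B" using Suc.prems by (intro monom_in_coeffs_in[OF B] coeffs_inD)
      define p' where "p' = psmult ?a p - ?t * h"
      have p': "p' \<in> coeffs_in B" unfolding p'_def
        by (intro P(6) P(5) smult_in_coeffs_in[OF B aB] t h(1) Suc.prems(1))
      have "pcoeff p' i = 0" if "i \<ge> n" for i
        using that False Suc.prems(2) by (cases "i = n") (auto simp: p'_def coeff_monom_mult coeff_eq_0 mult.commute[of "pcoeff p n" ?a])
      then obtain s q r where IH: "q \<in> coeffs_in B" "r \<in> coeffs_in B" "psmult (?a ^ s) p' = q * h + r" "pdegree r < ?m"
        using Suc.IH[OF p'] by blast
      have "psmult (?a ^ Suc s) p = (q + psmult (?a ^ s) ?t) * h + r"
      proof -
        have "psmult (?a ^ Suc s) p = psmult (?a ^ s) p' + psmult (?a ^ s) (?t * h)"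
          by (simp add: p'_def smult_diff_right mult.commute)
        then show ?thesis using IH(3) by (simp add: algebra_simps)
      qed
      moreover have "q + psmult (?a ^ s) ?t \<in> coeffs_in B"
        by (intro P(4) smult_in_coeffs_in[OF B] subring_setD(7)[OF B] aB t IH)
      ultimately show ?thesis using IH(2,4) by blast
    qed
  qed
  from this[OF p, of "Suc (pdegree p)"] show ?thesis by (auto simp: coeff_eq_0)
qed

locale residue_setting =
  fixes C M :: "'a::comm_ring_1 set"
  assumes C: "subring_set C" and M: "prime_in C M"
begin

lemma MI: "ideal_in C M" using M by (rule prime_in_ideal)

lemma one_notin: "1 \<notin> M" using M by (simp add: prime_in_def)

lemma mult_notin: "a \<in> C \<Longrightarrow> b \<in> C \<Longrightarrow> a \<notin> M \<Longrightarrow> b \<notin> M \<Longrightarrow> a * b \<notin> M"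
  using prime_in_mult[OF M] by blast

lemma power_notin: "a \<in> C \<Longrightarrow> a \<notin> M \<Longrightarrow> a ^ k \<notin> M"
  using prime_in_power[OF M C] by blast

lemma M_trans: "a - b \<in> M \<Longrightarrow> b - c \<in> M \<Longrightarrow> a - c \<in> M"
  using ideal_inD(3)[OF MI, of "a - b" "b - c"] by simp

lemma M_diff_iff: "a - b \<in> M \<Longrightarrow> a \<in> M \<longleftrightarrow> b \<in> M"
proof -
  assume *: "a - b \<in> M"
  show ?thesis
    using ideal_inD(3)[OF MI *, of b] ideal_in_minus(2)[OF MI C, of a "a - b"] * by auto
qed

lemma M_uminus: "a - b \<in> M \<Longrightarrow> b - a \<in> M"
  using ideal_in_minus(1)[OF MI C, of "a - b"] by simp

lemma M_mult: "a \<in> C \<Longrightarrow> b - c \<in> M \<Longrightarrow> a * b - a * c \<in> M"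
  using ideal_inD(4)[OF MI, of a "b - c"] by (simp add: right_diff_distrib)

text \<open>If \<open>x\<close> were transcendental over \<open>B\<close> modulo \<open>M\<close>, then \<open>1 + x c\<close> would be nonzero, hence divide a power of
  \<open>c\<close>, hence a power of \<open>x c\<close>. Modulo \<open>1 + x c\<close> that power is \<open>\<plusminus>1\<close>, so \<open>1 + x c\<close> would be a unit although it is a
  polynomial of positive degree in \<open>x\<close>.\<close>

lemma algebraic_of_locally_field:
  assumes B: "subring_set B" "B \<subseteq> C" and x: "x \<in> C" and lf: "locally_field M (adj B x)"
  shows "algebraic_mod M B x"
proof (rule ccontr)
  assume "\<not> algebraic_mod M B x"
  then have indep: "pcoeff p i \<in> M" if "p \<in> coeffs_in B" "poly p x \<in> M" for p i
    using that by (auto simp: algebraic_mod_def)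
  note P = subring_setD[OF subring_coeffs_in[OF B(1)]]
  note PC = coeffs_in_mono[OF B(2)]
  have X: "[:0, 1:] \<in> coeffs_in B"
    using monom_in_coeffs_in[OF B(1) subring_setD(1)[OF B(1)], of 1] by (simp add: monom_altdef)
  obtain c where c: "c \<in> adj B x" "c \<notin> M" "\<forall>d\<in>adj B x - M. \<exists>d'\<in>adj B x. \<exists>s. c ^ s - d * d' \<in> M"
    using lf by (auto simp: locally_field_def)
  then obtain cp where cp: "cp \<in> coeffs_in B" "c = poly cp x" by (blast elim: adj_memE)
  have cp_notin: "\<exists>i. pcoeff cp i \<notin> M"
    using poly_in_ideal[OF MI C x, of cp] c(2) cp by auto
  then obtain k where k: "pcoeff cp k \<notin> M" "\<And>j. j > k \<Longrightarrow> pcoeff cp j \<in> M"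
    using top_coeff_notin[OF ideal_inD(2)[OF MI]] by metis
  define w where "w = [:0, 1:] * cp"
  have w: "w \<in> coeffs_in B" unfolding w_def by (intro P X cp)
  have coeff_w: "pcoeff (1 + w) (Suc i) = pcoeff cp i" for i
    by (simp add: w_def)
  have "poly (1 + w) x \<notin> M"
    using indep[of "1 + w" "Suc k"] k P(4)[OF P(1) w] coeff_w by auto
  then have "poly (1 + w) x \<in> adj B x - M" using adj_memI[OF P(4)[OF P(1) w], of x] by blast
  then obtain d' s where d': "d' \<in> adj B x" "c ^ s - poly (1 + w) x * d' \<in> M" using c(3) by blast
  then obtain dp where dp: "dp \<in> coeffs_in B" "d' = poly dp x" by (blast elim: adj_memE)
  \<comment> \<open>multiplying by \<open>x ^ s\<close> turns \<open>c ^ s\<close> into \<open>w ^ s\<close>, and \<open>w\<close> is \<open>- 1\<close> modulo \<open>1 + w\<close>\<close>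
  define Z where "Z = (\<Sum>i<s. (- 1) ^ (s - Suc i) * w ^ i)"
  define E where "E = Z - dp * [:0, 1:] ^ s"
  have E: "E \<in> coeffs_in B"
    unfolding E_def Z_def
    by (intro P(6) P(5) P(7) dp X subring_set_sum[OF subring_coeffs_in[OF B(1)]] P(3)[OF P(1)] w)
  have ws: "w ^ s - (- 1) ^ s = (w - (- 1)) * Z"
    unfolding Z_def by (rule power_diff_sumr2)
  have "poly ((- 1) ^ s + (1 + w) * E) x = x ^ s * (c ^ s - poly (1 + w) x * d')"
  proof -
    have "(- 1) ^ s + (1 + w) * E = w ^ s - (1 + w) * dp * [:0, 1:] ^ s"
      using ws unfolding E_def by (simp add: algebra_simps)
    then have "poly ((- 1) ^ s + (1 + w) * E) x = poly (w ^ s - (1 + w) * dp * [:0, 1:] ^ s) x" by (rule arg_cong)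
    also have "\<dots> = x ^ s * (c ^ s - poly (1 + w) x * d')"
      by (simp add: w_def dp cp power_mult_distrib algebra_simps)
    finally show ?thesis .
  qed
  also have "\<dots> \<in> M" using ideal_inD(4)[OF MI subring_setD(7)[OF C x] d'(2)] .
  finally have inM: "pcoeff ((- 1) ^ s + (1 + w) * E) i \<in> M" for i
    by (rule indep[rotated]) (intro P(4) P(5) P(7) P(3)[OF P(1)] P(1) w E)
  have const: "pcoeff ((- 1) ^ s :: 'a poly) i = (if i = 0 then (- 1) ^ s else 0)" for i
    by (cases "even s") (auto simp: Polynomial.coeff_1)
  show False
  proof (cases "\<exists>i. pcoeff E i \<notin> M")
    case True
    then obtain n where n: "pcoeff E n \<notin> M" "\<And>j. j > n \<Longrightarrow> pcoeff E j \<in> M"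
      using top_coeff_notin[OF ideal_inD(2)[OF MI]] by metis
    have "pcoeff (1 + w) j \<in> M" if "j > Suc k" for j
      using that k(2)[of "j - 1"] coeff_w[of "j - 1"] by simp
    then have "pcoeff ((1 + w) * E) (Suc k + n) - pcoeff (1 + w) (Suc k) * pcoeff E n \<in> M"
      by (intro coeff_mult_top[OF MI C] PC E P(4) P(1) w n) auto
    moreover have "pcoeff ((1 + w) * E) (Suc k + n) \<in> M"
      using inM[of "Suc k + n"] const[of "Suc k + n"] by simp
    ultimately have "pcoeff cp k * pcoeff E n \<in> M"
      using M_diff_iff coeff_w by metis
    then show False using mult_notin k n coeffs_inD[OF PC[OF cp(1)]] coeffs_inD[OF PC[OF E]] by blast
  next
    case False
    then have "pcoeff ((1 + w) * E) 0 \<in> M"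
      by (intro coeff_mult_in_ideal[OF MI] PC P(4) P(1) w) auto
    then have "(- 1) ^ s \<in> M" using inM[of 0] const[of 0] M_diff_iff[of "(- 1) ^ s + pcoeff ((1 + w) * E) 0" "(- 1) ^ s"] by simp
    then show False using power_notin[of "- 1" s] one_notin C ideal_in_minus(1)[OF MI C, of "- 1"] subring_setD(1,3)[OF C] by auto
  qed
qed

text \<open>Let \<open>F\<close> be a relation of least degree for \<open>x\<close> over \<open>B\<close>, with leading coefficient \<open>l\<close>, so that lower powers
  of \<open>x\<close> are linearly independent. By Euclid's algorithm the inverted element \<open>c1\<close> of \<open>B[x]\<close> has a nonzero
  multiple \<open>b\<close> in \<open>B\<close>. For nonzero \<open>d \<in> B\<close> some power of \<open>b\<close> is then a multiple \<open>d y\<close> with \<open>y \<in> B[x]\<close>.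
  Reducing \<open>y\<close> modulo \<open>F\<close> at the cost of a power of \<open>l\<close>, and comparing the coefficients of \<open>x\<^sup>0\<close>, replaces
  \<open>y\<close> by an element of \<open>B\<close>; hence \<open>l b\<close> can be inverted instead of \<open>c1\<close>.\<close>

lemma locally_field_descend:
  assumes B: "subring_set B" "B \<subseteq> C" and x: "x \<in> C" and lf: "locally_field M (adj B x)"
  shows "locally_field M B"
proof -
  note P = subring_setD[OF subring_coeffs_in[OF B(1)]]
  note PC = coeffs_in_mono[OF B(2)]
  note adjC = adj_subset[OF C B(2) x]
  note R = subring_setD[OF subring_adj[OF B(1), of x]]
  have evalC: "poly p x \<in> C" if "p \<in> coeffs_in B" for p
    using adj_memI[OF that, of x] adjC by blast
  \<comment> \<open>a polynomial of least degree among those that vanish modulo \<open>M\<close> with leading coefficient outside \<open>M\<close>\<close>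
  define rel where "rel p \<longleftrightarrow> p \<in> coeffs_in B \<and> poly p x \<in> M \<and> lead_coeff p \<notin> M" for p
  have truncate: "\<exists>p'. rel p' \<and> pdegree p' = n"
    if p: "p \<in> coeffs_in B" "poly p x \<in> M" "pcoeff p n \<notin> M" "\<And>j. j > n \<Longrightarrow> pcoeff p j \<in> M" for p n
  proof -
    define p' where "p' = poly_cutoff (Suc n) p"
    have co: "pcoeff p' i = (if i \<le> n then pcoeff p i else 0)" for i
      by (simp add: p'_def coeff_poly_cutoff less_Suc_eq_le)
    have p': "p' \<in> coeffs_in B" using p(1) subring_setD(2)[OF B(1)] by (auto simp: coeffs_in_def co)
    have "poly (p - p') x \<in> M"
      by (rule poly_in_ideal[OF MI C x]) (use p co ideal_inD(2)[OF MI] in auto)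
    then have "poly p' x \<in> M" using M_diff_iff[of "poly p x" "poly p' x"] p(2) by simp
    moreover have "pdegree p' = n"
    proof (rule antisym)
      show "pdegree p' \<le> n" by (rule Polynomial.degree_le) (simp add: co)
      have "pcoeff p n \<noteq> 0" using p(3) ideal_inD(2)[OF MI] by auto
      then show "n \<le> pdegree p'" by (intro le_degree) (simp add: co)
    qed
    ultimately show ?thesis using p' p(3) by (intro exI[of _ p']) (auto simp: rel_def co)
  qed
  have "\<exists>p. rel p"
  proof -
    obtain p i where p: "p \<in> coeffs_in B" "poly p x \<in> M" "pcoeff p i \<notin> M"
      using algebraic_of_locally_field[OF assms] by (auto simp: algebraic_mod_def)
    obtain n where "pcoeff p n \<notin> M" "\<And>j. j > n \<Longrightarrow> pcoeff p j \<in> M"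
      using top_coeff_notin[OF ideal_inD(2)[OF MI] p(3)] by blast
    then show ?thesis using truncate[OF p(1,2)] by blast
  qed
  then obtain F where F: "rel F" "\<And>p. rel p \<Longrightarrow> pdegree F \<le> pdegree p"
    using ex_has_least_nat[of rel _ pdegree] by blast
  let ?e = "pdegree F" and ?lF = "lead_coeff F"
  have FB: "F \<in> coeffs_in B" and Fx: "poly F x \<in> M" and a0: "?lF \<notin> M" using F(1) by (auto simp: rel_def)
  have a0B: "?lF \<in> B" using FB by (rule coeffs_inD)
  have indep: "\<exists>n\<ge>?e. pcoeff p n \<notin> M \<and> (\<forall>j>n. pcoeff p j \<in> M)"
    if p: "p \<in> coeffs_in B" "poly p x \<in> M" "pcoeff p i \<notin> M" for p i
  proof -
    obtain n where n: "pcoeff p n \<notin> M" "\<And>j. j > n \<Longrightarrow> pcoeff p j \<in> M"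
      using top_coeff_notin[OF ideal_inD(2)[OF MI] p(3)] by blast
    obtain p' where "rel p'" "pdegree p' = n" using truncate[OF p(1,2) n] by blast
    then show ?thesis using F(2) n by blast
  qed
  have e: "?e > 0"
  proof (rule ccontr)
    assume "\<not> ?e > 0"
    then obtain a where "F = [:a:]" using degree_eq_zeroE by blast
    then show False using Fx a0 by simp
  qed
  obtain c1 where c1: "c1 \<in> adj B x" "c1 \<notin> M" "\<forall>d\<in>adj B x - M. \<exists>d'\<in>adj B x. \<exists>s. c1 ^ s - d * d' \<in> M"
    using lf by (auto simp: locally_field_def)
  \<comment> \<open>the nonzero multiples of \<open>c1\<close>; one of least degree turns out to be a constant\<close>
  define mul where "mul h \<longleftrightarrow> h \<in> coeffs_in B \<and> poly h x \<notin> M \<and> (\<exists>z\<in>adj B x. poly h x - z * c1 \<in> M)" for h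
  have "\<exists>h. mul h"
  proof -
    obtain cp where "cp \<in> coeffs_in B" "c1 = poly cp x" using c1(1) by (blast elim: adj_memE)
    then show ?thesis using c1(2) R(1) ideal_inD(2)[OF MI] unfolding mul_def by (intro exI[of _ cp]) (auto intro!: bexI[of _ 1])
  qed
  then obtain h where h: "mul h" "\<And>p. mul p \<Longrightarrow> pdegree h \<le> pdegree p"
    using ex_has_least_nat[of mul _ pdegree] by blast
  then obtain z where hB: "h \<in> coeffs_in B" and hx: "poly h x \<notin> M" and z: "z \<in> adj B x" "poly h x - z * c1 \<in> M"
    by (auto simp: mul_def)
  have "pdegree h = 0"
  proof (rule ccontr)
    assume "pdegree h \<noteq> 0"
    then have m: "pdegree h > 0" by simp
    let ?m = "pdegree h" and ?a = "lead_coeff h"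
    have aB: "?a \<in> B" using hB by (rule coeffs_inD)
    have a: "?a \<notin> M"
    proof
      assume aM: "?a \<in> M"
      define h' where "h' = h - pmonom ?a ?m"
      have h': "h' \<in> coeffs_in B" unfolding h'_def by (intro P(6) monom_in_coeffs_in[OF B(1) aB] hB)
      have d: "poly h' x - poly h x \<in> M"
        using ideal_in_minus(1)[OF MI C ideal_inD(5)[OF MI subring_setD(7)[OF C x] aM]] by (simp add: h'_def poly_monom)
      then have "mul h'" unfolding mul_def using h' hx M_diff_iff z M_trans by blast
      moreover have "pdegree h' < ?m"
        using m by (intro Polynomial.degree_lessI) (auto simp: h'_def coeff_eq_0)
      ultimately show False using h(2) by fastforce
    qed
    have "?m < ?e"
    proof (rule ccontr)
      assume "\<not> ?m < ?e"
      obtain s q r where r: "q \<in> coeffs_in B" "r \<in> coeffs_in B" "psmult (?lF ^ s) h = q * F + r" "pdegree r < ?e"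
        using pseudo_division[OF B(1) FB e hB] by blast
      have s: "?lF ^ s \<in> B" "?lF ^ s \<in> C" "?lF ^ s \<notin> M"
        using subring_setD(7)[OF B(1) a0B] B(2) power_notin[OF _ a0] a0B by auto
      have "?lF ^ s * poly h x = poly q x * poly F x + poly r x"
        using arg_cong[OF r(3), of "\<lambda>p. poly p x"] by simp
      then have d: "?lF ^ s * poly h x - poly r x \<in> M"
        using ideal_inD(4)[OF MI evalC[OF r(1)] Fx] by simp
      have "poly r x \<notin> M" using M_diff_iff[OF d] mult_notin[OF s(2) evalC[OF hB] s(3) hx] by simp
      moreover have "poly r x - (?lF ^ s * z) * c1 \<in> M"
        using M_trans[OF M_uminus[OF d] M_mult[OF s(2) z(2)]] by (simp add: mult.assoc)
      moreover have "?lF ^ s * z \<in> adj B x" using R(5) adj_base[OF B(1) s(1)] z(1) by blast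
      ultimately have "mul r" using r(2) unfolding mul_def by blast
      then show False using h(2)[of r] r(4) \<open>\<not> ?m < ?e\<close> by simp
    qed
    obtain s q r where r: "q \<in> coeffs_in B" "r \<in> coeffs_in B" "psmult (?a ^ s) F = q * h + r" "pdegree r < ?m"
      using pseudo_division[OF B(1) hB m FB] by blast
    have s: "?a ^ s \<in> B" "?a ^ s \<in> C" "?a ^ s \<notin> M"
      using subring_setD(7)[OF B(1) aB] B(2) power_notin[OF _ a] aB by auto
    have "?a ^ s * poly F x = poly q x * poly h x + poly r x"
      using arg_cong[OF r(3), of "\<lambda>p. poly p x"] by simp
    then have d: "poly r x - (- poly q x) * poly h x \<in> M"
      using ideal_inD(4)[OF MI s(2) Fx] by (simp add: add.commute)
    have "\<not> mul r" using h(2)[of r] r(4) by auto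
    moreover have "poly r x - (- poly q x * z) * c1 \<in> M"
      using M_trans[OF d M_mult[OF _ z(2), of "- poly q x"]] evalC[OF r(1)] subring_setD(3)[OF C] by (simp add: mult.assoc)
    moreover have "- poly q x * z \<in> adj B x" using R(3,5) adj_memI[OF r(1)] z(1) by blast
    ultimately have "poly r x \<in> M" using r(2) unfolding mul_def by blast
    then have "- poly q x * poly h x \<in> M" using M_diff_iff[OF d] by simp
    then have "poly q x * poly h x \<in> M" using ideal_in_minus(1)[OF MI C, of "- poly q x * poly h x"] by simp
    then have qM: "poly q x \<in> M" using prime_in_mult[OF M evalC[OF r(1)] evalC[OF hB]] hx by blast
    have coeffs: "?a ^ s * pcoeff F i = pcoeff (q * h) i + pcoeff r i" for i
      using arg_cong[OF r(3), of "\<lambda>p. pcoeff p i"] by simp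
    show False
    proof (cases "\<exists>i. pcoeff q i \<notin> M")
      case True
      then obtain n where n: "n \<ge> ?e" "pcoeff q n \<notin> M" "\<forall>j>n. pcoeff q j \<in> M"
        using indep[OF r(1) qM] by blast
      have "pcoeff (q * h) (n + ?m) - pcoeff q n * ?a \<in> M"
        by (rule coeff_mult_top[OF MI C PC[OF r(1)] PC[OF hB]])
          (use n ideal_inD(2)[OF MI] in \<open>auto simp: coeff_eq_0\<close>)
      moreover have "pcoeff (q * h) (n + ?m) = 0"
        using coeffs[of "n + ?m"] n(1) m r(4) by (simp add: coeff_eq_0)
      ultimately have "pcoeff q n * ?a \<in> M" using M_diff_iff ideal_inD(2)[OF MI] by metis
      then show False using mult_notin n(2) a aB B(2) coeffs_inD[OF PC[OF r(1)]] by blast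
    next
      case False
      then have "pcoeff (q * h) ?e \<in> M"
        using coeff_mult_in_ideal[OF MI PC[OF hB], of q ?e] by (simp add: mult.commute)
      then have "?a ^ s * ?lF \<in> M" using coeffs[of ?e] r(4) \<open>?m < ?e\<close> by (simp add: coeff_eq_0)
      then show False using mult_notin s a0 a0B B(2) by blast
    qed
  qed
  then obtain b where "h = [:b:]" using degree_eq_zeroE by blast
  then have b: "b \<in> B" "b \<notin> M" "b - z * c1 \<in> M" using hB hx z coeffs_inD[OF hB, of 0] by auto
  have bC: "b \<in> C" and a0C: "?lF \<in> C" using b a0B B by auto
  have "\<exists>d'\<in>B. \<exists>s. (?lF * b) ^ s - d * d' \<in> M" if d: "d \<in> B - M" for d
  proof -
    have dC: "d \<in> C" using d B by auto
    have "d \<in> adj B x - M" using d adj_base[OF B(1)] by blast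
    then obtain d' s where d': "d' \<in> adj B x" "c1 ^ s - d * d' \<in> M" using c1(3) by blast
    have d'C: "d' \<in> C" and zC: "z \<in> C" and c1C: "c1 \<in> C" using d' z c1 adjC by auto
    have "b ^ s - (z * c1) ^ s \<in> M"
    proof -
      have "b ^ s - (z * c1) ^ s = (\<Sum>i<s. (z * c1) ^ (s - Suc i) * b ^ i) * (b - z * c1)"
        by (subst power_diff_sumr2) (rule mult.commute)
      moreover have "(\<Sum>i<s. (z * c1) ^ (s - Suc i) * b ^ i) \<in> C"
        by (intro subring_set_sum[OF C] subring_setD(5)[OF C] subring_setD(7)[OF C] zC c1C bC)
      ultimately show ?thesis using ideal_inD(4)[OF MI _ b(3)] by simp
    qed
    moreover have "(z * c1) ^ s - d * (z ^ s * d') \<in> M"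
      using M_mult[OF subring_setD(7)[OF C zC, of s] d'(2)] by (simp add: power_mult_distrib mult.left_commute)
    ultimately have 1: "b ^ s - d * (z ^ s * d') \<in> M" by (rule M_trans)
    have "z ^ s * d' \<in> adj B x" by (intro R(5) R(7) z d')
    then obtain yp where yp: "yp \<in> coeffs_in B" "z ^ s * d' = poly yp x" by (blast elim: adj_memE)
    obtain t q r where r: "q \<in> coeffs_in B" "r \<in> coeffs_in B" "psmult (?lF ^ t) yp = q * F + r" "pdegree r < ?e"
      using pseudo_division[OF B(1) FB e yp(1)] by blast
    have tC: "?lF ^ t \<in> C" "?lF ^ t \<in> B" using subring_setD(7)[OF C a0C] subring_setD(7)[OF B(1) a0B] by auto
    have "?lF ^ t * poly yp x = poly q x * poly F x + poly r x"
      using arg_cong[OF r(3), of "\<lambda>p. poly p x"] by simp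
    then have "?lF ^ t * poly yp x - poly r x \<in> M"
      using ideal_inD(4)[OF MI evalC[OF r(1)] Fx] by simp
    from M_mult[OF dC this] have 2: "d * (?lF ^ t * poly yp x) - d * poly r x \<in> M" .
    have "?lF ^ t * b ^ s - d * (?lF ^ t * poly yp x) \<in> M"
      using M_mult[OF tC(1) 1] yp(2) by (simp add: mult.left_commute)
    from M_trans[OF this 2] have 3: "?lF ^ t * b ^ s - d * poly r x \<in> M" .
    define g where "g = [:?lF ^ t * b ^ s:] - psmult d r"
    have g: "g \<in> coeffs_in B" unfolding g_def
      by (intro P(6) const_in_coeffs_in[OF B(1)] smult_in_coeffs_in[OF B(1)] subring_setD(5)[OF B(1)] subring_setD(7)[OF B(1)] r b a0B)
        (use d in auto)
    have "pcoeff g 0 \<in> M"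
    proof (rule ccontr)
      assume "pcoeff g 0 \<notin> M"
      moreover have "poly g x \<in> M" using 3 by (simp add: g_def)
      ultimately obtain n where n: "n \<ge> ?e" "pcoeff g n \<notin> M" using indep[OF g] by blast
      have "pcoeff g n = 0" using n(1) r(4) e by (cases n) (auto simp: g_def coeff_eq_0)
      then show False using n(2) ideal_inD(2)[OF MI] by simp
    qed
    then have 4: "?lF ^ t * b ^ s - d * pcoeff r 0 \<in> M" by (simp add: g_def)
    have "(?lF * b) ^ (s + t) - d * (?lF ^ s * b ^ t * pcoeff r 0) \<in> M"
      using M_mult[OF _ 4, of "?lF ^ s * b ^ t"] subring_setD(5,7)[OF C] a0C bC
      by (simp add: power_mult_distrib power_add mult_ac)
    moreover have "?lF ^ s * b ^ t * pcoeff r 0 \<in> B"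
      by (intro subring_setD(5)[OF B(1)] subring_setD(7)[OF B(1)] a0B b coeffs_inD[OF r(2)])
    ultimately show ?thesis by blast
  qed
  moreover have "?lF * b \<in> B - M" using subring_setD(5)[OF B(1) a0B b(1)] mult_notin[OF a0C bC a0 b(2)] by blast
  ultimately show ?thesis unfolding locally_field_def by blast
qed

end

text \<open>Modulo the maximal ideal the whole polynomial ring is a field. The property \<open>locally_field\<close> descends
  through the tower \<open>k[x] \<subseteq> k[x][v\<^sub>1] \<subseteq> \<dots>\<close> down to \<open>k[x]\<close>, so \<open>x\<close> is algebraic modulo the ideal.\<close>

theorem zariski:
  fixes M :: "('v, 'k::field) mpoly set"
  assumes A: "finite A" and M: "prime_in (polys A) M"
    and max: "\<And>a. a \<in> polys A \<Longrightarrow> a \<notin> M \<Longrightarrow> \<exists>b\<in>polys A. 1 - a * b \<in> M"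
    and x: "x \<in> polys A"
  shows "\<exists>n c. c n \<noteq> 0 \<and> (\<Sum>i\<le>n. cst (c i) * x ^ i) \<in> M"
proof -
  interpret residue_setting "polys A" M by unfold_locales (rule subring_polys, rule M)
  let ?K = "range cst :: ('v, 'k) mpoly set"
  have K: "subring_set ?K"
    unfolding polys_empty[symmetric] by (rule subring_polys)
  have KA: "?K \<subseteq> polys A" by auto
  define tower where "tower = (\<lambda>vs. foldr (\<lambda>v B. adj B (var v)) vs (adj ?K x))"
  have tower: "subring_set (tower vs) \<and> tower vs \<subseteq> polys A" if "set vs \<subseteq> A" for vs
    using that
  proof (induction vs)
    case Nil
    then show ?case unfolding tower_def using subring_adj[OF K] adj_subset[OF subring_polys KA x] by simp
  next
    case (Cons v vs)
    then have "subring_set (tower vs) \<and> tower vs \<subseteq> polys A" by simp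
    then show ?case
      using subring_adj[of "tower vs" "var v"] adj_subset[OF subring_polys, of "tower vs" A "var v"] var_in_polys[of v A] Cons.prems
      by (simp add: tower_def)
  qed
  have down: "locally_field M (adj ?K x)" if "set vs \<subseteq> A" "locally_field M (tower vs)" for vs
    using that
  proof (induction vs)
    case (Cons v vs)
    then have lf: "locally_field M (adj (tower vs) (var v))" by (simp add: tower_def)
    have "locally_field M (tower vs)"
      by (rule locally_field_descend[OF _ _ _ lf]) (use tower[of vs] var_in_polys[of v A] Cons.prems in auto)
    then show ?case using Cons by simp
  qed (simp add: tower_def)
  obtain vs where vs: "set vs = A" using finite_list[OF A] by blast
  have mem: "adj ?K x \<subseteq> tower vs \<and> (\<forall>v\<in>set vs. var v \<in> tower vs)" if "set vs \<subseteq> A" for vs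
    using that
  proof (induction vs)
    case (Cons v vs)
    then have t: "subring_set (tower vs)" using tower[of vs] by simp
    have "tower (v # vs) = adj (tower vs) (var v)" by (simp add: tower_def)
    then show ?case using Cons adj_base[OF t, of _ "var v"] adj_gen[OF t, of "var v"] by auto
  qed (simp add: tower_def)
  have "polys A \<subseteq> tower vs"
    by (rule polys_subset_subring) (use tower[of vs] mem[of vs] vs adj_base[OF K, of _ x] in auto)
  then have "tower vs = polys A" using tower[of vs] vs by auto
  moreover have "locally_field M (polys A)"
    unfolding locally_field_def
  proof (rule bexI[of _ 1], rule ballI)
    fix d assume "d \<in> polys A - M"
    then obtain b where "b \<in> polys A" "1 - d * b \<in> M" using max by blast
    then show "\<exists>d'\<in>polys A. \<exists>s. 1 ^ s - d * d' \<in> M" by auto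
  qed (use one_notin polys_one in blast)
  ultimately have "locally_field M (adj ?K x)" using down[of vs] vs by simp
  then have "algebraic_mod M ?K x"
    by (rule algebraic_of_locally_field[OF K KA x])
  then obtain p i where p: "p \<in> coeffs_in ?K" "poly p x \<in> M" "pcoeff p i \<notin> M" by (auto simp: algebraic_mod_def)
  then have "p \<noteq> 0" using ideal_inD(2)[OF MI] by auto
  have "\<forall>i. \<exists>c. pcoeff p i = cst c" using coeffs_inD[OF p(1)] by auto
  then obtain c where c: "\<And>i. pcoeff p i = cst (c i)" by metis
  then have "c (pdegree p) \<noteq> 0" using \<open>p \<noteq> 0\<close> leading_coeff_0_iff[of p] by auto
  moreover have "(\<Sum>i\<le>pdegree p. cst (c i) * x ^ i) \<in> M" using p(2) by (simp add: poly_altdef c)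
  ultimately show ?thesis by blast
qed

section \<open>Chains of primes in a polynomial ring\<close>

definition deg_box :: "'v set \<Rightarrow> nat \<Rightarrow> ('v, 'k::field) mpoly set" where
  "deg_box A e = {f \<in> polys A. \<forall>m\<in>keys f. \<forall>v. lookup m v \<le> e}"

lemma deg_box_mult: "f \<in> deg_box A e \<Longrightarrow> g \<in> deg_box A e' \<Longrightarrow> f * g \<in> deg_box A (e + e')"
proof -
  assume f: "f \<in> deg_box A e" and g: "g \<in> deg_box A e'"
  have "lookup m v \<le> e + e'" if m: "m \<in> keys (f * g)" for m v
  proof -
    obtain a b where "m = a + b" "a \<in> keys f" "b \<in> keys g"
      using keys_mult[of f g] m by blast
    then show ?thesis using f g by (auto simp: deg_box_def lookup_add intro: add_mono)
  qed
  then show ?thesis using f g by (simp add: deg_box_def polys_mult)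
qed

lemma deg_box_one: "1 \<in> deg_box A e"
  by (simp add: deg_box_def polys_one)

lemma deg_box_power: "f \<in> deg_box A e \<Longrightarrow> f ^ k \<in> deg_box A (k * e)"
  by (induction k) (auto simp: deg_box_one intro: deg_box_mult)

lemma deg_box_prod:
  "finite I \<Longrightarrow> (\<And>i. i \<in> I \<Longrightarrow> f i \<in> deg_box A (e i)) \<Longrightarrow> prod f I \<in> deg_box A (sum e I)"
  by (induction I rule: finite_induct) (auto simp: deg_box_one intro: deg_box_mult)

lemma deg_box_mono: "e \<le> e' \<Longrightarrow> deg_box A e \<subseteq> deg_box A e'"
  unfolding deg_box_def using le_trans by blast

lemma ex_deg_box: assumes "f \<in> polys A" shows "\<exists>e. f \<in> deg_box A e"
  using assms
proof (induction f rule: polys_induct)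
  case (single m c)
  have "\<exists>e. \<forall>v. lookup m v \<le> e"
  proof (intro exI allI)
    fix v
    show "lookup m v \<le> Max (insert 0 (lookup m ` keys m))"
      by (cases "v \<in> keys m") (auto simp: in_keys_iff)
  qed
  then show ?case using single by (auto simp: deg_box_def single_in_polys)
next
  case (add f g)
  then obtain e e' where "f \<in> deg_box A e" "g \<in> deg_box A e'" by auto
  then have f: "f \<in> deg_box A (max e e')" and g: "g \<in> deg_box A (max e e')"
    using deg_box_mono[of e "max e e'" A] deg_box_mono[of e' "max e e'" A] by auto
  have "f + g \<in> deg_box A (max e e')"
    using f g keys_add[of f g] polys_add[of f A g] unfolding deg_box_def by blast
  then show ?case ..
qed

text \<open>Counting dimensions. The \<open>K\<^sup>r\<close> products of powers \<open>< K\<close> of the \<open>a\<^sub>i\<close> lie in the span of the monomials whose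
  exponents are at most a constant multiple of \<open>K\<close>, and there are \<open>O(K\<^bsup>|A|\<^esup>)\<close> of those. For \<open>r > |A|\<close> and large
  \<open>K\<close> the products are linearly dependent. The relation is given by a set \<open>F\<close> of exponent functions with
  nonzero coefficients, so that two equal products also yield a relation.\<close>

lemma algebraic_dependence:
  fixes a :: "nat \<Rightarrow> ('v, 'k::field) mpoly"
  assumes A: "finite A" and a: "\<And>i. i < r \<Longrightarrow> a i \<in> polys A" and r: "card A < r"
  shows "\<exists>F u. finite F \<and> F \<noteq> {} \<and> F \<subseteq> extensional {..<r} \<and> (\<forall>m\<in>F. u m \<noteq> 0) \<and>
    (\<Sum>m\<in>F. cst (u m) * (\<Prod>i<r. a i ^ m i)) = 0"
proof -
  interpret V: vector_space "\<lambda>(c :: 'k) (f :: ('v, 'k) mpoly). cst c * f"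
    by unfold_locales (simp_all add: distrib_left single_add distrib_right mult.assoc[symmetric] mult_single)
  obtain e where e: "\<And>i. i < r \<Longrightarrow> a i \<in> deg_box A e"
  proof -
    have "\<forall>i. \<exists>e. i < r \<longrightarrow> a i \<in> deg_box A e" using ex_deg_box a by blast
    then obtain d where d: "\<And>i. i < r \<Longrightarrow> a i \<in> deg_box A (d i)" by metis
    have "a i \<in> deg_box A (\<Sum>i<r. d i)" if "i < r" for i
      using d[OF that] deg_box_mono[of "d i" "\<Sum>i<r. d i" A] that by (auto intro!: member_le_sum)
    then show thesis by (rule that)
  qed
  define N where "N = card A"
  \<comment> \<open>large enough for \<open>(D + 1) ^ N < K ^ r\<close> below\<close>
  define K where "K = (e * r + 1) ^ N + 1"
  define D where "D = e * r * K"
  define F0 where "F0 = PiE {..<r} (\<lambda>_. {..<K})"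
  define v where "v m = (\<Prod>i<r. a i ^ m i)" for m :: "nat \<Rightarrow> nat"
  define E where "E = {m. keys m \<subseteq> A \<and> (\<forall>v. lookup m v \<le> D)}"
  define S where "S = (\<lambda>m. single m (1 :: 'k)) ` E"
  have F0: "finite F0" "card F0 = K ^ r" by (simp_all add: F0_def finite_PiE card_PiE)
  have E: "finite E" "card E \<le> (D + 1) ^ N"
  proof -
    let ?r = "\<lambda>m :: 'v \<Rightarrow>\<^sub>0 nat. restrict (lookup m) A"
    have inj: "inj_on ?r E"
    proof (rule inj_onI, rule poly_mapping_eqI)
      fix m l k assume *: "m \<in> E" "l \<in> E" "?r m = ?r l"
      show "lookup m k = lookup l k"
      proof (cases "k \<in> A")
        case True
        then show ?thesis using fun_cong[OF *(3), of k] by simp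
      next
        case False
        then have "k \<notin> keys m" "k \<notin> keys l" using * by (auto simp: E_def)
        then show ?thesis by (simp add: in_keys_iff)
      qed
    qed
    have sub: "?r ` E \<subseteq> PiE A (\<lambda>_. {..D})" by (auto simp: E_def)
    have fin: "finite (PiE A (\<lambda>_. {..D}))" using A by (simp add: finite_PiE)
    show "finite E" using finite_imageD[OF finite_subset[OF sub fin] inj] .
    have "card E \<le> card (PiE A (\<lambda>_. {..D}))" using card_mono[OF fin sub] card_image[OF inj] by simp
    then show "card E \<le> (D + 1) ^ N" using A by (simp add: card_PiE N_def)
  qed
  have v_span: "v m \<in> V.span S" if m: "m \<in> F0" for m
  proof -
    have "v m \<in> deg_box A (\<Sum>i<r. m i * e)"
      unfolding v_def using e by (intro deg_box_prod deg_box_power) auto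
    moreover have "(\<Sum>i<r. m i * e) \<le> D"
    proof -
      have "m i * e \<le> K * e" if "i < r" for i
        using m that by (intro mult_right_mono) (auto simp: F0_def PiE_iff intro: less_imp_le)
      then have "(\<Sum>i<r. m i * e) \<le> (\<Sum>i<r. K * e)" by (intro sum_mono) auto
      then show ?thesis by (simp add: D_def mult_ac)
    qed
    ultimately have vm: "v m \<in> deg_box A D" using deg_box_mono[of _ D A] by blast
    have "(\<Sum>l\<in>keys (v m). cst (lookup (v m) l) * single l 1) \<in> V.span S"
      by (intro V.span_sum V.span_scale V.span_base) (use vm in \<open>auto simp: S_def E_def deg_box_def polys_def\<close>)
    moreover have "(\<Sum>l\<in>keys (v m). cst (lookup (v m) l) * single l 1) = v m"
      by (simp add: mult_single flip: mpoly_eq_sum_single)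
    ultimately show ?thesis by simp
  qed
  have K: "K > 0" by (simp add: K_def)
  have count: "(D + 1) ^ N < K ^ r"
  proof -
    have "D + 1 \<le> (e * r + 1) * K" using K by (simp add: D_def)
    then have "(D + 1) ^ N \<le> ((e * r + 1) * K) ^ N" by (rule power_mono) simp
    also have "\<dots> = (e * r + 1) ^ N * K ^ N" by (rule power_mult_distrib)
    also have "\<dots> < K * K ^ N" using K by (intro mult_strict_right_mono) (simp_all add: K_def)
    also have "\<dots> = K ^ Suc N" by simp
    also have "\<dots> \<le> K ^ r" using r K by (intro power_increasing) (auto simp: N_def)
    finally show ?thesis .
  qed
  show ?thesis
  proof (cases "inj_on v F0")
    case True
    have fS: "finite S" and cS: "card S \<le> (D + 1) ^ N"
      using E card_image_le[OF E(1), of "\<lambda>m. single m (1 :: 'k)"] by (auto simp: S_def)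
    have "V.dependent (v ` F0)"
    proof (rule ccontr)
      assume "\<not> V.dependent (v ` F0)"
      then have "card (v ` F0) \<le> card S"
        using V.independent_span_bound[OF fS, of "v ` F0"] v_span by auto
      then show False using card_image[OF True] F0 cS count by simp
    qed
    then obtain u where u: "\<exists>f\<in>v ` F0. u f \<noteq> 0" "(\<Sum>f\<in>v ` F0. cst (u f) * f) = 0"
      using V.dependent_finite[of "v ` F0"] F0 by auto
    let ?F = "{m \<in> F0. u (v m) \<noteq> 0}"
    have "(\<Sum>m\<in>?F. cst (u (v m)) * v m) = (\<Sum>m\<in>F0. cst (u (v m)) * v m)"
      using F0(1) by (intro sum.mono_neutral_left) auto
    also have "\<dots> = 0" using u(2) by (simp add: sum.reindex[OF True])
    finally have "(\<Sum>m\<in>?F. cst (u (v m)) * v m) = 0" .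
    moreover have "finite ?F" using F0(1) by simp
    moreover have "?F \<noteq> {}" "?F \<subseteq> extensional {..<r}"
      using u(1) by (auto simp: F0_def PiE_def)
    ultimately show ?thesis
      by (intro exI[of _ ?F] exI[of _ "\<lambda>m. u (v m)"]) (simp add: v_def)
  next
    case False
    then obtain m l where ml: "m \<in> F0" "l \<in> F0" "m \<noteq> l" "v m = v l" by (auto simp: inj_on_def)
    then show ?thesis
      by (intro exI[of _ "{m, l}"] exI[of _ "\<lambda>k. if k = m then 1 else - 1"])
        (auto simp: v_def F0_def PiE_def single_uminus)
  qed
qed

text \<open>In a longer chain choose \<open>a\<^sub>i \<in> c\<^bsub>i+1\<^esub> - c\<^sub>i\<close> and an algebraic relation between the \<open>a\<^sub>i\<close>. Modulo \<open>c\<^sub>j\<close> the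
  highest possible power of \<open>a\<^sub>j\<close> can be cancelled, and then modulo \<open>c\<^bsub>j+1\<^esub>\<close> only the terms without \<open>a\<^sub>j\<close>
  survive. At the end of the chain a single nonzero constant is left in a prime ideal.\<close>

lemma prime_chain_bound:
  fixes c :: "nat \<Rightarrow> ('v, 'k::field) mpoly set"
  assumes A: "finite A" and prime: "\<And>i. i \<le> k \<Longrightarrow> prime_in (polys A) (c i)"
    and strict: "\<And>i. i < k \<Longrightarrow> c i \<subset> c (Suc i)"
  shows "k \<le> card A"
proof (rule ccontr)
  assume "\<not> k \<le> card A"
  define r where "r = Suc (card A)"
  have rk: "r \<le> k" using \<open>\<not> k \<le> card A\<close> by (simp add: r_def)
  have ci: "ideal_in (polys A) (c i)" if "i \<le> r" for i using prime[of i] that rk by (simp add: prime_in_def)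
  have "\<forall>i. \<exists>a. i < r \<longrightarrow> a \<in> c (Suc i) \<and> a \<notin> c i" using strict rk by (meson less_le_trans psubset_imp_ex_mem DiffD1 DiffD2)
  then obtain a where a: "\<And>i. i < r \<Longrightarrow> a i \<in> c (Suc i) \<and> a i \<notin> c i" by metis
  have aA: "a i \<in> polys A" if "i < r" for i using a[OF that] ideal_in_sub[OF ci, of "Suc i"] that by simp
  obtain F :: "(nat \<Rightarrow> nat) set" and u where F: "finite F" "F \<noteq> {}" "F \<subseteq> extensional {..<r}" "\<forall>m\<in>F. u m \<noteq> 0"
    "(\<Sum>m\<in>F. cst (u m) * (\<Prod>i<r. a i ^ m i)) = 0"
    using algebraic_dependence[of A r a, OF A aA] unfolding r_def by blast
  have descend: False
    if "j \<le> r" "finite F" "F \<noteq> {}" "\<forall>m\<in>F. u m \<noteq> 0"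
      "\<And>m l. m \<in> F \<Longrightarrow> l \<in> F \<Longrightarrow> (\<And>i. j \<le> i \<Longrightarrow> i < r \<Longrightarrow> m i = l i) \<Longrightarrow> m = l"
      "(\<Sum>m\<in>F. cst (u m) * (\<Prod>i=j..<r. a i ^ m i)) \<in> c j" for j and F :: "(nat \<Rightarrow> nat) set"
    using that
  proof (induction j arbitrary: F rule: inc_induct)
    case base
    then obtain m where m: "F = {m}" by (metis all_not_in_conv is_singletonI' is_singleton_the_elem leD)
    then have um: "cst (u m) \<in> c r" "u m \<noteq> 0" using base by auto
    have "cst (inverse (u m)) * cst (u m) \<in> c r" using ideal_inD(4)[OF ci _ um(1)] by simp
    then have "1 \<in> c r" using um(2) by (simp add: mult_single)
    then show ?case using prime[OF rk] by (simp add: prime_in_def)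
  next
    case (step j)
    note j = \<open>j < r\<close>
    define e where "e = Min ((\<lambda>m. m j) ` F)"
    have e_le: "e \<le> m j" if "m \<in> F" for m using that step by (simp add: e_def)
    have "e \<in> (\<lambda>m. m j) ` F" unfolding e_def using step by (intro Min_in) auto
    then obtain m0 where m0: "m0 \<in> F" "m0 j = e" by auto
    let ?p = "\<lambda>m. \<Prod>i=Suc j..<r. a i ^ m i"
    let ?g = "\<lambda>m. cst (u m) * (a j ^ (m j - e) * ?p m)"
    have pA: "?p m \<in> polys A" for m
      by (intro polys_prod polys_power aA) auto
    have "(\<Sum>m\<in>F. cst (u m) * (\<Prod>i=j..<r. a i ^ m i)) = a j ^ e * (\<Sum>m\<in>F. ?g m)"
      unfolding sum_distrib_left
    proof (rule sum.cong[OF refl])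
      fix m assume "m \<in> F"
      then have "a j ^ m j = a j ^ e * a j ^ (m j - e)" using e_le by (simp flip: power_add)
      then show "cst (u m) * (\<Prod>i=j..<r. a i ^ m i) = a j ^ e * ?g m"
        using j by (simp add: prod.atLeast_Suc_lessThan mult_ac)
    qed
    then have "a j ^ e * (\<Sum>m\<in>F. ?g m) \<in> c j" using step.prems by simp
    moreover have gA: "(\<Sum>m\<in>F. ?g m) \<in> polys A"
      by (intro polys_sum polys_mult polys_power aA[OF j] pA cst_in_polys)
    moreover have pj: "prime_in (polys A) (c j)" using j rk by (intro prime) simp
    ultimately have "(\<Sum>m\<in>F. ?g m) \<in> c j"
      using prime_in_mult[OF pj subring_setD(7)[OF subring_polys aA[OF j], of e]] prime_in_power[OF pj subring_polys aA[OF j]] a[OF j] by blast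
    then have 1: "(\<Sum>m\<in>F. ?g m) \<in> c (Suc j)" using strict[of j] j rk by auto
    let ?F = "{m \<in> F. m j = e}"
    have cS: "ideal_in (polys A) (c (Suc j))" using ci j by simp
    have 2: "(\<Sum>m\<in>F - ?F. ?g m) \<in> c (Suc j)"
    proof (rule ideal_in_sum[OF cS])
      fix m assume "m \<in> F - ?F"
      then have "m j > e" using e_le[of m] by auto
      then obtain d where "m j - e = Suc d" by (cases "m j - e") auto
      then have "?g m = (cst (u m) * a j ^ d * ?p m) * a j" by (simp add: mult_ac)
      moreover have "cst (u m) * a j ^ d * ?p m \<in> polys A"
        by (intro polys_mult polys_power aA[OF j] pA cst_in_polys)
      ultimately show "?g m \<in> c (Suc j)" using ideal_inD(4)[OF cS _ conjunct1[OF a[OF j]]] by simp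
    qed
    have "(\<Sum>m\<in>F. ?g m) = (\<Sum>m\<in>?F. ?g m) + (\<Sum>m\<in>F - ?F. ?g m)"
      using step.prems(1) by (subst sum.subset_diff[of ?F F]) (auto simp: add.commute)
    then have "(\<Sum>m\<in>?F. ?g m) = (\<Sum>m\<in>F. ?g m) - (\<Sum>m\<in>F - ?F. ?g m)" by simp
    then have "(\<Sum>m\<in>?F. ?g m) \<in> c (Suc j)" using ideal_in_minus(2)[OF cS subring_polys 1 2] by simp
    moreover have "(\<Sum>m\<in>?F. ?g m) = (\<Sum>m\<in>?F. cst (u m) * ?p m)" by (intro sum.cong) auto
    ultimately have mem: "(\<Sum>m\<in>?F. cst (u m) * ?p m) \<in> c (Suc j)" by simp
    show ?case
    proof (rule step.IH[OF _ _ _ _ mem])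
      show "?F \<noteq> {}" using m0 by auto
      show "m = l" if "m \<in> ?F" "l \<in> ?F" "\<And>i. Suc j \<le> i \<Longrightarrow> i < r \<Longrightarrow> m i = l i" for m l
      proof (rule step.prems(4))
        show "m i = l i" if "j \<le> i" "i < r" for i
          using \<open>m \<in> ?F\<close> \<open>l \<in> ?F\<close> \<open>\<And>i. Suc j \<le> i \<Longrightarrow> i < r \<Longrightarrow> m i = l i\<close>[of i] that by (cases "i = j") auto
      qed (use that in auto)
    qed (use step.prems in auto)
  qed
  show False
  proof (rule descend[of 0 F])
    show "(\<Sum>m\<in>F. cst (u m) * (\<Prod>i = 0..<r. a i ^ m i)) \<in> c 0"
      using F(5) ideal_inD(2)[OF ci[of 0]] by (simp add: atLeast0LessThan)
    show "m = l" if "m \<in> F" "l \<in> F" "\<And>i. 0 \<le> i \<Longrightarrow> i < r \<Longrightarrow> m i = l i" for m l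
      using that F(3) by (intro extensionalityI[of m "{..<r}" l]) auto
  qed (use F in auto)
qed

lemma ex_subset_chain:
  assumes "finite T'" "T \<subseteq> T'"
  obtains e :: "nat \<Rightarrow> 'a set" where "e 0 = T" "e (card T' - card T) = T'"
    "\<And>i. i < card T' - card T \<Longrightarrow> e i \<subset> e (Suc i)" "\<And>i. i \<le> card T' - card T \<Longrightarrow> e i \<subseteq> T'"
proof -
  let ?d = "card T' - card T"
  have card: "card (T' - T) = ?d" using assms by (simp add: card_Diff_subset finite_subset)
  obtain h where h: "bij_betw h {0..<?d} (T' - T)"
    using ex_bij_betw_nat_finite[of "T' - T"] assms card by auto
  define e where "e i = T \<union> h ` {0..<i}" for i
  have "e i \<subset> e (Suc i)" if "i < ?d" for i
  proof -
    have "h i \<in> T' - T" using h that by (auto simp: bij_betw_def)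
    moreover have "h i \<notin> h ` {0..<i}" using h that by (auto simp: bij_betw_def dest!: inj_onD)
    ultimately have "h i \<in> e (Suc i) - e i" by (auto simp: e_def)
    moreover have "e i \<subseteq> e (Suc i)" by (auto simp: e_def)
    ultimately show ?thesis by blast
  qed
  moreover have "e i \<subseteq> T'" if "i \<le> ?d" for i
    using assms(2) h that by (auto simp: e_def bij_betw_def)
  moreover have "e 0 = T" "e ?d = T'" using h assms(2) by (auto simp: e_def bij_betw_def)
  ultimately show thesis using that by blast
qed

section \<open>Depth and height\<close>

lemma (in cring) ideal_add_principal:
  assumes "ideal Q R" "a \<in> carrier R"
  shows "ideal (Q <+>\<^bsub>R\<^esub> PIdl a) R" "Q \<subseteq> Q <+>\<^bsub>R\<^esub> PIdl a" "a \<in> Q <+>\<^bsub>R\<^esub> PIdl a"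
proof -
  interpret Q: ideal Q R by fact
  show "ideal (Q <+>\<^bsub>R\<^esub> PIdl a) R" using assms by (intro add_ideals cgenideal_ideal)
  have Q0: "\<zero> \<in> Q" using additive_subgroup.zero_closed[OF Q.is_additive_subgroup] .
  have a0: "\<zero> \<in> PIdl a" using assms by (auto simp: cgenideal_def intro!: exI[of _ \<zero>])
  have mem: "q \<oplus> b \<in> Q <+>\<^bsub>R\<^esub> PIdl a" if "q \<in> Q" "b \<in> PIdl a" for q b
    unfolding set_add_def' by (rule UN_I[OF that(1)], rule UN_I[OF that(2)]) simp
  show "Q \<subseteq> Q <+>\<^bsub>R\<^esub> PIdl a"
  proof
    fix q assume "q \<in> Q"
    then show "q \<in> Q <+>\<^bsub>R\<^esub> PIdl a" using mem[OF _ a0, of q] Q.Icarr[of q] by simp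
  qed
  show "a \<in> Q <+>\<^bsub>R\<^esub> PIdl a"
    using mem[OF Q0 cgenideal_self[OF assms(2)]] assms(2) by simp
qed

text \<open>An ideal maximal among those that contain \<open>I\<close> and are disjoint from the multiplicative set of all
  \<open>x\<^sup>k s\<close> with \<open>s \<notin> P\<close> is prime. The set does not meet \<open>I\<close> because \<open>x\<close> can be cancelled modulo \<open>I\<close>.\<close>

lemma (in cring) prime_avoiding_nonzerodivisor:
  assumes noeth: "noetherian_ring R" and P: "primeideal P R" and I: "ideal I R" "I \<subseteq> P"
    and x: "x \<in> carrier R" and nzd: "\<And>a. a \<in> carrier R \<Longrightarrow> x \<otimes> a \<in> I \<Longrightarrow> a \<in> I"
  shows "\<exists>Q. primeideal Q R \<and> I \<subseteq> Q \<and> Q \<subseteq> P \<and> x \<notin> Q"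
proof -
  interpret N: noetherian_ring R by fact
  interpret P: primeideal P R by fact
  define T where "T = {x [^] (k::nat) \<otimes> s | k s. s \<in> carrier R \<and> s \<notin> P}"
  have T_mult: "t \<otimes> t' \<in> T" if tT: "t \<in> T" "t' \<in> T" for t t'
  proof -
    from tT(1) obtain k s where "t = x [^] (k::nat) \<otimes> s" "s \<in> carrier R" "s \<notin> P"
      unfolding T_def by (elim CollectE exE conjE)
    moreover from tT(2) obtain k' s' where "t' = x [^] (k'::nat) \<otimes> s'" "s' \<in> carrier R" "s' \<notin> P"
      unfolding T_def by (elim CollectE exE conjE)
    ultimately have t: "t = x [^] k \<otimes> s" "s \<in> carrier R" "s \<notin> P" "t' = x [^] k' \<otimes> s'" "s' \<in> carrier R" "s' \<notin> P"
      by auto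
    have "t \<otimes> t' = x [^] (k + k') \<otimes> (s \<otimes> s')"
    proof -
      have "x [^] k \<in> carrier R" "x [^] k' \<in> carrier R" using x by auto
      then have "(x [^] k \<otimes> s) \<otimes> (x [^] k' \<otimes> s') = (x [^] k \<otimes> x [^] k') \<otimes> (s \<otimes> s')"
        using t(2,5) by (simp add: m_ac)
      then show ?thesis using t x by (simp add: nat_pow_mult)
    qed
    moreover have "s \<otimes> s' \<notin> P" using P.I_prime t by blast
    ultimately show ?thesis
      using t unfolding T_def by (intro CollectI exI[of _ "k + k'"] exI[of _ "s \<otimes> s'"]) simp
  qed
  have oneP: "\<one> \<notin> P" using P.one_imp_carrier P.I_notcarr by metis
  have T_carr: "s \<in> T" if "s \<in> carrier R" "s \<notin> P" for s
    using that unfolding T_def by (intro CollectI exI[of _ 0] exI[of _ s]) simp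
  have xT: "x \<in> T"
    unfolding T_def using x oneP by (intro CollectI exI[of _ 1] exI[of _ \<one>]) simp
  define \<F> where "\<F> = {K. ideal K R \<and> I \<subseteq> K \<and> K \<inter> T = {}}"
  have "I \<in> \<F>"
  proof -
    have "s \<in> I" if "s \<in> carrier R" "x [^] (k::nat) \<otimes> s \<in> I" for k s
      using that
    proof (induction k)
      case (Suc k)
      have "x [^] Suc k \<otimes> s = x \<otimes> (x [^] k \<otimes> s)" using x Suc.prems(1) by (simp add: m_assoc m_lcomm)
      then have "x \<otimes> (x [^] k \<otimes> s) \<in> I" using Suc.prems(2) by simp
      then have "x [^] k \<otimes> s \<in> I" by (rule nzd[rotated]) (use Suc.prems x in simp)
      then show ?case using Suc by simp
    qed simp
    then show ?thesis using I by (auto simp: \<F>_def T_def)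
  qed
  moreover have "\<Union>C \<in> \<F>" if "C \<noteq> {}" "subset.chain \<F> C" for C
  proof -
    have "subset.chain {K. ideal K R} C" using that(2) by (auto simp: subset.chain_def \<F>_def)
    then have "\<Union>C \<in> C" using N.ideal_chain_is_trivial that(1) by blast
    then show ?thesis using that(2) by (auto simp: subset.chain_def)
  qed
  ultimately obtain Q where Q: "Q \<in> \<F>" "\<And>K. K \<in> \<F> \<Longrightarrow> Q \<subseteq> K \<Longrightarrow> K = Q"
    using subset_Zorn_nonempty[of \<F>] by (metis (no_types, lifting) empty_iff)
  then interpret Q: ideal Q R by (simp add: \<F>_def)
  have QT: "Q \<inter> T = {}" and IQ: "I \<subseteq> Q" using Q by (auto simp: \<F>_def)
  have QP: "Q \<subseteq> P" using T_carr QT Q.Icarr by blast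
  have meet: "\<exists>q\<in>Q. \<exists>r\<in>carrier R. q \<oplus> r \<otimes> a \<in> T" if a: "a \<in> carrier R" "a \<notin> Q" for a
  proof -
    have "Q <+>\<^bsub>R\<^esub> PIdl a \<notin> \<F>"
      using Q(2)[of "Q <+>\<^bsub>R\<^esub> PIdl a"] ideal_add_principal[OF Q.is_ideal a(1)] a(2) by auto
    then obtain t where "t \<in> T" "t \<in> Q <+>\<^bsub>R\<^esub> PIdl a"
      using ideal_add_principal[OF Q.is_ideal a(1)] IQ by (auto simp: \<F>_def)
    then show ?thesis by (auto simp: set_add_def' cgenideal_def)
  qed
  have "primeideal Q R"
  proof (rule primeidealI[OF Q.is_ideal is_cring])
    show "carrier R \<noteq> Q" using QP oneP by auto
    fix a b assume ab: "a \<in> carrier R" "b \<in> carrier R" "a \<otimes> b \<in> Q"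
    show "a \<in> Q \<or> b \<in> Q"
    proof (rule ccontr)
      assume "\<not> (a \<in> Q \<or> b \<in> Q)"
      then obtain q r q' r' where q: "q \<in> Q" "r \<in> carrier R" "q \<oplus> r \<otimes> a \<in> T" "q' \<in> Q" "r' \<in> carrier R" "q' \<oplus> r' \<otimes> b \<in> T"
        using meet ab by metis
      note qc = Q.Icarr[OF q(1)] Q.Icarr[OF q(4)]
      have "(q \<oplus> r \<otimes> a) \<otimes> (q' \<oplus> r' \<otimes> b) = q \<otimes> (q' \<oplus> r' \<otimes> b) \<oplus> ((r \<otimes> a) \<otimes> q' \<oplus> (r \<otimes> r') \<otimes> (a \<otimes> b))"
      proof -
        have "(r \<otimes> a) \<otimes> (r' \<otimes> b) = (r \<otimes> r') \<otimes> (a \<otimes> b)" using q(2,5) ab(1,2) by (simp add: m_ac)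
        moreover have "(r \<otimes> a) \<otimes> (q' \<oplus> r' \<otimes> b) = (r \<otimes> a) \<otimes> q' \<oplus> (r \<otimes> a) \<otimes> (r' \<otimes> b)"
          by (rule r_distr) (use q ab qc in auto)
        moreover have "(q \<oplus> r \<otimes> a) \<otimes> (q' \<oplus> r' \<otimes> b) = q \<otimes> (q' \<oplus> r' \<otimes> b) \<oplus> (r \<otimes> a) \<otimes> (q' \<oplus> r' \<otimes> b)"
          by (rule l_distr) (use q ab qc in auto)
        ultimately show ?thesis by simp
      qed
      also have "\<dots> \<in> Q"
      proof (intro additive_subgroup.a_closed[OF Q.is_additive_subgroup])
        show "q \<otimes> (q' \<oplus> r' \<otimes> b) \<in> Q" using q(1) by (rule Q.I_r_closed) (use q ab qc in auto)
        show "(r \<otimes> a) \<otimes> q' \<in> Q" using q(4) by (rule Q.I_l_closed) (use q ab in auto)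
        show "(r \<otimes> r') \<otimes> (a \<otimes> b) \<in> Q" using ab(3) by (rule Q.I_l_closed) (use q in auto)
      qed
      finally show False using T_mult[OF q(3,6)] QT by auto
    qed
  qed
  moreover have "x \<notin> Q" using xT QT by auto
  ultimately show ?thesis using IQ QP by (intro exI[of _ Q] conjI)
qed

text \<open>A regular sequence \<open>f\<^sub>1, \<dots>, f\<^sub>r\<close> in \<open>M\<close> gives a chain of primes from the top down: the prime below the current
  one contains \<open>f\<^sub>1, \<dots>, f\<^bsub>j-1\<^esub>\<close> but not \<open>f\<^sub>j\<close>.\<close>

lemma (in cring) depth_le_height:
  assumes noeth: "noetherian_ring R" and M: "primeideal M R"
  shows "depth R M \<le> height R M"
  unfolding depth_def
proof (rule SUP_least)
  fix fs assume "fs \<in> {fs. regular_sequence R fs \<and> set fs \<subseteq> M}"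
  then have fs: "set fs \<subseteq> carrier R" "set fs \<subseteq> M"
    and reg: "\<And>i a. i < length fs \<Longrightarrow> a \<in> carrier R \<Longrightarrow> fs ! i \<otimes> a \<in> Idl (set (take i fs)) \<Longrightarrow> a \<in> Idl (set (take i fs))"
    by (auto simp: regular_sequence_def)
  interpret M: primeideal M R by fact
  have "\<exists>c :: nat \<Rightarrow> _. (\<forall>i\<le>j. primeideal (c i) R) \<and> (\<forall>i<j. c i \<subset> c (Suc i)) \<and> c j = M \<and>
      Idl (set (take (length fs - j) fs)) \<subseteq> c 0" if "j \<le> length fs" for j
    using that
  proof (induction j)
    case 0
    show ?case using M fs genideal_minimal[OF M.is_ideal fs(2)] by (intro exI[of _ "\<lambda>_. M"]) auto
  next
    case (Suc j)
    then obtain c where c: "\<forall>i\<le>j. primeideal (c i) R" "\<forall>i<j. c i \<subset> c (Suc i)" "c j = M"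
        "Idl (set (take (length fs - j) fs)) \<subseteq> c 0" by auto
    define k where "k = length fs - Suc j"
    have k: "k < length fs" "length fs - j = Suc k" using Suc.prems by (auto simp: k_def)
    have sub: "set (take i fs) \<subseteq> carrier R" for i using fs(1) set_take_subset[of i fs] by auto
    have "fs ! k \<in> set (take (Suc k) fs)" using k(1) by (simp add: take_Suc_conv_app_nth)
    then have fk: "fs ! k \<in> c 0" using genideal_self[OF sub, of "Suc k"] c(4) k(2) by auto
    have "Idl (set (take k fs)) \<subseteq> Idl (set (take (Suc k) fs))"
      by (rule subset_Idl_subset[OF sub]) (simp add: set_take_subset_set_take)
    then have Ic: "Idl (set (take k fs)) \<subseteq> c 0" using c(4) k(2) by auto
    obtain Q where Q: "primeideal Q R" "Idl (set (take k fs)) \<subseteq> Q" "Q \<subseteq> c 0" "fs ! k \<notin> Q"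
    proof -
      have fkR: "fs ! k \<in> carrier R" using fs(1) k(1) by auto
      have "primeideal (c 0) R" using c(1) by blast
      then show thesis
        using prime_avoiding_nonzerodivisor[OF noeth _ genideal_ideal[OF sub] Ic fkR reg[OF k(1)]] that by blast
    qed
    show ?case
    proof (intro exI[of _ "case_nat Q c"] conjI allI impI)
      fix i assume "i \<le> Suc j" then show "primeideal (case_nat Q c i) R" using Q c by (cases i) auto
    next
      fix i assume "i < Suc j" then show "case_nat Q c i \<subset> case_nat Q c (Suc i)" using Q c fk by (cases i) auto
    qed (use Q c k_def in auto)
  qed
  from this[of "length fs"] show "enat (length fs) \<le> height R M"
    unfolding height_def by (intro SUP_upper) blast
qed

section \<open>Monomials in the dual ideal\<close>

lemma isotone_maps_memI:
  "(\<And>p. p \<in> P \<Longrightarrow> f p \<in> Q) \<Longrightarrow> mono_on P f \<Longrightarrow> restrict f P \<in> isotone_maps P Q"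
  by (auto simp: isotone_maps_def mono_on_def)

lemma finite_isotone_maps: "finite P \<Longrightarrow> finite Q \<Longrightarrow> finite (isotone_maps P Q)"
  by (rule finite_subset[of _ "PiE P (\<lambda>_. Q)"]) (auto simp: isotone_maps_def finite_PiE)

lemma isotone_mapsD:
  "\<phi> \<in> isotone_maps P Q \<Longrightarrow> p \<in> P \<Longrightarrow> \<phi> p \<in> Q"
  "\<phi> \<in> isotone_maps P Q \<Longrightarrow> p \<in> P \<Longrightarrow> q \<in> P \<Longrightarrow> p \<le> q \<Longrightarrow> \<phi> p \<le> \<phi> q"
  by (auto simp: isotone_maps_def mono_on_def)

text \<open>The map is \<open>\<phi>(p) = 1 + h(p)\<close>, where \<open>h(p)\<close> is the largest length of a chain \<open>(1,p\<^sub>1), (2,p\<^sub>2), \<dots>\<close> in \<open>U\<close>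
  with \<open>p\<^sub>1 \<le> p\<^sub>2 \<le> \<dots> \<le> p\<close>. If \<open>(\<phi>(p),p)\<close> were in \<open>U\<close>, a longest chain could be extended by it.\<close>

lemma chain_or_avoiding_map:
  fixes P :: "'p::order set"
  assumes U: "U \<subseteq> {1..n} \<times> P"
  shows "(\<exists>\<rho>\<in>isotone_maps {1..n} P. \<forall>i\<in>{1..n}. (i, \<rho> i) \<in> U) \<or>
    (\<exists>\<phi>\<in>isotone_maps P {1..n}. (\<forall>p\<in>P. (\<phi> p, p) \<notin> U) \<and> prod.swap ` Lambda P n \<phi> \<subseteq> U)"
proof -
  define ch where "ch p m \<longleftrightarrow> (\<exists>\<rho>. mono_on {1..m} \<rho> \<and> (\<forall>i\<in>{1..m}. \<rho> i \<in> P \<and> \<rho> i \<le> p \<and> (i, \<rho> i) \<in> U))" for p m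
  have ch0: "ch p 0" for p by (auto simp: ch_def mono_on_def)
  have ch_le: "m \<le> n" if ch: "ch p m" for p m
  proof (cases "m = 0")
    case False
    then obtain x where "(m, x) \<in> U" using ch unfolding ch_def by force
    then show ?thesis using U by auto
  qed simp
  define h where "h p = (GREATEST m. ch p m)" for p
  have ch_h: "ch p (h p)" for p
    unfolding h_def by (rule GreatestI_nat[of "ch p" 0 n]) (use ch0 ch_le in auto)
  have h_ge: "m \<le> h p" if "ch p m" for p m
    unfolding h_def by (rule Greatest_le_nat[of "ch p" m n]) (use that ch_le in auto)
  have h_mono: "h p \<le> h q" if "p \<le> q" for p q
  proof (rule h_ge)
    show "ch q (h p)" using ch_h[of p] that unfolding ch_def by (meson order_trans)
  qed
  show ?thesis
  proof (cases "\<exists>p\<in>P. h p = n")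
    case True
    then obtain p where "ch p n" using ch_h by metis
    then obtain \<rho> where \<rho>: "mono_on {1..n} \<rho>" "\<forall>i\<in>{1..n}. \<rho> i \<in> P \<and> (i, \<rho> i) \<in> U"
      unfolding ch_def by blast
    then have "restrict \<rho> {1..n} \<in> isotone_maps {1..n} P" by (intro isotone_maps_memI) auto
    moreover have "\<forall>i\<in>{1..n}. (i, restrict \<rho> {1..n} i) \<in> U" using \<rho> by auto
    ultimately show ?thesis by blast
  next
    case False
    define \<phi> where "\<phi> = restrict (\<lambda>p. Suc (h p)) P"
    have \<phi>: "\<phi> p = Suc (h p)" if "p \<in> P" for p using that by (simp add: \<phi>_def)
    have "Suc (h p) \<in> {1..n}" if "p \<in> P" for p
      using False that ch_le[OF ch_h, of p] by (auto simp: le_less)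
    then have iso: "\<phi> \<in> isotone_maps P {1..n}"
      unfolding \<phi>_def by (intro isotone_maps_memI) (auto simp: mono_on_def intro: h_mono)
    have avoid: "(\<phi> p, p) \<notin> U" if p: "p \<in> P" for p
    proof
      assume "(\<phi> p, p) \<in> U"
      then have pU: "(Suc (h p), p) \<in> U" using p \<phi> by simp
      obtain \<rho> where \<rho>: "mono_on {1..h p} \<rho>" "\<forall>i\<in>{1..h p}. \<rho> i \<in> P \<and> \<rho> i \<le> p \<and> (i, \<rho> i) \<in> U"
        using ch_h[of p] unfolding ch_def by blast
      have "ch p (Suc (h p))"
        unfolding ch_def
      proof (intro exI[of _ "\<rho>(Suc (h p) := p)"] conjI ballI)
        show "mono_on {1..Suc (h p)} (\<rho>(Suc (h p) := p))"
          using \<rho> by (auto simp: mono_on_def le_Suc_eq)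
      qed (use \<rho> p pU in \<open>auto simp: le_Suc_eq\<close>)
      then show False using h_ge[of p "Suc (h p)"] by simp
    qed
    have "(i, p) \<in> U" if pi: "(p, i) \<in> Lambda P n \<phi>" for p i
    proof -
      have p: "p \<in> P" "i \<in> {1..n}" "i < \<phi> p" "\<And>q. q \<in> P \<Longrightarrow> q < p \<Longrightarrow> \<phi> q \<le> i"
        using pi by (auto simp: Lambda_def)
      then have ih: "i \<in> {1..h p}" using \<phi> by auto
      obtain \<rho> where \<rho>: "mono_on {1..h p} \<rho>" "\<forall>i\<in>{1..h p}. \<rho> i \<in> P \<and> \<rho> i \<le> p \<and> (i, \<rho> i) \<in> U"
        using ch_h[of p] unfolding ch_def by blast
      \<comment> \<open>the chain up to \<open>i\<close> ends in \<open>\<rho> i\<close>, so \<open>\<rho> i\<close> cannot lie strictly below \<open>p\<close>\<close>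
      have "ch (\<rho> i) i"
        unfolding ch_def by (intro exI[of _ \<rho>]) (use \<rho> ih in \<open>auto simp: mono_on_def\<close>)
      then have "i < \<phi> (\<rho> i)" using h_ge[of "\<rho> i" i] \<phi> \<rho> ih by (simp add: less_Suc_eq_le)
      then have "\<not> \<rho> i < p" using p(4) \<rho>(2) ih by (meson leD)
      then have "\<rho> i = p" using \<rho>(2) ih by (auto simp: less_le)
      then show ?thesis using \<rho>(2) ih by auto
    qed
    then show ?thesis using iso avoid by (intro disjI2 bexI[of _ \<phi>]) auto
  qed
qed

text \<open>\<open>i \<mapsto> \<phi>(\<rho>(i))\<close> is an isotone self-map of \<open>[n]\<close>; the least \<open>i\<close> with \<open>\<phi>(\<rho>(i)) \<le> i\<close> is a fixed point.\<close>

lemma chain_meets_graph: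
  fixes P :: "'p::order set" and n :: nat
  assumes n: "n \<ge> 1" and \<rho>: "\<rho> \<in> isotone_maps {1..n} P" and \<phi>: "\<phi> \<in> isotone_maps P {1..n}"
  shows "\<exists>i\<in>{1..n}. \<phi> (\<rho> i) = i"
proof -
  define i where "i = (LEAST i. i \<ge> 1 \<and> \<phi> (\<rho> i) \<le> i)"
  have "n \<ge> 1 \<and> \<phi> (\<rho> n) \<le> n" using isotone_mapsD(1)[OF \<phi> isotone_mapsD(1)[OF \<rho>, of n]] n by auto
  then have i: "i \<ge> 1" "\<phi> (\<rho> i) \<le> i" "i \<le> n"
    unfolding i_def using LeastI[of "\<lambda>i. i \<ge> 1 \<and> \<phi> (\<rho> i) \<le> i" n] Least_le[of "\<lambda>i. i \<ge> 1 \<and> \<phi> (\<rho> i) \<le> i" n] by auto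
  have "i \<le> \<phi> (\<rho> i)"
  proof (cases "i = 1")
    case True
    then show ?thesis using isotone_mapsD(1)[OF \<phi> isotone_mapsD(1)[OF \<rho>, of i]] i by auto
  next
    case False
    then have j: "i - 1 \<ge> 1" "i - 1 < i" using i by auto
    then have "\<not> \<phi> (\<rho> (i - 1)) \<le> i - 1" using not_less_Least[of "i - 1" "\<lambda>i. i \<ge> 1 \<and> \<phi> (\<rho> i) \<le> i"] unfolding i_def by blast
    moreover have "\<phi> (\<rho> (i - 1)) \<le> \<phi> (\<rho> i)"
      using i j by (intro isotone_mapsD(2)[OF \<phi>] isotone_mapsD[OF \<rho>]) auto
    ultimately show ?thesis by simp
  qed
  then show ?thesis using i by (intro bexI[of _ i]) auto
qed

text \<open>A minimal \<open>p\<close> with \<open>\<phi>(p) < \<psi>(p)\<close> works: \<open>\<psi>(q) \<le> \<phi>(q) \<le> \<phi>(p)\<close> for all \<open>q < p\<close>.\<close>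

lemma Lambda_meets_graph:
  fixes P :: "'p::order set"
  assumes "finite P" "\<phi> \<in> isotone_maps P {1..n}" "\<psi> \<in> isotone_maps P {1..n}" "\<not> pointwise_le P \<psi> \<phi>"
  shows "\<exists>p\<in>P. (p, \<phi> p) \<in> Lambda P n \<psi>"
proof -
  let ?S = "{p \<in> P. \<phi> p < \<psi> p}"
  have "?S \<noteq> {}" using assms(4) by (auto simp: pointwise_le_def not_le)
  then obtain p where p: "p \<in> ?S" "\<And>q. q \<in> ?S \<Longrightarrow> q \<le> p \<Longrightarrow> q = p"
    using finite_has_minimal[of ?S] assms(1) by auto
  have "\<psi> q \<le> \<phi> p" if "q \<in> P" "q < p" for q
  proof -
    have "q \<le> p" "q \<noteq> p" using that by auto
    then have "\<not> \<phi> q < \<psi> q" using p(2)[of q] that(1) by auto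
    then show ?thesis using isotone_mapsD(2)[OF assms(2), of q p] that p(1) \<open>q \<le> p\<close> by auto
  qed
  then show ?thesis using p(1) isotone_mapsD(1)[OF assms(2), of p] by (intro bexI[of _ p]) (auto simp: Lambda_def)
qed

definition graph_vars :: "'p set \<Rightarrow> ('p \<Rightarrow> nat) \<Rightarrow> (nat \<times> 'p) set" where
  "graph_vars P \<phi> = (\<lambda>p. (\<phi> p, p)) ` P"

definition meets_graphs :: "'p set \<Rightarrow> ('p \<Rightarrow> nat) set \<Rightarrow> (nat \<times> 'p) set \<Rightarrow> bool" where
  "meets_graphs P J U \<longleftrightarrow> (\<forall>\<phi>\<in>J. U \<inter> graph_vars P \<phi> \<noteq> {})"

text \<open>The equation \<open>L(n,P;\<J>) = L(n,P) + K(\<J>\<^sup>c)\<close> on the level of supports of monomials.\<close>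

lemma meets_graphs_iff:
  fixes P :: "'p::order set"
  assumes n: "n \<ge> 1" and P: "finite P" and J: "poset_ideal (isotone_maps P {1..n}) (pointwise_le P) J"
    and U: "U \<subseteq> {1..n} \<times> P"
  shows "meets_graphs P J U \<longleftrightarrow>
    (\<exists>\<rho>\<in>isotone_maps {1..n} P. (\<lambda>i. (i, \<rho> i)) ` {1..n} \<subseteq> U) \<or>
    (\<exists>\<psi>\<in>isotone_maps P {1..n} - J. prod.swap ` Lambda P n \<psi> \<subseteq> U)"
    (is "_ \<longleftrightarrow> ?chain \<or> ?lam")
proof
  assume *: "meets_graphs P J U"
  from chain_or_avoiding_map[OF U] show "?chain \<or> ?lam"
  proof
    assume "\<exists>\<rho>\<in>isotone_maps {1..n} P. \<forall>i\<in>{1..n}. (i, \<rho> i) \<in> U"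
    then show ?thesis by blast
  next
    assume "\<exists>\<phi>\<in>isotone_maps P {1..n}. (\<forall>p\<in>P. (\<phi> p, p) \<notin> U) \<and> prod.swap ` Lambda P n \<phi> \<subseteq> U"
    then obtain \<phi> where \<phi>: "\<phi> \<in> isotone_maps P {1..n}" "\<forall>p\<in>P. (\<phi> p, p) \<notin> U" "prod.swap ` Lambda P n \<phi> \<subseteq> U" by blast
    then have "\<phi> \<notin> J" using * by (auto simp: meets_graphs_def graph_vars_def)
    then show ?thesis using \<phi> by blast
  qed
next
  have JH: "J \<subseteq> isotone_maps P {1..n}" using J by (simp add: poset_ideal_def)
  assume "?chain \<or> ?lam"
  then show "meets_graphs P J U"
  proof
    assume ?chain
    then obtain \<rho> where \<rho>: "\<rho> \<in> isotone_maps {1..n} P" "(\<lambda>i. (i, \<rho> i)) ` {1..n} \<subseteq> U" by blast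
    show ?thesis
      unfolding meets_graphs_def
    proof
      fix \<phi> assume "\<phi> \<in> J"
      then obtain i where "i \<in> {1..n}" "\<phi> (\<rho> i) = i" using chain_meets_graph[OF n \<rho>(1)] JH by blast
      then have "(i, \<rho> i) \<in> U \<inter> graph_vars P \<phi>"
        using \<rho> isotone_mapsD(1)[OF \<rho>(1)] by (auto simp: graph_vars_def image_iff)
      then show "U \<inter> graph_vars P \<phi> \<noteq> {}" by blast
    qed
  next
    assume ?lam
    then obtain \<psi> where \<psi>: "\<psi> \<in> isotone_maps P {1..n}" "\<psi> \<notin> J" "prod.swap ` Lambda P n \<psi> \<subseteq> U" by blast
    show ?thesis
      unfolding meets_graphs_def
    proof
      fix \<phi> assume \<phi>: "\<phi> \<in> J"
      then have "\<not> pointwise_le P \<psi> \<phi>" using J \<psi> by (auto simp: poset_ideal_def)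
      then obtain p where "p \<in> P" "(p, \<phi> p) \<in> Lambda P n \<psi>"
        using Lambda_meets_graph[OF P _ \<psi>(1)] JH \<phi> by blast
      then have "(\<phi> p, p) \<in> U \<inter> graph_vars P \<phi>" using \<psi>(3) by (force simp: graph_vars_def)
      then show "U \<inter> graph_vars P \<phi> \<noteq> {}" by blast
    qed
  qed
qed

text \<open>The ideal of the theorem in the form used by the proof: the intersection of the primes \<open>(x\<^sup>\<phi>)\<close>,
  \<open>\<phi> \<in> J\<close>. It is the Alexander dual by \<open>dual_letterplace_ideal_eq\<close>.\<close>

definition dual_ideal :: "nat \<Rightarrow> 'p set \<Rightarrow> ('p \<Rightarrow> nat) set \<Rightarrow> (nat \<times> 'p, 'k::field) mpoly set" where
  "dual_ideal n P J = mono_ideal ({1..n} \<times> P) (\<lambda>m. meets_graphs P J (keys m))"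

lemma dual_ideal_ideal: "ideal_in (polys ({1..n} \<times> P)) (dual_ideal n P J)"
  unfolding dual_ideal_def by (rule mono_ideal_ideal) (fastforce simp: meets_graphs_def keys_add_nat)

lemma dual_ideal_subset_coord: "\<phi> \<in> J \<Longrightarrow> dual_ideal n P J \<subseteq> coord_ideal ({1..n} \<times> P) (graph_vars P \<phi>)"
  by (auto simp: dual_ideal_def coord_ideal_def mono_ideal_def meets_graphs_def)

lemma dual_ideal_antimono: "J' \<subseteq> J \<Longrightarrow> dual_ideal n P J \<subseteq> dual_ideal n P J'"
  by (auto simp: dual_ideal_def mono_ideal_def meets_graphs_def)

lemma swap_Lambda_subset: "prod.swap ` Lambda P n \<phi> \<subseteq> {1..n} \<times> P"
  by (auto simp: Lambda_def)

lemma finite_Lambda: "finite P \<Longrightarrow> finite (Lambda P n \<phi>)"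
  by (rule finite_subset[of _ "P \<times> {1..n}"]) (auto simp: Lambda_def)

definition Lambda_monomial :: "nat \<Rightarrow> 'p::order set \<Rightarrow> ('p \<Rightarrow> nat) \<Rightarrow> (nat \<times> 'p, 'k::field) mpoly" where
  "Lambda_monomial n P \<phi> = (\<Prod>v\<in>prod.swap ` Lambda P n \<phi>. var v)"

lemma Lambda_monomial_eq:
  "finite P \<Longrightarrow> Lambda_monomial n P \<phi> = single (sqfree_exp (prod.swap ` Lambda P n \<phi>)) 1"
  by (simp add: Lambda_monomial_def prod_var_eq_single finite_Lambda)

lemma Lambda_monomial_polys: "finite P \<Longrightarrow> Lambda_monomial n P \<phi> \<in> polys ({1..n} \<times> P)"
  unfolding Lambda_monomial_eq
  by (rule single_in_polys) (use swap_Lambda_subset[of P n \<phi>] finite_Lambda[of P n \<phi>] in \<open>simp add: keys_sqfree_exp\<close>)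

lemma Lambda_monomial_notin_coord:
  "finite P \<Longrightarrow> (Lambda_monomial n P \<phi> :: (_, 'k::field) mpoly) \<notin> coord_ideal ({1..n} \<times> P) (graph_vars P \<phi>)"
proof
  assume P: "finite P" and "(Lambda_monomial n P \<phi> :: (_, 'k) mpoly) \<in> coord_ideal ({1..n} \<times> P) (graph_vars P \<phi>)"
  then have "prod.swap ` Lambda P n \<phi> \<inter> graph_vars P \<phi> \<noteq> {}"
    using finite_Lambda[OF P, of n \<phi>]
    by (simp add: Lambda_monomial_eq coord_ideal_def mono_ideal_def keys_sqfree_exp)
  then show False by (auto simp: graph_vars_def Lambda_def)
qed

section \<open>Freeness over the ring of consecutive differences\<close>

text \<open>The ring of consecutive differences is the image of \<open>k[x\<^sub>T]\<close>, \<open>T = [n-1] \<times> P\<close>, under \<open>subst diff_var\<close>.\<close>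

definition diff_var :: "nat \<times> 'p \<Rightarrow> (nat \<times> 'p, 'k::field) mpoly" where
  "diff_var v = var v - var (Suc (fst v), snd v)"

lemma diff_var_polys: "v \<in> {1..<n} \<times> P \<Longrightarrow> diff_var v \<in> polys ({1..n} \<times> P)"
  unfolding diff_var_def by (intro polys_diff var_in_polys) auto

lemma subst_diff_polys: "f \<in> polys ({1..<n} \<times> P) \<Longrightarrow> subst diff_var f \<in> polys ({1..n} \<times> P)"
  by (rule subst_in_subring[OF _ subring_polys cst_in_polys diff_var_polys])

text \<open>Modulo \<open>(x\<^sup>\<psi>)\<close> each variable \<open>x\<^bsub>j,p\<^esub>\<close> is \<open>x\<^bsub>j,p\<^esub> - x\<^bsub>\<psi>(p),p\<^esub>\<close>, a telescoping sum of differences up to sign.\<close>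

lemma poly_mod_coord:
  assumes \<psi>: "\<And>p. p \<in> P \<Longrightarrow> \<psi> p \<in> {1..n}" and f: "f \<in> polys ({1..n} \<times> P)"
  shows "\<exists>b\<in>polys ({1..<n} \<times> P). f - subst diff_var b \<in> coord_ideal ({1..n} \<times> P) (graph_vars P \<psi>)"
proof -
  let ?S = "polys ({1..n} \<times> P) :: (nat \<times> 'a, 'b) mpoly set"
  let ?I = "coord_ideal ({1..n} \<times> P) (graph_vars P \<psi>) :: (nat \<times> 'a, 'b) mpoly set"
  let ?B = "polys ({1..<n} \<times> P) :: (nat \<times> 'a, 'b) mpoly set"
  define X where "X = {f \<in> ?S. \<exists>b\<in>?B. f - subst diff_var b \<in> ?I}"
  have I: "ideal_in ?S ?I" by (rule coord_ideal_ideal)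
  note R = subring_setD[OF subring_polys[of "{1..n} \<times> P"]] and RB = subring_setD[OF subring_polys[of "{1..<n} \<times> P"]]
  have memX: "f \<in> X" if "f \<in> ?S" "b \<in> ?B" "f - subst diff_var b \<in> ?I" for f b
    using that by (auto simp: X_def)
  have cstX: "cst c \<in> X" for c
    by (rule memX[OF cst_in_polys cst_in_polys[of c]]) (simp only: subst_cst diff_self ideal_inD(2)[OF I])
  have "subring_set X"
    unfolding subring_set_def
  proof (intro conjI ballI)
    show "1 \<in> X" using cstX[of 1] by simp
  next
    fix f assume "f \<in> X"
    then obtain b where b: "f \<in> ?S" "b \<in> ?B" "f - subst diff_var b \<in> ?I" by (auto simp: X_def)
    have eq: "- f - subst diff_var (0 - b) = - (f - subst diff_var b)" unfolding subst_minus by simp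
    show "- f \<in> X"
      by (rule memX[OF R(3)[OF b(1)] RB(6)[OF RB(2) b(2)]])
        (simp only: eq ideal_in_minus(1)[OF I subring_polys b(3)])
  next
    fix f g assume "f \<in> X" "g \<in> X"
    then obtain b d where b: "f \<in> ?S" "b \<in> ?B" "f - subst diff_var b \<in> ?I"
      and d: "g \<in> ?S" "d \<in> ?B" "g - subst diff_var d \<in> ?I" by (auto simp: X_def)
    have eq: "f + g - subst diff_var (b + d) = (f - subst diff_var b) + (g - subst diff_var d)"
      by (simp add: subst_add)
    show "f + g \<in> X"
      by (rule memX[OF R(4)[OF b(1) d(1)] RB(4)[OF b(2) d(2)]]) (simp only: eq ideal_inD(3)[OF I b(3) d(3)])
    have eq: "f * g - subst diff_var (b * d) = g * (f - subst diff_var b) + subst diff_var b * (g - subst diff_var d)"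
      by (simp add: subst_mult algebra_simps)
    have "g * (f - subst diff_var b) + subst diff_var b * (g - subst diff_var d) \<in> ?I"
      using b d subst_diff_polys[OF b(2)] by (intro ideal_inD(3)[OF I] ideal_inD(4)[OF I])
    then show "f * g \<in> X"
      by (intro memX[OF R(5)[OF b(1) d(1)] RB(5)[OF b(2) d(2)]]) (simp only: eq)
  qed
  moreover have "var v \<in> X" if v: "v \<in> {1..n} \<times> P" for v
  proof -
    obtain j p where jp: "v = (j, p)" "j \<in> {1..n}" "p \<in> P" using v by auto
    let ?x = "\<lambda>i. var (i, p) :: (nat \<times> 'a, 'b) mpoly"
    have "?x (\<psi> p) \<in> ?I"
      using jp \<psi> by (subst var_in_coord_ideal_iff) (auto simp: graph_vars_def)
    moreover have tele: "subst diff_var (\<Sum>i\<in>{a..<b}. ?x i) = ?x a - ?x b" if "a \<le> b" for a b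
    proof -
      have "(\<Sum>i=a..<b. - ?x (Suc i) - (- ?x i)) = - ?x b - (- ?x a)" by (rule sum_Suc_diff'[OF that])
      then show ?thesis by (simp add: subst_sum diff_var_def)
    qed
    have BB: "(\<Sum>i\<in>{a..<b}. ?x i) \<in> ?B" if "1 \<le> a" "b \<le> n" for a b
      using that jp by (intro polys_sum var_in_polys) auto
    show ?thesis
    proof (cases "j \<le> \<psi> p")
      case True
      show ?thesis
        by (rule memX[OF var_in_polys[OF v] BB[of j "\<psi> p"]])
          (use jp \<psi> tele[OF True] \<open>?x (\<psi> p) \<in> ?I\<close> in auto)
    next
      case False
      show ?thesis
        by (rule memX[OF var_in_polys[OF v] RB(6)[OF RB(2) BB[of "\<psi> p" j]]])
          (use jp \<psi>[of p] False tele[of "\<psi> p" j] \<open>?x (\<psi> p) \<in> ?I\<close> in \<open>auto simp: subst_minus[of _ 0, simplified]\<close>)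
    qed
  qed
  ultimately have "?S \<subseteq> X" using cstX by (intro polys_subset_subring)
  then show ?thesis using f by (auto simp: X_def)
qed

text \<open>The same telescoping sums define a substitution that kills \<open>(x\<^sup>\<psi>)\<close> and is inverse to \<open>diff_var\<close>.\<close>

lemma subst_diff_coord_eq_0:
  fixes t :: "(nat \<times> 'p, 'k::field) mpoly"
  assumes t: "t \<in> polys ({1..<n} \<times> P)" and mem: "subst diff_var t \<in> coord_ideal ({1..n} \<times> P) (graph_vars P \<psi>)"
  shows "t = 0"
proof -
  define \<sigma> :: "nat \<times> 'p \<Rightarrow> (nat \<times> 'p, 'k) mpoly" where
    "\<sigma> = (\<lambda>(j, p). (\<Sum>i\<in>{j..<\<psi> p}. var (i, p)) - (\<Sum>i\<in>{\<psi> p..<j}. var (i, p)))"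
  have inv: "subst \<sigma> (diff_var v) = var v" for v
  proof -
    obtain i p where v: "v = (i, p)" by (cases v)
    have "\<sigma> (i, p) - \<sigma> (Suc i, p) = var (i, p)"
    proof (cases "i < \<psi> p")
      case True
      then show ?thesis by (simp add: \<sigma>_def sum.atLeast_Suc_lessThan)
    next
      case False
      then show ?thesis by (simp add: \<sigma>_def)
    qed
    then show ?thesis by (simp add: v diff_var_def subst_minus)
  qed
  have kill: "subst \<sigma> f = 0" if f: "f \<in> coord_ideal ({1..n} \<times> P) (graph_vars P \<psi>)" for f
    unfolding subst_def
  proof (rule sum.neutral, rule ballI)
    fix m assume "m \<in> keys f"
    then obtain p where "(\<psi> p, p) \<in> keys m"
      using f by (auto simp: coord_ideal_def mono_ideal_def graph_vars_def)
    then have "mono_val \<sigma> m = 0" by (rule subst_eq_0_single) (simp add: \<sigma>_def)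
    then show "cst (lookup f m) * mono_val \<sigma> m = 0" by simp
  qed
  have "t = subst \<sigma> (subst diff_var t)"
    unfolding subst_subst by (rule subst_id[OF t, symmetric]) (rule inv)
  then show ?thesis using kill[OF mem] by simp
qed

text \<open>Induction on \<open>|J|\<close>, removing a maximal element \<open>\<psi>\<close>. With \<open>J' = J - {\<psi>}\<close>, the ideal of \<open>J'\<close> is that of \<open>J\<close> plus
  the multiples of the monomial of \<open>\<Lambda>\<psi>\<close> (\<open>step\<close>), and \<open>(x\<^sup>\<psi>)\<close> annihilates that monomial modulo the ideal
  of \<open>J\<close> (\<open>colon\<close>). Hence the remainder of an expansion over \<open>J'\<close> is expanded by \<open>poly_mod_coord\<close>. In a
  relation over \<open>J\<close> the coefficients over \<open>J'\<close> vanish by induction; the last one vanishes because \<open>(x\<^sup>\<psi>)\<close> is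
  prime, does not contain the monomial of \<open>\<Lambda>\<psi>\<close>, and meets the ring of differences in zero only.\<close>

theorem free_basis:
  fixes P :: "'p::order set" and J :: "('p \<Rightarrow> nat) set"
  assumes n: "n \<ge> 1" and P: "finite P" and J: "poset_ideal (isotone_maps P {1..n}) (pointwise_le P) J"
  defines "B \<equiv> polys ({1..<n} \<times> P) :: (nat \<times> 'p, 'k::field) mpoly set"
  shows "f \<in> polys ({1..n} \<times> P) \<Longrightarrow>
      \<exists>a. (\<forall>\<phi>\<in>J. a \<phi> \<in> B) \<and> f - (\<Sum>\<phi>\<in>J. subst diff_var (a \<phi>) * Lambda_monomial n P \<phi>) \<in> dual_ideal n P J" (is "_ \<Longrightarrow> ?span J f")
    and "(\<And>\<phi>. \<phi> \<in> J \<Longrightarrow> b \<phi> \<in> B) \<Longrightarrow>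
      (\<Sum>\<phi>\<in>J. subst diff_var (b \<phi>) * Lambda_monomial n P \<phi>) \<in> dual_ideal n P J \<Longrightarrow> \<phi> \<in> J \<Longrightarrow> b \<phi> = 0"
proof -
  let ?H = "isotone_maps P {1..n}" and ?V = "{1..n} \<times> P"
  let ?S = "polys ?V :: (nat \<times> 'p, 'k) mpoly set"
  let ?L = "\<lambda>J. dual_ideal n P J :: (nat \<times> 'p, 'k) mpoly set"
  let ?x = "\<lambda>\<phi>. Lambda_monomial n P \<phi> :: (nat \<times> 'p, 'k) mpoly"
  let ?sum = "\<lambda>a J. \<Sum>\<phi>\<in>J. subst diff_var (a \<phi>) * ?x \<phi>"
  have "finite ?H" using P by (simp add: finite_isotone_maps)
  then have "finite J" using J finite_subset by (auto simp: poset_ideal_def)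
  have "(\<forall>f\<in>?S. ?span J f) \<and> (\<forall>b. (\<forall>\<phi>\<in>J. b \<phi> \<in> B) \<longrightarrow> ?sum b J \<in> ?L J \<longrightarrow> (\<forall>\<phi>\<in>J. b \<phi> = 0))"
    using \<open>finite J\<close> J
  proof (induction "card J" arbitrary: J)
    case 0
    then show ?case by (auto simp: dual_ideal_def mono_ideal_def meets_graphs_def)
  next
    case (Suc k)
    have JH: "J \<subseteq> ?H" using Suc.prems by (simp add: poset_ideal_def)
    have "J \<noteq> {}" using Suc.hyps(2) by auto
    \<comment> \<open>an element of largest total value is maximal\<close>
    define s where "s \<phi> = (\<Sum>p\<in>P. \<phi> p)" for \<phi> :: "'p \<Rightarrow> nat"
    have "Max (s ` J) \<in> s ` J" using \<open>J \<noteq> {}\<close> Suc.prems(1) by (intro Max_in) auto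
    then obtain \<psi> where \<psi>: "\<psi> \<in> J" "s \<psi> = Max (s ` J)" by auto
    have max: "\<phi> = \<psi>" if "\<phi> \<in> J" "pointwise_le P \<psi> \<phi>" for \<phi>
    proof (rule ccontr)
      assume "\<phi> \<noteq> \<psi>"
      have ext: "\<phi> \<in> extensional P" "\<psi> \<in> extensional P" using that(1) \<psi>(1) JH by (auto simp: isotone_maps_def PiE_def)
      obtain p where "p \<in> P" "\<phi> p \<noteq> \<psi> p" using extensionalityI[OF ext] \<open>\<phi> \<noteq> \<psi>\<close> by blast
      then have "s \<psi> < s \<phi>" unfolding s_def using that(2) P
        by (intro sum_strict_mono_ex1) (auto simp: pointwise_le_def intro!: bexI[of _ p] le_neq_trans)
      moreover have "s \<phi> \<le> Max (s ` J)" using that(1) Suc.prems(1) by simp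
      ultimately show False using \<psi>(2) by simp
    qed
    define J' where "J' = J - {\<psi>}"
    have J'ideal: "poset_ideal ?H (pointwise_le P) J'"
      using Suc.prems(2) max unfolding poset_ideal_def J'_def by blast
    have J: "J = insert \<psi> J'" "\<psi> \<notin> J'" "finite J'" using \<psi> Suc.prems by (auto simp: J'_def)
    have IH: "\<And>f. f \<in> ?S \<Longrightarrow> ?span J' f"
      "\<And>b. \<forall>\<phi>\<in>J'. b \<phi> \<in> B \<Longrightarrow> ?sum b J' \<in> ?L J' \<Longrightarrow> \<forall>\<phi>\<in>J'. b \<phi> = 0"
      using Suc.hyps(1)[OF _ J(3) J'ideal] Suc.hyps(2) J by auto
    let ?C = "coord_ideal ?V (graph_vars P \<psi>) :: (nat \<times> 'p, 'k) mpoly set"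
    have \<psi>n: "\<And>p. p \<in> P \<Longrightarrow> \<psi> p \<in> {1..n}" using isotone_mapsD(1) \<psi>(1) JH by blast
    have xS: "?x \<phi> \<in> ?S" for \<phi> by (rule Lambda_monomial_polys[OF P])
    have LI: "ideal_in ?S (?L J)" "ideal_in ?S (?L J')" by (rule dual_ideal_ideal)+
    have keys_x: "keys (sqfree_exp (prod.swap ` Lambda P n \<psi>)) = prod.swap ` Lambda P n \<psi>"
      using finite_Lambda[OF P] by (intro keys_sqfree_exp) auto
    have xL': "?x \<psi> \<in> ?L J'"
    proof -
      have "meets_graphs P J' (prod.swap ` Lambda P n \<psi>)"
        using meets_graphs_iff[OF n P J'ideal swap_Lambda_subset, of \<psi>] \<psi>(1) JH J(2) by blast
      then show ?thesis
        unfolding Lambda_monomial_eq[OF P] dual_ideal_def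
        by (intro mono_ideal_mem_single) (simp_all only: keys_x swap_Lambda_subset)
    qed
    \<comment> \<open>the monomials of \<open>g\<close> meet the graph of \<open>\<psi>\<close>, and the monomial of \<open>\<Lambda>\<psi>\<close> meets all others\<close>
    have colon: "g * ?x \<psi> \<in> ?L J" if g: "g \<in> ?C" for g
    proof -
      have "meets_graphs P J (keys m)" if m: "m \<in> keys (g * ?x \<psi>)" for m
      proof -
        obtain l where l: "l \<in> keys g" "m = l + sqfree_exp (prod.swap ` Lambda P n \<psi>)"
          using m keys_mult[of g "?x \<psi>"] by (auto simp: Lambda_monomial_eq[OF P])
        have "keys l \<inter> graph_vars P \<psi> \<noteq> {}" using g l(1) by (auto simp: coord_ideal_def mono_ideal_def)
        moreover have "meets_graphs P J' (prod.swap ` Lambda P n \<psi>)"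
          using xL' by (simp add: Lambda_monomial_eq[OF P] dual_ideal_def mono_ideal_def keys_x)
        ultimately show ?thesis
          unfolding l(2) keys_add_nat keys_x J(1) meets_graphs_def by (auto simp: Int_Un_distrib2)
      qed
      moreover have "g * ?x \<psi> \<in> ?S" using g xS by (intro polys_mult) (auto simp: coord_ideal_def mono_ideal_def)
      ultimately show ?thesis by (simp add: dual_ideal_def mono_ideal_def)
    qed
    have step: "\<exists>h\<in>?S. l - h * ?x \<psi> \<in> ?L J" if l: "l \<in> ?L J'" for l
    proof -
      let ?M = "keys l"
      have "\<exists>h\<in>?S. single m (lookup l m) - h * ?x \<psi> \<in> ?L J" if m: "m \<in> ?M" for m
      proof -
        have mV: "keys m \<subseteq> ?V" and mJ': "meets_graphs P J' (keys m)"
          using l m by (auto simp: dual_ideal_def mono_ideal_def polys_def)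
        show ?thesis
        proof (cases "meets_graphs P J (keys m)")
          case True
          then show ?thesis using mV
            by (intro bexI[of _ 0]) (auto simp: dual_ideal_def mono_ideal_def single_in_polys polys_zero)
        next
          case False
          then have "prod.swap ` Lambda P n \<psi> \<subseteq> keys m"
            using mJ' meets_graphs_iff[OF n P J'ideal mV] meets_graphs_iff[OF n P Suc.prems(2) mV] J(1) by blast
          then obtain d where d: "m = sqfree_exp (prod.swap ` Lambda P n \<psi>) + d"
            using sqfree_exp_dvd[of "prod.swap ` Lambda P n \<psi>" m] finite_Lambda[OF P] by blast
          then have "keys d \<subseteq> ?V" using mV by (simp add: keys_add_nat)
          moreover have "single m (lookup l m) = single d (lookup l m) * ?x \<psi>"
            by (simp add: Lambda_monomial_eq[OF P] mult_single d add.commute)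
          ultimately show ?thesis
            by (intro bexI[of _ "single d (lookup l m)"])
              (auto simp: single_in_polys ideal_inD(2)[OF LI(1)])
        qed
      qed
      then obtain h where h: "\<And>m. m \<in> ?M \<Longrightarrow> h m \<in> ?S \<and> single m (lookup l m) - h m * ?x \<psi> \<in> ?L J" by metis
      have "(\<Sum>m\<in>?M. single m (lookup l m) - h m * ?x \<psi>) \<in> ?L J"
        using h by (intro ideal_in_sum[OF LI(1)]) auto
      then have "l - (\<Sum>m\<in>?M. h m) * ?x \<psi> \<in> ?L J"
        by (simp add: sum_subtractf sum_distrib_right flip: mpoly_eq_sum_single)
      moreover have "(\<Sum>m\<in>?M. h m) \<in> ?S" using h by (intro polys_sum) auto
      ultimately show ?thesis by blast
    qed
    show ?case
    proof (intro conjI ballI allI impI)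
      fix f assume f: "f \<in> ?S"
      obtain a where a: "\<forall>\<phi>\<in>J'. a \<phi> \<in> B" "f - ?sum a J' \<in> ?L J'" using IH(1)[OF f] by blast
      obtain h where h: "h \<in> ?S" "f - ?sum a J' - h * ?x \<psi> \<in> ?L J" using step[OF a(2)] by blast
      obtain b where b: "b \<in> B" "h - subst diff_var b \<in> ?C"
        unfolding B_def using poly_mod_coord[of P \<psi> n h, OF \<psi>n h(1)] by blast
      define a' where "a' = a(\<psi> := b)"
      have "?sum a' J = subst diff_var b * ?x \<psi> + ?sum a J'"
        using J by (simp add: a'_def) (intro sum.cong, auto)
      then have "f - ?sum a' J = (f - ?sum a J' - h * ?x \<psi>) + (h - subst diff_var b) * ?x \<psi>"
        by (simp add: algebra_simps)
      also have "\<dots> \<in> ?L J" by (rule ideal_inD(3)[OF LI(1) h(2) colon[OF b(2)]])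
      finally show "?span J f" using a(1) b(1) J by (intro exI[of _ a']) (auto simp: a'_def)
    next
      fix b \<phi> assume b: "\<forall>\<phi>\<in>J. b \<phi> \<in> B" and mem: "?sum b J \<in> ?L J" and \<phi>: "\<phi> \<in> J"
      have sum: "?sum b J = subst diff_var (b \<psi>) * ?x \<psi> + ?sum b J'" using J by simp
      have bS: "subst diff_var (b \<psi>) \<in> ?S" using b \<psi>(1) unfolding B_def by (intro subst_diff_polys) auto
      have "?sum b J \<in> ?L J'" using mem dual_ideal_antimono[of J' J n P] J(1) by blast
      then have "?sum b J - subst diff_var (b \<psi>) * ?x \<psi> \<in> ?L J'"
        using ideal_inD(4)[OF LI(2) bS xL'] by (rule ideal_in_minus(2)[OF LI(2) subring_polys])
      then have "?sum b J' \<in> ?L J'" by (simp add: sum)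
      then have b0: "\<forall>\<phi>\<in>J'. b \<phi> = 0" using IH(2)[of b] b J(1) by blast
      then have "?sum b J = subst diff_var (b \<psi>) * ?x \<psi>" by (simp add: sum)
      then have "subst diff_var (b \<psi>) * ?x \<psi> \<in> ?C" using mem dual_ideal_subset_coord[OF \<psi>(1)] by auto
      then have "subst diff_var (b \<psi>) \<in> ?C"
        using prime_in_mult[OF coord_ideal_prime bS xS] P Lambda_monomial_notin_coord[OF P] by blast
      then have "b \<psi> = 0" using b \<psi>(1) unfolding B_def by (intro subst_diff_coord_eq_0) auto
      then show "b \<phi> = 0" using b0 \<phi> J(1) by auto
    qed
  qed
  then show "f \<in> polys ({1..n} \<times> P) \<Longrightarrow> ?span J f"
    and "(\<And>\<phi>. \<phi> \<in> J \<Longrightarrow> b \<phi> \<in> B) \<Longrightarrow> ?sum b J \<in> ?L J \<Longrightarrow> \<phi> \<in> J \<Longrightarrow> b \<phi> = 0"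
    by blast+
qed

section \<open>The Alexander dual\<close>

text \<open>Stated for a family of index sets and injections because the generators of the three ideals of
  the theorem are products over different index sets: \<open>P\<close>, \<open>[n]\<close> and \<open>\<Lambda>\<phi>\<close>.\<close>

lemma Idl_prod_var:
  fixes A :: "'v set"
  assumes "\<And>r. r \<in> F \<Longrightarrow> finite (X r) \<and> inj_on (e r) (X r) \<and> e r ` X r \<subseteq> A"
  shows "Idl\<^bsub>mpoly_ring A\<^esub> {\<Prod>x\<in>X r. (var (e r x) :: ('v, 'k::field) mpoly) | r. r \<in> F} =
    mono_ideal A (\<lambda>m. \<exists>U\<in>(\<lambda>r. e r ` X r) ` F. U \<subseteq> keys m)"
proof -
  have "(\<Prod>x\<in>X r. (var (e r x) :: ('v, 'k) mpoly)) = (\<Prod>v\<in>e r ` X r. var v)" if "r \<in> F" for r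
    using assms[OF that] by (simp add: prod.reindex)
  then have "{\<Prod>x\<in>X r. (var (e r x) :: ('v, 'k) mpoly) | r. r \<in> F} =
      {\<Prod>v\<in>U. var v | U. U \<in> (\<lambda>r. e r ` X r) ` F}"
    by (auto simp: image_iff) metis+
  then show ?thesis by (simp only:) (rule Idl_sqfree, use assms in blast)
qed

lemma mono_ideal_cong:
  "(\<And>m. keys m \<subseteq> A \<Longrightarrow> E m \<longleftrightarrow> E' m) \<Longrightarrow> mono_ideal A E = mono_ideal A E'"
  by (auto simp: mono_ideal_def polys_def)

lemma single_divides_keys:
  assumes "single a 1 divides\<^bsub>mpoly_ring A\<^esub> single m (1 :: 'k::field)"
  shows "keys a \<subseteq> keys m"
proof -
  obtain c :: "('a, 'k) mpoly" where "single m 1 = single a 1 * c"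
    using assms by (auto simp: factor_def mpoly_ring_eq)
  then have "m \<in> keys (single a (1 :: 'k) * c)" by (metis in_keys_iff lookup_single_eq one_neq_zero)
  then obtain b where "m = a + b" using keys_mult[of "single a (1 :: 'k)" c] by auto
  then show ?thesis by (simp add: keys_add_nat)
qed

lemma var_divides_single:
  assumes "keys m \<subseteq> A" "v \<in> keys m"
  shows "var v divides\<^bsub>mpoly_ring A\<^esub> single m (1 :: 'k::field)"
proof -
  let ?l = "m - single v 1"
  have l: "m = single v 1 + ?l"
    using exp_split_var[OF assms(2)] by (simp add: add.commute)
  then have "keys m = keys (single v (1::nat)) \<union> keys ?l"
    by (metis keys_add_nat)
  then have "single ?l (1 :: 'k) \<in> polys A" using assms(1) by (intro single_in_polys) auto
  moreover have "single m 1 = var v * single ?l (1 :: 'k)"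
    unfolding var_def mult_single l[symmetric] by simp
  ultimately show ?thesis unfolding factor_def mpoly_ring_eq ring_on_simps by blast
qed

text \<open>Two monomials have a common divisor \<open>\<noteq> 1\<close> iff they share a variable, and every monomial of \<open>I\<close> has some
  \<open>U \<in> \<U>\<close> in its support, so it is enough to test against the generators.\<close>

lemma alexander_dual_sqfree:
  fixes A :: "'v set"
  assumes U: "\<And>U. U \<in> \<U> \<Longrightarrow> finite U \<and> U \<subseteq> A"
    and I: "I = (mono_ideal A (\<lambda>m. \<exists>U\<in>\<U>. U \<subseteq> keys m) :: ('v, 'k::field) mpoly set)"
  shows "alexander_dual A I = mono_ideal A (\<lambda>m. \<forall>U\<in>\<U>. keys m \<inter> U \<noteq> {})"
proof -
  let ?dual = "\<lambda>u. \<forall>w \<in> monomials A \<inter> I. \<exists>d \<in> monomials A. d \<noteq> 1 \<and>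
      d divides\<^bsub>mpoly_ring A\<^esub> u \<and> d divides\<^bsub>mpoly_ring A\<^esub> w"
  let ?E = "\<lambda>m. \<forall>U\<in>\<U>. keys m \<inter> U \<noteq> {}"
  let ?s = "\<lambda>m. single m (1 :: 'k)"
  have single_I: "?s m \<in> I \<longleftrightarrow> (\<exists>U\<in>\<U>. U \<subseteq> keys m)" if "keys m \<subseteq> A" for m
    using that by (auto simp: I mono_ideal_def single_in_polys)
  have iff: "?dual (?s m) \<longleftrightarrow> ?E m" if m: "keys m \<subseteq> A" for m
  proof
    assume *: "?dual (?s m)"
    show "?E m"
    proof
      fix U assume UU: "U \<in> \<U>"
      have k: "keys (sqfree_exp U) = U" using U[OF UU] by (intro keys_sqfree_exp) auto
      then have "?s (sqfree_exp U) \<in> monomials A \<inter> I"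
        using single_I[of "sqfree_exp U"] U[OF UU] UU by (auto simp: monomials_def)
      then obtain d where d: "d \<in> monomials A" "d \<noteq> 1" "d divides\<^bsub>mpoly_ring A\<^esub> ?s m"
          "d divides\<^bsub>mpoly_ring A\<^esub> ?s (sqfree_exp U)" using * by blast
      then obtain a where a: "d = ?s a" by (auto simp: monomials_def)
      then have "keys a \<subseteq> keys m" "keys a \<subseteq> U"
        using single_divides_keys d(3,4) k by blast+
      moreover have "keys a \<noteq> {}" using a d(2) by auto
      ultimately show "keys m \<inter> U \<noteq> {}" by blast
    qed
  next
    assume E: "?E m"
    show "?dual (?s m)"
    proof
      fix w assume w: "w \<in> monomials A \<inter> I"
      then obtain l where l: "w = ?s l" "keys l \<subseteq> A" by (auto simp: monomials_def)
      then obtain U where "U \<in> \<U>" "U \<subseteq> keys l" using w single_I by auto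
      then obtain v where v: "v \<in> keys m" "v \<in> keys l" using E by blast
      have "(var v :: ('v, 'k) mpoly) \<in> monomials A"
        unfolding monomials_def var_def using m v(1) by (intro CollectI exI[of _ "single v 1"]) auto
      moreover have "(var v :: ('v, 'k) mpoly) \<noteq> 1"
      proof
        assume "(var v :: ('v, 'k) mpoly) = 1"
        then have "keys (var v :: ('v, 'k) mpoly) = {0}" by simp
        then have "keys (single v (1::nat)) = {}" by (simp add: var_def)
        then show False by simp
      qed
      ultimately show "\<exists>d\<in>monomials A. d \<noteq> 1 \<and> d divides\<^bsub>mpoly_ring A\<^esub> ?s m \<and> d divides\<^bsub>mpoly_ring A\<^esub> w"
        using var_divides_single[OF m v(1)] var_divides_single[OF l(2) v(2)] l(1) by blast
    qed
  qed
  have "{u \<in> monomials A. ?dual u} = ?s ` {m. keys m \<subseteq> A \<and> ?E m}" (is "?lhs = ?rhs")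
  proof
    show "?lhs \<subseteq> ?rhs"
    proof
      fix u assume u: "u \<in> ?lhs"
      then obtain m where "u = ?s m" "keys m \<subseteq> A" unfolding monomials_def by blast
      then show "u \<in> ?rhs" using u iff by blast
    qed
    show "?rhs \<subseteq> ?lhs" using iff unfolding monomials_def by blast
  qed
  then have "alexander_dual A I = Idl\<^bsub>mpoly_ring A\<^esub> (?s ` {m. keys m \<subseteq> A \<and> ?E m})"
    by (simp add: alexander_dual_def)
  also have "\<dots> = mono_ideal A (\<lambda>m. \<exists>g\<in>{m. keys m \<subseteq> A \<and> ?E m}. \<exists>l. m = g + l)"
    by (rule Idl_monomials) auto
  also have "\<dots> = mono_ideal A ?E"
  proof (rule mono_ideal_cong)
    fix m :: "'v \<Rightarrow>\<^sub>0 nat" assume m: "keys m \<subseteq> A"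
    show "(\<exists>g\<in>{m. keys m \<subseteq> A \<and> ?E m}. \<exists>l. m = g + l) \<longleftrightarrow> ?E m"
    proof
      assume "\<exists>g\<in>{m. keys m \<subseteq> A \<and> ?E m}. \<exists>l. m = g + l"
      then obtain g l where "?E g" "m = g + l" by blast
      then show "?E m" by (simp add: keys_add_nat Int_Un_distrib2)
    next
      assume "?E m"
      then show "\<exists>g\<in>{m. keys m \<subseteq> A \<and> ?E m}. \<exists>l. m = g + l"
        using m by (intro bexI[of _ m] exI[of _ 0]) auto
    qed
  qed
  finally show ?thesis .
qed

lemma coletterplace_ideal_eq:
  assumes "finite P" "J \<subseteq> isotone_maps P {1..n}"
  shows "coletterplace_ideal P n J =
    mono_ideal (P \<times> {1..n}) (\<lambda>m. \<exists>U\<in>(\<lambda>\<phi>. (\<lambda>p. (p, \<phi> p)) ` P) ` J. U \<subseteq> keys m)"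
  unfolding coletterplace_ideal_def
proof (rule Idl_prod_var)
  show "finite P \<and> inj_on (\<lambda>p. (p, \<phi> p)) P \<and> (\<lambda>p. (p, \<phi> p)) ` P \<subseteq> P \<times> {1..n}" if "\<phi> \<in> J" for \<phi>
    using assms that isotone_mapsD(1)[of \<phi> P] by (fast intro: inj_onI)
qed

abbreviation swap_exp :: "('a \<times> 'b \<Rightarrow>\<^sub>0 nat) \<Rightarrow> ('b \<times> 'a \<Rightarrow>\<^sub>0 nat)" where
  "swap_exp \<equiv> Poly_Mapping.map_key prod.swap"

lemma keys_swap_exp: "keys (swap_exp m) = prod.swap ` keys m"
  by (auto simp: keys_map_key[OF inj_swap])

lemma swap_exp_swap_exp: "swap_exp (swap_exp m) = m"
  by (rule poly_mapping_eqI) (simp add: map_key.rep_eq[OF inj_swap])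

lemma lookup_swap_vars: "lookup (swap_vars f) m = lookup f (swap_exp m)"
  by (simp add: swap_vars_def map_key.rep_eq[OF inj_map_key_swap])

lemma swap_vars_swap_vars: "swap_vars (swap_vars f) = f"
  by (rule poly_mapping_eqI) (simp add: lookup_swap_vars swap_exp_swap_exp)

lemma swap_vars_mem_mono_ideal:
  assumes "f \<in> mono_ideal A E"
  shows "swap_vars f \<in> mono_ideal (prod.swap ` A) (\<lambda>m. E (swap_exp m))"
proof -
  have "keys m \<subseteq> prod.swap ` A \<and> E (swap_exp m)" if "m \<in> keys (swap_vars f)" for m
  proof -
    have "swap_exp m \<in> keys f" using that by (simp add: in_keys_iff lookup_swap_vars)
    then have "keys (swap_exp m) \<subseteq> A" "E (swap_exp m)" using assms by (auto simp: mono_ideal_def polys_def)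
    then show ?thesis by (force simp: keys_swap_exp)
  qed
  then show ?thesis by (auto simp: mono_ideal_def polys_def)
qed

lemma swap_vars_mono_ideal:
  "swap_vars ` mono_ideal A E = mono_ideal (prod.swap ` A) (\<lambda>m. E (swap_exp m))" (is "_ = ?R")
proof
  show "swap_vars ` mono_ideal A E \<subseteq> ?R" using swap_vars_mem_mono_ideal by blast
  show "?R \<subseteq> swap_vars ` mono_ideal A E"
  proof
    fix f assume "f \<in> ?R"
    then have "swap_vars f \<in> mono_ideal A E"
      using swap_vars_mem_mono_ideal[of f "prod.swap ` A" "\<lambda>m. E (swap_exp m)"]
      by (simp add: swap_exp_swap_exp image_image)
    then show "f \<in> swap_vars ` mono_ideal A E"
      using swap_vars_swap_vars[of f] by (metis imageI)
  qed
qed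

lemma dual_letterplace_ideal_eq:
  fixes P :: "'p::order set"
  assumes P: "finite P" and J: "J \<subseteq> isotone_maps P {1..n}"
  shows "(dual_letterplace_ideal n P J :: (nat \<times> 'p, 'k::field) mpoly set) = dual_ideal n P J"
proof -
  have "alexander_dual (P \<times> {1..n}) (coletterplace_ideal P n J :: ('p \<times> nat, 'k) mpoly set) =
      mono_ideal (P \<times> {1..n}) (\<lambda>m. \<forall>U\<in>(\<lambda>\<phi>. (\<lambda>p. (p, \<phi> p)) ` P) ` J. keys m \<inter> U \<noteq> {})"
    by (rule alexander_dual_sqfree[OF _ coletterplace_ideal_eq[OF assms]])
      (use P J isotone_mapsD(1) in fast)
  then have "(dual_letterplace_ideal n P J :: (nat \<times> 'p, 'k) mpoly set) = mono_ideal (prod.swap ` (P \<times> {1..n}))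
      (\<lambda>m. \<forall>U\<in>(\<lambda>\<phi>. (\<lambda>p. (p, \<phi> p)) ` P) ` J. keys (swap_exp m) \<inter> U \<noteq> {})"
    by (simp only: dual_letterplace_ideal_def swap_vars_mono_ideal)
  moreover have "prod.swap ` (P \<times> {1..n}) = {1..n} \<times> P" by auto
  moreover have "(\<forall>U\<in>(\<lambda>\<phi>. (\<lambda>p. (p, \<phi> p)) ` P) ` J. keys (swap_exp m) \<inter> U \<noteq> {}) \<longleftrightarrow>
      meets_graphs P J (keys m)" for m
  proof -
    have "keys (swap_exp m) \<inter> (\<lambda>p. (p, \<phi> p)) ` P = prod.swap ` (keys m \<inter> graph_vars P \<phi>)" for \<phi>
      by (force simp: keys_swap_exp graph_vars_def)
    then show ?thesis by (simp add: meets_graphs_def)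
  qed
  ultimately show ?thesis by (simp add: dual_ideal_def)
qed

lemma letterplace_ideal_eq:
  "letterplace_ideal n P = mono_ideal ({1..n} \<times> P)
    (\<lambda>m. \<exists>U\<in>(\<lambda>\<rho>. (\<lambda>i. (i, \<rho> i)) ` {1..n}) ` isotone_maps {1..n} P. U \<subseteq> keys m)"
  unfolding letterplace_ideal_def
proof (rule Idl_prod_var)
  show "finite {1..n} \<and> inj_on (\<lambda>i. (i, \<rho> i)) {1..n} \<and> (\<lambda>i. (i, \<rho> i)) ` {1..n} \<subseteq> {1..n} \<times> P"
    if "\<rho> \<in> isotone_maps {1..n} P" for \<rho>
    using that isotone_mapsD(1)[of \<rho> "{1..n}"] by (fast intro: inj_onI)
qed

lemma K_ideal_eq:
  fixes P :: "'p::order set"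
  assumes "finite P"
  shows "(K_ideal n P H :: (nat \<times> 'p, 'k::field) mpoly set) = mono_ideal ({1..n} \<times> P)
    (\<lambda>m. \<exists>U\<in>(\<lambda>\<psi>. prod.swap ` Lambda P n \<psi>) ` H. U \<subseteq> keys m)"
proof -
  have "(\<lambda>(p, i). var (i, p) :: (nat \<times> 'p, 'k) mpoly) = (\<lambda>v. var (prod.swap v))" by auto
  then show ?thesis
    unfolding K_ideal_def
    by (simp only:)
      (intro Idl_prod_var conjI finite_Lambda[OF assms] inj_on_subset[OF inj_swap subset_UNIV] swap_Lambda_subset)
qed

lemma mono_ideal_add:
  fixes A :: "'v set"
  assumes up: "\<And>m l. E m \<Longrightarrow> keys l \<subseteq> A \<Longrightarrow> E (m + l)" "\<And>m l. E' m \<Longrightarrow> keys l \<subseteq> A \<Longrightarrow> E' (m + l)"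
  shows "mono_ideal A E <+>\<^bsub>mpoly_ring A\<^esub> mono_ideal A E' = (mono_ideal A (\<lambda>m. E m \<or> E' m) :: ('v, 'k::field) mpoly set)"
    (is "?L = ?R")
proof -
  note I = mono_ideal_ideal[of E A, OF up(1)] and I' = mono_ideal_ideal[of E' A, OF up(2)]
  have IR: "ideal_in (polys A) ?R" using up by (intro mono_ideal_ideal) auto
  show ?thesis
  proof
    show "?L \<subseteq> ?R"
      unfolding set_add_def' mpoly_ring_eq ring_on_simps
      using ideal_inD(3)[OF IR] by (auto simp: mono_ideal_def)
    show "?R \<subseteq> ?L"
    proof
      fix f :: "('v, 'k) mpoly" assume f: "f \<in> ?R"
      let ?t = "\<lambda>m. single m (lookup f m)"
      let ?K = "keys f"
      have kA: "keys m \<subseteq> A" "E m \<or> E' m" if "m \<in> ?K" for m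
        using f that by (auto simp: mono_ideal_def polys_def)
      have "(\<Sum>m\<in>{m\<in>?K. E m}. ?t m) \<in> mono_ideal A E"
        using kA by (intro ideal_in_sum[OF I] mono_ideal_mem_single) auto
      moreover have "(\<Sum>m\<in>{m\<in>?K. \<not> E m}. ?t m) \<in> mono_ideal A E'"
        using kA by (intro ideal_in_sum[OF I'] mono_ideal_mem_single) auto
      moreover have "(\<Sum>m\<in>{m\<in>?K. E m}. ?t m) + (\<Sum>m\<in>{m\<in>?K. \<not> E m}. ?t m) = f"
      proof -
        have "(\<Sum>m\<in>{m\<in>?K. E m}. ?t m) + (\<Sum>m\<in>{m\<in>?K. \<not> E m}. ?t m) = (\<Sum>m\<in>{m\<in>?K. E m} \<union> {m\<in>?K. \<not> E m}. ?t m)"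
          by (rule sum.union_disjoint[symmetric]) auto
        also have "{m\<in>?K. E m} \<union> {m\<in>?K. \<not> E m} = ?K" by auto
        finally show ?thesis by (simp only: mpoly_eq_sum_single[symmetric])
      qed
      ultimately show "f \<in> ?L"
        unfolding set_add_def' mpoly_ring_eq ring_on_simps by blast
    qed
  qed
qed

theorem dual_ideal_eq_sum:
  fixes P :: "'p::order set"
  assumes n: "n \<ge> 1" and P: "finite P" and J: "poset_ideal (isotone_maps P {1..n}) (pointwise_le P) J"
  shows "dual_ideal n P J =
    letterplace_ideal n P <+>\<^bsub>mpoly_ring ({1..n} \<times> P)\<^esub> K_ideal n P (isotone_maps P {1..n} - J)"
proof -
  have "letterplace_ideal n P <+>\<^bsub>mpoly_ring ({1..n} \<times> P)\<^esub> K_ideal n P (isotone_maps P {1..n} - J) =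
    mono_ideal ({1..n} \<times> P) (\<lambda>m.
      (\<exists>U\<in>(\<lambda>\<rho>. (\<lambda>i. (i, \<rho> i)) ` {1..n}) ` isotone_maps {1..n} P. U \<subseteq> keys m) \<or>
      (\<exists>U\<in>(\<lambda>\<psi>. prod.swap ` Lambda P n \<psi>) ` (isotone_maps P {1..n} - J). U \<subseteq> keys m))"
    unfolding letterplace_ideal_eq K_ideal_eq[OF P]
    by (rule mono_ideal_add) (auto simp: keys_add_nat)
  also have "\<dots> = dual_ideal n P J"
    unfolding dual_ideal_def
    by (rule mono_ideal_cong) (simp only: meets_graphs_iff[OF n P J] bex_simps)
  finally show ?thesis ..
qed

section \<open>Regular sequences modulo the dual ideal\<close>

lemma lspan_image_subst:
  assumes "b \<in> lspan B G" "\<And>b. b \<in> B \<Longrightarrow> subst \<sigma> b \<in> C"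
  shows "subst \<sigma> b \<in> lspan C (subst \<sigma> ` G)"
  using assms(1)
proof induction
  case (step c g x)
  then show ?case using assms(2) by (auto simp: subst_add subst_mult intro: lspan.step)
qed (simp add: lspan.zero)

text \<open>An ideal of the ring of differences extends to the free module coefficientwise.\<close>

lemma lspan_free_iff:
  fixes P :: "'p::order set"
  assumes n: "n \<ge> 1" and P: "finite P" and J: "poset_ideal (isotone_maps P {1..n}) (pointwise_le P) J"
    and G: "G \<subseteq> polys ({1..<n} \<times> P)"
  defines "S \<equiv> polys ({1..n} \<times> P) :: (nat \<times> 'p, 'k::field) mpoly set" and "B \<equiv> polys ({1..<n} \<times> P)"
    and "L \<equiv> dual_ideal n P J"
  shows "f \<in> lspan S (subst diff_var ` G \<union> L) \<longleftrightarrow>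
    (\<exists>a. (\<forall>\<phi>\<in>J. a \<phi> \<in> lspan B G) \<and> f - (\<Sum>\<phi>\<in>J. subst diff_var (a \<phi>) * Lambda_monomial n P \<phi>) \<in> L)"
proof
  let ?x = "\<lambda>\<phi>. Lambda_monomial n P \<phi> :: (nat \<times> 'p, 'k) mpoly"
  let ?T = "subst diff_var ` G \<union> L"
  have BS: "subst diff_var b \<in> S" if "b \<in> B" for b using that unfolding B_def S_def by (rule subst_diff_polys)
  have xS: "?x \<phi> \<in> S" for \<phi> unfolding S_def by (rule Lambda_monomial_polys[OF P])
  have SR: "subring_set S" and BR: "subring_set B" unfolding S_def B_def by (rule subring_polys)+
  have LI: "ideal_in S L" unfolding S_def L_def by (rule dual_ideal_ideal)
  {
    assume "\<exists>a. (\<forall>\<phi>\<in>J. a \<phi> \<in> lspan B G) \<and> f - (\<Sum>\<phi>\<in>J. subst diff_var (a \<phi>) * ?x \<phi>) \<in> L"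
    then obtain a where a: "\<And>\<phi>. \<phi> \<in> J \<Longrightarrow> a \<phi> \<in> lspan B G" "f - (\<Sum>\<phi>\<in>J. subst diff_var (a \<phi>) * ?x \<phi>) \<in> L" by blast
    have "subst diff_var (a \<phi>) \<in> lspan S ?T" if "\<phi> \<in> J" for \<phi>
      by (rule lspan_mono[OF lspan_image_subst[OF a(1)[OF that] BS]]) auto
    then have "(\<Sum>\<phi>\<in>J. ?x \<phi> * subst diff_var (a \<phi>)) \<in> lspan S ?T"
      using xS by (intro lspan_sum lspan_scale SR)
    moreover have "f - (\<Sum>\<phi>\<in>J. subst diff_var (a \<phi>) * ?x \<phi>) \<in> lspan S ?T"
      using a(2) by (intro lspan_base SR) auto
    ultimately have "(\<Sum>\<phi>\<in>J. ?x \<phi> * subst diff_var (a \<phi>)) + (f - (\<Sum>\<phi>\<in>J. subst diff_var (a \<phi>) * ?x \<phi>)) \<in> lspan S ?T"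
      by (rule lspan_add)
    then show "f \<in> lspan S ?T" by (simp add: mult.commute)
  }
  assume "f \<in> lspan S ?T"
  then show "\<exists>a. (\<forall>\<phi>\<in>J. a \<phi> \<in> lspan B G) \<and> f - (\<Sum>\<phi>\<in>J. subst diff_var (a \<phi>) * ?x \<phi>) \<in> L"
  proof induction
    case zero
    show ?case by (intro exI[of _ "\<lambda>_. 0"]) (auto simp: lspan.zero ideal_inD(2)[OF LI])
  next
    case (step s g h)
    then obtain a where a: "\<forall>\<phi>\<in>J. a \<phi> \<in> lspan B G" "h - (\<Sum>\<phi>\<in>J. subst diff_var (a \<phi>) * ?x \<phi>) \<in> L" by blast
    show ?case
    proof (cases "g \<in> L")
      case True
      have "s * g + (h - (\<Sum>\<phi>\<in>J. subst diff_var (a \<phi>) * ?x \<phi>)) \<in> L"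
        using ideal_inD(3)[OF LI ideal_inD(4)[OF LI step(1) True] a(2)] .
      then show ?thesis using a(1) by (intro exI[of _ a]) (simp add: add_diff_eq)
    next
      case False
      then obtain g0 where g0: "g0 \<in> G" "g = subst diff_var g0" using step(2) by blast
      have g0B: "g0 \<in> B" using g0(1) G by (auto simp: B_def)
      obtain b where b: "\<forall>\<phi>\<in>J. b \<phi> \<in> B" "s - (\<Sum>\<phi>\<in>J. subst diff_var (b \<phi>) * ?x \<phi>) \<in> L"
        using free_basis(1)[OF n P J, of s] step(1) unfolding S_def B_def L_def by blast
      have "g * (s - (\<Sum>\<phi>\<in>J. subst diff_var (b \<phi>) * ?x \<phi>)) + (h - (\<Sum>\<phi>\<in>J. subst diff_var (a \<phi>) * ?x \<phi>)) \<in> L"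
        unfolding g0(2) by (intro ideal_inD(3)[OF LI] ideal_inD(4)[OF LI BS[OF g0B]] b(2) a(2))
      also have "g * (s - (\<Sum>\<phi>\<in>J. subst diff_var (b \<phi>) * ?x \<phi>)) + (h - (\<Sum>\<phi>\<in>J. subst diff_var (a \<phi>) * ?x \<phi>)) =
          s * g + h - (\<Sum>\<phi>\<in>J. subst diff_var (b \<phi> * g0 + a \<phi>) * ?x \<phi>)"
      proof -
        have "subst diff_var (b \<phi> * g0 + a \<phi>) * ?x \<phi> = g * (subst diff_var (b \<phi>) * ?x \<phi>) + subst diff_var (a \<phi>) * ?x \<phi>" for \<phi>
          by (simp add: g0(2) subst_add subst_mult algebra_simps)
        then have "(\<Sum>\<phi>\<in>J. subst diff_var (b \<phi> * g0 + a \<phi>) * ?x \<phi>) =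
            g * (\<Sum>\<phi>\<in>J. subst diff_var (b \<phi>) * ?x \<phi>) + (\<Sum>\<phi>\<in>J. subst diff_var (a \<phi>) * ?x \<phi>)"
          by (simp add: sum.distrib sum_distrib_left)
        then show ?thesis by (simp add: algebra_simps)
      qed
      finally have "s * g + h - (\<Sum>\<phi>\<in>J. subst diff_var (b \<phi> * g0 + a \<phi>) * ?x \<phi>) \<in> L" .
      moreover have "\<forall>\<phi>\<in>J. b \<phi> * g0 + a \<phi> \<in> lspan B G" using a(1) b(1) g0(1) by (auto intro: lspan.step)
      ultimately show ?thesis by (intro exI[of _ "\<lambda>\<phi>. b \<phi> * g0 + a \<phi>"] conjI)
    qed
  qed
qed

text \<open>Freeness reduces the cancellation of a polynomial in one difference to the cancellation of a
  univariate polynomial in each coefficient.\<close>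

theorem regular_mod_dual:
  fixes P :: "'p::order set" and c :: "nat \<Rightarrow> 'k::field"
  assumes n: "n \<ge> 1" and P: "finite P" and J: "poset_ideal (isotone_maps P {1..n}) (pointwise_le P) J"
    and G: "G \<subseteq> polys ({1..<n} \<times> P)" "G \<subseteq> polys (- {v})" and v: "v \<in> {1..<n} \<times> P" and c: "c N \<noteq> 0"
    and f: "f \<in> polys ({1..n} \<times> P)"
    and mem: "(\<Sum>i\<le>N. cst (c i) * diff_var v ^ i) * f \<in> lspan (polys ({1..n} \<times> P)) (subst diff_var ` G \<union> dual_ideal n P J)"
  shows "f \<in> lspan (polys ({1..n} \<times> P)) (subst diff_var ` G \<union> dual_ideal n P J)"
proof -
  let ?S = "polys ({1..n} \<times> P) :: (nat \<times> 'p, 'k) mpoly set" and ?B = "polys ({1..<n} \<times> P) :: (nat \<times> 'p, 'k) mpoly set"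
  let ?L = "dual_ideal n P J :: (nat \<times> 'p, 'k) mpoly set"
  let ?x = "\<lambda>\<phi>. Lambda_monomial n P \<phi> :: (nat \<times> 'p, 'k) mpoly"
  define g :: "(nat \<times> 'p, 'k) mpoly" where "g = (\<Sum>i\<le>N. cst (c i) * var v ^ i)"
  have gs: "subst diff_var g = (\<Sum>i\<le>N. cst (c i) * diff_var v ^ i)"
    by (simp add: g_def subst_sum subst_mult subst_power)
  have gB: "g \<in> ?B" unfolding g_def
    by (intro polys_sum polys_mult cst_in_polys polys_power var_in_polys[OF v])
  have LI: "ideal_in ?S ?L" by (rule dual_ideal_ideal)
  have GB: "lspan ?B G \<subseteq> ?B" using lspan_ideal[OF subring_polys G(1)] by (rule ideal_inD(1))
  obtain b where b: "\<forall>\<phi>\<in>J. b \<phi> \<in> ?B" "f - (\<Sum>\<phi>\<in>J. subst diff_var (b \<phi>) * ?x \<phi>) \<in> ?L"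
    using free_basis(1)[OF n P J f] by blast
  obtain a where a: "\<forall>\<phi>\<in>J. a \<phi> \<in> lspan ?B G" "subst diff_var g * f - (\<Sum>\<phi>\<in>J. subst diff_var (a \<phi>) * ?x \<phi>) \<in> ?L"
    using mem unfolding lspan_free_iff[OF n P J G(1)] gs by blast
  have "(subst diff_var g * f - (\<Sum>\<phi>\<in>J. subst diff_var (a \<phi>) * ?x \<phi>)) - subst diff_var g * (f - (\<Sum>\<phi>\<in>J. subst diff_var (b \<phi>) * ?x \<phi>)) \<in> ?L"
    by (intro ideal_in_minus(2)[OF LI subring_polys] a(2) ideal_inD(4)[OF LI subst_diff_polys[OF gB]] b(2))
  also have "(subst diff_var g * f - (\<Sum>\<phi>\<in>J. subst diff_var (a \<phi>) * ?x \<phi>)) - subst diff_var g * (f - (\<Sum>\<phi>\<in>J. subst diff_var (b \<phi>) * ?x \<phi>)) =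
      (\<Sum>\<phi>\<in>J. subst diff_var (g * b \<phi> - a \<phi>) * ?x \<phi>)"
    by (simp add: subst_minus subst_mult sum_subtractf sum_distrib_left right_diff_distrib left_diff_distrib mult.assoc)
  finally have *: "(\<Sum>\<phi>\<in>J. subst diff_var (g * b \<phi> - a \<phi>) * ?x \<phi>) \<in> ?L" .
  have "g * b \<phi> - a \<phi> = 0" if "\<phi> \<in> J" for \<phi>
    using free_basis(2)[OF n P J _ * that] gB b(1) a(1) GB by (meson polys_mult polys_diff subsetD)
  then have "\<forall>\<phi>\<in>J. b \<phi> \<in> lspan ?B G"
    using univariate_regular[OF G, of c N] c a(1) by (simp add: g_def)
  then show ?thesis unfolding lspan_free_iff[OF n P J G(1)] using b(2) by blast
qed

section \<open>Quotient rings\<close>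

lemma (in cring) maximalideal_inverse:
  assumes "maximalideal M R" "a \<in> carrier R" "a \<notin> M"
  shows "\<exists>m\<in>M. \<exists>b\<in>carrier R. \<one> = m \<oplus> b \<otimes> a"
proof -
  interpret M: maximalideal M R by fact
  have "M <+>\<^bsub>R\<^esub> PIdl a = carrier R"
    using M.I_maximal[OF ideal_add_principal(1)[OF M.is_ideal assms(2)] ideal_add_principal(2)[OF M.is_ideal assms(2)]]
      ideal_add_principal(1,3)[OF M.is_ideal assms(2)] assms(3) additive_subgroup.a_subset[OF ideal.axioms(1)] by metis
  then have "\<one> \<in> M <+>\<^bsub>R\<^esub> PIdl a" by simp
  then show ?thesis by (auto simp: set_add_def' cgenideal_def)
qed

locale quotient_setting =
  fixes S L :: "'a::comm_ring_1 set"
  assumes S: "subring_set S" and L: "ideal_in S L"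
begin

abbreviation "R \<equiv> ring_on S"
abbreviation "Q \<equiv> R Quot L"
definition proj :: "'a \<Rightarrow> 'a set" where "proj = a_r_coset R L"

sublocale R: cring R by (rule cring_ring_on[OF S])

lemma L_ideal: "ideal L R" using L by (simp add: ideal_ring_on_iff[OF S])

sublocale Q: cring Q by (rule ideal.quotient_is_cring[OF L_ideal R.is_cring])

sublocale hom: ring_hom_ring R Q proj
  unfolding proj_def by (rule ideal.rcos_ring_hom_ring[OF L_ideal])

lemma carrier_Q: "carrier Q = proj ` S"
  unfolding proj_def by (auto simp: FactRing_def A_RCOSETS_def')

lemma proj_simps:
  "a \<in> S \<Longrightarrow> b \<in> S \<Longrightarrow> proj (a * b) = proj a \<otimes>\<^bsub>Q\<^esub> proj b"
  "a \<in> S \<Longrightarrow> b \<in> S \<Longrightarrow> proj (a + b) = proj a \<oplus>\<^bsub>Q\<^esub> proj b"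
  "proj 1 = \<one>\<^bsub>Q\<^esub>"
  "a \<in> S \<Longrightarrow> proj a \<in> carrier Q"
  using hom.hom_mult[of a b] hom.hom_add[of a b] hom.hom_one carrier_Q by auto

lemma proj_eq_iff: "a \<in> S \<Longrightarrow> b \<in> S \<Longrightarrow> proj a = proj b \<longleftrightarrow> a - b \<in> L"
proof -
  assume ab: "a \<in> S" "b \<in> S"
  have "\<ominus>\<^bsub>R\<^esub> b = - b"
    by (rule R.minus_equality) (use ab subring_setD(3)[OF S] in auto)
  then have "a \<ominus>\<^bsub>R\<^esub> b = a - b" by (simp add: a_minus_def)
  then show ?thesis using R.quotient_eq_iff_same_a_r_cos[OF L_ideal, of a b] ab by (simp add: proj_def)
qed

text \<open>Ideals of the quotient are studied through their inverse images in \<open>S\<close>.\<close>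

definition pre :: "'a set set \<Rightarrow> 'a set" where "pre K = {a \<in> S. proj a \<in> K}"

lemma pre_ideal: "ideal K Q \<Longrightarrow> ideal_in S (pre K)"
  using hom.ideal_vimage[of K] ideal_ring_on_iff[OF S, of "pre K"] by (simp add: pre_def)

lemma L_subset_pre: "ideal K Q \<Longrightarrow> L \<subseteq> pre K"
proof
  fix l assume K: "ideal K Q" and l: "l \<in> L"
  have lS: "l \<in> S" using ideal_in_sub[OF L l] .
  then have "proj l = proj 0" using l subring_setD(2)[OF S] by (simp add: proj_eq_iff)
  also have "\<dots> \<in> K" using ideal_inD(2)[OF pre_ideal[OF K]] by (simp add: pre_def)
  finally show "l \<in> pre K" using lS by (simp add: pre_def)
qed

lemma pre_prime: "primeideal K Q \<Longrightarrow> prime_in S (pre K)"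
  using hom.primeideal_vimage[OF R.is_cring, of K] primeideal_ring_on_iff[OF S, of "pre K"] by (simp add: pre_def)

lemma ideal_Q_subset: "ideal K Q \<Longrightarrow> K \<subseteq> proj ` S"
  using additive_subgroup.a_subset[OF ideal.axioms(1)] carrier_Q by blast

lemma pre_strict_mono: "ideal K Q \<Longrightarrow> ideal K' Q \<Longrightarrow> K \<subset> K' \<Longrightarrow> pre K \<subset> pre K'"
  using ideal_Q_subset[of K'] by (auto simp: pre_def)

lemma proj_Idl_iff:
  assumes X: "X \<subseteq> S" and a: "a \<in> S"
  shows "proj a \<in> Idl\<^bsub>Q\<^esub> (proj ` X) \<longleftrightarrow> a \<in> lspan S (X \<union> L)"
proof -
  have XQ: "proj ` X \<subseteq> carrier Q" using X carrier_Q by auto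
  have XL: "X \<union> L \<subseteq> S" using X ideal_inD(1)[OF L] by auto
  have IQ: "ideal (Idl\<^bsub>Q\<^esub> (proj ` X)) Q" by (rule Q.genideal_ideal[OF XQ])
  have IS: "ideal_in S (lspan S (X \<union> L))" by (rule lspan_ideal[OF S XL])
  show ?thesis
  proof
    assume *: "proj a \<in> Idl\<^bsub>Q\<^esub> (proj ` X)"
    have "ideal (proj ` lspan S (X \<union> L)) Q"
      unfolding proj_def using IS by (intro R.ring_ideal_imp_quot_ideal[OF L_ideal]) (simp add: ideal_ring_on_iff[OF S])
    moreover have "proj ` X \<subseteq> proj ` lspan S (X \<union> L)" using lspan_base[OF S] by blast
    ultimately have "proj a \<in> proj ` lspan S (X \<union> L)" using Q.genideal_minimal * by blast
    then obtain j where j: "j \<in> lspan S (X \<union> L)" "proj a = proj j" by blast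
    then have "a - j \<in> L" using proj_eq_iff[OF a] ideal_in_sub[OF IS] by blast
    then have "a - j \<in> lspan S (X \<union> L)" using lspan_base[OF S] by blast
    then have "(a - j) + j \<in> lspan S (X \<union> L)" using j(1) by (rule lspan_add)
    then show "a \<in> lspan S (X \<union> L)" by simp
  next
    assume *: "a \<in> lspan S (X \<union> L)"
    have "X \<union> L \<subseteq> pre (Idl\<^bsub>Q\<^esub> (proj ` X))"
      using L_subset_pre[OF IQ] X Q.genideal_self[OF XQ] by (auto simp: pre_def)
    then show "proj a \<in> Idl\<^bsub>Q\<^esub> (proj ` X)"
      using * lspan_subset[OF pre_ideal[OF IQ], of "X \<union> L"] by (auto simp: pre_def)
  qed
qed

lemma noetherian_Q:
  assumes "noeth S" shows "noetherian_ring Q"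
proof (rule Q.noetherian_ringI)
  fix K assume K: "ideal K Q"
  obtain G where G: "finite G" "G \<subseteq> pre K" "pre K \<subseteq> lspan S G"
    using assms pre_ideal[OF K] unfolding noeth_def by blast
  have GS: "G \<subseteq> S" using G(2) by (auto simp: pre_def)
  have "Idl\<^bsub>Q\<^esub> (proj ` G) \<subseteq> K" by (rule Q.genideal_minimal[OF K]) (use G(2) in \<open>auto simp: pre_def\<close>)
  moreover have "K \<subseteq> Idl\<^bsub>Q\<^esub> (proj ` G)"
  proof
    fix k assume k: "k \<in> K"
    then obtain a where a: "a \<in> S" "k = proj a" using ideal_Q_subset[OF K] by blast
    then have "a \<in> lspan S G" using k G(3) by (auto simp: pre_def)
    then have "a \<in> lspan S (G \<union> L)" by (rule lspan_mono) auto
    then show "k \<in> Idl\<^bsub>Q\<^esub> (proj ` G)" using proj_Idl_iff[OF GS a(1)] a(2) by simp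
  qed
  ultimately show "\<exists>A\<subseteq>carrier Q. finite A \<and> K = Idl\<^bsub>Q\<^esub> A"
    using G(1) GS carrier_Q by (intro exI[of _ "proj ` G"]) auto
qed

lemma pre_maximal_inverse:
  assumes M: "maximalideal M Q" and a: "a \<in> S" "a \<notin> pre M"
  shows "\<exists>b\<in>S. 1 - a * b \<in> pre M"
proof -
  have MI: "ideal M Q" using M by (rule maximalideal.axioms(1))
  have "proj a \<in> carrier Q" "proj a \<notin> M" using a by (auto simp: carrier_Q pre_def)
  then obtain m b where mb: "m \<in> M" "b \<in> carrier Q" "\<one>\<^bsub>Q\<^esub> = m \<oplus>\<^bsub>Q\<^esub> b \<otimes>\<^bsub>Q\<^esub> proj a"
    using Q.maximalideal_inverse[OF M] by blast
  obtain m' where m': "m' \<in> S" "m = proj m'" using ideal_Q_subset[OF MI] mb(1) by blast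
  obtain b' where b': "b' \<in> S" "b = proj b'" using mb(2) carrier_Q by blast
  note R = subring_setD[OF S]
  have "proj 1 = proj (m' + b' * a)" using mb(3) m' b' a R(5) by (simp add: proj_simps)
  then have "1 - (m' + b' * a) \<in> L" using R(1) R(4)[OF m'(1) R(5)[OF b'(1) a(1)]] by (simp add: proj_eq_iff)
  then have "(1 - (m' + b' * a)) + m' \<in> pre M"
    using L_subset_pre[OF MI] mb(1) m' by (intro ideal_inD(3)[OF pre_ideal[OF MI]]) (auto simp: pre_def)
  then have "1 - a * b' \<in> pre M" by (simp add: algebra_simps)
  then show ?thesis using b'(1) by blast
qed

end

section \<open>Primes above the dual ideal\<close>

text \<open>If \<open>p\<close> contained none of the ideals \<open>(x\<^sup>\<phi>)\<close>, the product of one missing variable for each \<open>\<phi>\<close> would be a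
  monomial of the dual ideal outside \<open>p\<close>. For empty \<open>J\<close> the product is 1, and the claim is that no prime
  contains the unit ideal.\<close>

lemma prime_above_dual:
  assumes P: "finite P" and J: "J \<subseteq> isotone_maps P {1..n}"
    and p: "prime_in (polys ({1..n} \<times> P)) p" and sub: "dual_ideal n P J \<subseteq> p"
  shows "\<exists>\<phi>\<in>J. coord_ideal ({1..n} \<times> P) (graph_vars P \<phi>) \<subseteq> p"
proof (rule ccontr)
  let ?V = "{1..n} \<times> P"
  assume no: "\<not> ?thesis"
  have graphV: "graph_vars P \<phi> \<subseteq> ?V" if "\<phi> \<in> J" for \<phi>
    using J that isotone_mapsD(1) unfolding graph_vars_def by blast
  have "\<exists>v\<in>graph_vars P \<phi>. var v \<notin> p" if "\<phi> \<in> J" for \<phi>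
    using no coord_ideal_subset[OF prime_in_ideal[OF p]] that by blast
  then obtain w where w: "\<And>\<phi>. \<phi> \<in> J \<Longrightarrow> w \<phi> \<in> graph_vars P \<phi> \<and> var (w \<phi>) \<notin> p" by metis
  have "finite (isotone_maps P {1..n})" using P by (simp add: finite_isotone_maps)
  then have fin: "finite (w ` J)" using J finite_subset by blast
  have WV: "w ` J \<subseteq> ?V" using w graphV by blast
  have "meets_graphs P J (w ` J)" using w unfolding meets_graphs_def by blast
  then have "(\<Prod>v\<in>w ` J. var v) \<in> dual_ideal n P J"
    unfolding prod_var_eq_single[OF fin] dual_ideal_def
    by (intro mono_ideal_mem_single) (simp_all only: keys_sqfree_exp[OF fin] WV)
  then have "\<exists>v\<in>w ` J. var v \<in> p"
    using sub WV by (intro prime_in_prod[OF fin p subring_polys]) (auto intro!: var_in_polys)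
  then show False using w by blast
qed

lemma chain_imp_height_ge:
  assumes "\<And>i. i \<le> k \<Longrightarrow> primeideal (c i) R" "\<And>i. i < k \<Longrightarrow> c i \<subset> c (Suc i)" "c k = p"
  shows "enat k \<le> height R p"
  unfolding height_def by (rule SUP_upper) (use assms in blast)

lemma card_graph_vars: "card (graph_vars P \<phi>) = card P"
  unfolding graph_vars_def by (rule card_image) (auto simp: inj_on_def)

lemma graph_vars_subset: "\<phi> \<in> isotone_maps P {1..n} \<Longrightarrow> graph_vars P \<phi> \<subseteq> {1..n} \<times> P"
  using isotone_mapsD(1) unfolding graph_vars_def by blast

lemma coord_chain_below:
  fixes A :: "'v set" and p :: "('v, 'k::field) mpoly set"
  assumes A: "finite A" and T: "T \<subseteq> A" and p: "prime_in (polys A) p" "coord_ideal A T \<subseteq> p"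
  obtains c where "\<And>i. i \<le> card T \<Longrightarrow> prime_in (polys A) (c i)"
    "\<And>i. i < card T \<Longrightarrow> c i \<subset> c (Suc i)" "c (card T) = p"
proof -
  have fT: "finite T" using A T finite_subset by blast
  obtain e where e: "e 0 = {}" "e (card T) = T" "\<And>i. i < card T \<Longrightarrow> e i \<subset> e (Suc i)" "\<And>i. i \<le> card T \<Longrightarrow> e i \<subseteq> T"
    using ex_subset_chain[OF fT empty_subsetI] by (metis card.empty diff_zero)
  define c :: "nat \<Rightarrow> ('v, 'k) mpoly set" where "c i = (if i = card T then p else coord_ideal A (e i))" for i
  have "prime_in (polys A) (c i)" if "i \<le> card T" for i
    by (simp add: c_def p(1) coord_ideal_prime[OF A])
  moreover have "c i \<subset> c (Suc i)" if i: "i < card T" for i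
  proof -
    have "(coord_ideal A (e i) :: ('v, 'k) mpoly set) \<subset> coord_ideal A (e (Suc i))"
      by (rule coord_ideal_strict_mono[OF e(3)[OF i]]) (use e(4)[of "Suc i"] i T in auto)
    moreover have "coord_ideal A (e (Suc i)) \<subseteq> c (Suc i)"
      using p(2) e(2) by (simp add: c_def)
    moreover have "c i = coord_ideal A (e i)" using i by (simp add: c_def)
    ultimately show ?thesis by blast
  qed
  moreover have "c (card T) = p" by (simp add: c_def)
  ultimately show thesis by (rule that)
qed

lemma prime_chain_join_bound:
  fixes c d :: "nat \<Rightarrow> ('v, 'k::field) mpoly set"
  assumes A: "finite A"
    and c: "\<And>i. i \<le> k \<Longrightarrow> prime_in (polys A) (c i)" "\<And>i. i < k \<Longrightarrow> c i \<subset> c (Suc i)"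
    and d: "\<And>i. i \<le> l \<Longrightarrow> prime_in (polys A) (d i)" "\<And>i. i < l \<Longrightarrow> d i \<subset> d (Suc i)"
    and eq: "c k = d 0"
  shows "k + l \<le> card A"
proof (rule prime_chain_bound[OF A])
  define e where "e i = (if i \<le> k then c i else d (i - k))" for i
  show "prime_in (polys A) (e i)" if "i \<le> k + l" for i
    using c(1)[of i] d(1)[of "i - k"] that by (simp add: e_def)
  show "e i \<subset> e (Suc i)" if i: "i < k + l" for i
  proof (cases "i < k")
    case True
    then show ?thesis using c(2) by (simp add: e_def)
  next
    case False
    then have "e i = d (i - k)" using eq by (cases "i = k") (simp_all add: e_def)
    moreover have "e (Suc i) = d (Suc (i - k))" using False by (simp add: e_def Suc_diff_le)
    ultimately show ?thesis using d(2)[of "i - k"] i False by simp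
  qed
qed

section \<open>Codimension\<close>

text \<open>Chains of coordinate primes below \<open>(x\<^sup>\<phi>)\<close> give the lower bound. For the upper bound a chain that ends in
  \<open>(x\<^sup>\<phi>)\<close> is prolonged by coordinate primes up to \<open>(x\<^sub>v : v \<in> V)\<close>, and the total length is at most \<open>|V|\<close>.\<close>

theorem codim_dual_ideal:
  fixes P :: "'p::order set"
  assumes P: "finite P" and J: "J \<subseteq> isotone_maps P {1..n}" "J \<noteq> {}"
  shows "codim (mpoly_ring ({1..n} \<times> P)) (dual_ideal n P J :: (nat \<times> 'p, 'k::field) mpoly set) = enat (card P)"
proof -
  let ?V = "{1..n} \<times> P"
  let ?S = "polys ?V :: (nat \<times> 'p, 'k) mpoly set"
  let ?L = "dual_ideal n P J :: (nat \<times> 'p, 'k) mpoly set"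
  have fV: "finite ?V" using P by simp
  have primeiff: "primeideal p (ring_on ?S) \<longleftrightarrow> prime_in ?S p" for p
    by (rule primeideal_ring_on_iff[OF subring_polys])
  have "enat (card P) \<le> codim (ring_on ?S) ?L"
    unfolding codim_def
  proof (rule INF_greatest)
    fix p assume "p \<in> {p. primeideal p (ring_on ?S) \<and> ?L \<subseteq> p}"
    then have p: "prime_in ?S p" "?L \<subseteq> p" using primeiff by blast+
    then obtain \<phi> where \<phi>: "\<phi> \<in> J" "(coord_ideal ?V (graph_vars P \<phi>) :: (nat \<times> 'p, 'k) mpoly set) \<subseteq> p"
      using prime_above_dual[OF P J(1)] by blast
    obtain c where c: "\<And>i. i \<le> card (graph_vars P \<phi>) \<Longrightarrow> prime_in ?S (c i)"
      "\<And>i. i < card (graph_vars P \<phi>) \<Longrightarrow> c i \<subset> c (Suc i)" "c (card (graph_vars P \<phi>)) = p"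
      using coord_chain_below[OF fV graph_vars_subset p(1) \<phi>(2)] \<phi>(1) J(1) by blast
    show "enat (card P) \<le> height (ring_on ?S) p"
      using c unfolding card_graph_vars primeiff[symmetric] by (rule chain_imp_height_ge)
  qed
  moreover have "codim (ring_on ?S) ?L \<le> enat (card P)"
  proof -
    obtain \<phi> where \<phi>: "\<phi> \<in> J" using J by blast
    let ?G = "graph_vars P \<phi>" and ?p = "coord_ideal ?V (graph_vars P \<phi>) :: (nat \<times> 'p, 'k) mpoly set"
    have GV: "?G \<subseteq> ?V" using graph_vars_subset \<phi> J(1) by blast
    have "codim (ring_on ?S) ?L \<le> height (ring_on ?S) ?p"
      unfolding codim_def
      by (rule INF_lower) (use \<phi> dual_ideal_subset_coord coord_ideal_prime[OF fV] primeiff in blast)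
    also have "\<dots> \<le> enat (card P)"
      unfolding height_def
    proof (rule SUP_least)
      fix k assume "k \<in> {k. \<exists>c :: nat \<Rightarrow> _. (\<forall>i\<le>k. primeideal (c i) (ring_on ?S)) \<and> (\<forall>i<k. c i \<subset> c (Suc i)) \<and> c k = ?p}"
      then obtain c where c: "\<And>i. i \<le> k \<Longrightarrow> prime_in ?S (c i)" "\<And>i. i < k \<Longrightarrow> c i \<subset> c (Suc i)" "c k = ?p"
        unfolding primeiff by blast
      let ?m = "card ?V - card ?G"
      obtain e where e: "e 0 = ?G" "\<And>i. i < ?m \<Longrightarrow> e i \<subset> e (Suc i)" "\<And>i. i \<le> ?m \<Longrightarrow> e i \<subseteq> ?V"
        using ex_subset_chain[OF fV GV] by metis
      define d :: "nat \<Rightarrow> (nat \<times> 'p, 'k) mpoly set" where "d i = coord_ideal ?V (e i)" for i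
      have d: "prime_in ?S (d i)" for i unfolding d_def by (rule coord_ideal_prime[OF fV])
      have d': "d i \<subset> d (Suc i)" if "i < ?m" for i
        unfolding d_def by (rule coord_ideal_strict_mono[OF e(2)[OF that] e(3)]) (use that in simp)
      have cd: "c k = d 0" by (simp only: d_def e(1) c(3))
      have "k + ?m \<le> card ?V" by (rule prime_chain_join_bound[of ?V k c ?m d, OF fV c(1,2) d d' cd])
      moreover have "card ?G \<le> card ?V" by (rule card_mono[OF fV GV])
      ultimately show "enat k \<le> enat (card P)" using card_graph_vars[of P \<phi>] by simp
    qed
    finally show ?thesis .
  qed
  ultimately show ?thesis by (simp add: mpoly_ring_eq)
qed

section \<open>Cohen-Macaulayness\<close>

text \<open>For a maximal ideal \<open>M\<close> of the quotient, \<open>height M \<le> (n-1)|P| \<le> depth M \<le> height M\<close>.\<close>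

theorem cohen_macaulay_dual_ideal:
  fixes P :: "'p::order set"
  assumes n: "n \<ge> 1" and P: "finite P" and J: "poset_ideal (isotone_maps P {1..n}) (pointwise_le P) J"
  shows "cohen_macaulay_ideal (mpoly_ring ({1..n} \<times> P)) (dual_ideal n P J :: (nat \<times> 'p, 'k::field) mpoly set)"
proof -
  let ?V = "{1..n} \<times> P" and ?T = "{1..<n} \<times> P"
  let ?S = "polys ?V :: (nat \<times> 'p, 'k) mpoly set"
  let ?L = "dual_ideal n P J :: (nat \<times> 'p, 'k) mpoly set"
  have fV: "finite ?V" and fT: "finite ?T" using P by simp_all
  have JH: "J \<subseteq> isotone_maps P {1..n}" using J by (simp add: poset_ideal_def)
  interpret quotient_setting ?S ?L
    by unfold_locales (rule subring_polys, rule dual_ideal_ideal)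
  have noeth: "noetherian_ring Q" by (rule noetherian_Q[OF noeth_polys[OF fV]])
  have cards: "card ?V = card ?T + card P"
    using n by (cases n) (simp_all add: card_cartesian_product)
  have "depth Q M = height Q M" if M: "maximalideal M Q" for M
  proof (rule antisym)
    have Mp: "primeideal M Q" by (rule Q.maximalideal_prime[OF M])
    have MI: "ideal M Q" using M by (rule maximalideal.axioms(1))
    show "depth Q M \<le> height Q M" by (rule Q.depth_le_height[OF noeth Mp])
    have "height Q M \<le> enat (card ?T)"
      unfolding height_def
    proof (rule SUP_least)
      fix k assume "k \<in> {k. \<exists>c :: nat \<Rightarrow> _. (\<forall>i\<le>k. primeideal (c i) Q) \<and> (\<forall>i<k. c i \<subset> c (Suc i)) \<and> c k = M}"
      then obtain c where c: "\<And>i. i \<le> k \<Longrightarrow> primeideal (c i) Q" "\<And>i. i < k \<Longrightarrow> c i \<subset> c (Suc i)" by auto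
      have ideal: "ideal (c i) Q" if "i \<le> k" for i using c(1)[OF that] by (rule primeideal.axioms(1))
      have pre: "prime_in ?S (pre (c i))" if "i \<le> k" for i by (rule pre_prime[OF c(1)[OF that]])
      have pre': "pre (c i) \<subset> pre (c (Suc i))" if "i < k" for i
        using that c(2) by (intro pre_strict_mono ideal) auto
      obtain \<phi> where \<phi>: "\<phi> \<in> J" "(coord_ideal ?V (graph_vars P \<phi>) :: (nat \<times> 'p, 'k) mpoly set) \<subseteq> pre (c 0)"
        using prime_above_dual[OF P JH pre L_subset_pre[OF ideal]] by blast
      obtain d where d: "\<And>i. i \<le> card (graph_vars P \<phi>) \<Longrightarrow> prime_in ?S (d i)"
        "\<And>i. i < card (graph_vars P \<phi>) \<Longrightarrow> d i \<subset> d (Suc i)" "d (card (graph_vars P \<phi>)) = pre (c 0)"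
        using coord_chain_below[OF fV graph_vars_subset pre \<phi>(2)] \<phi>(1) JH by blast
      have "card P + k \<le> card ?V"
        by (rule prime_chain_join_bound[of ?V "card P" d k "\<lambda>i. pre (c i)", OF fV d(1,2)[unfolded card_graph_vars] pre pre' d(3)[unfolded card_graph_vars]])
      then show "enat k \<le> enat (card ?T)" using cards by simp
    qed
    also have "\<dots> \<le> depth Q M"
    proof -
      have pM: "prime_in ?S (pre M)" by (rule pre_prime[OF Mp])
      \<comment> \<open>\<open>N\<close> is the degree and \<open>c\<close> the coefficient sequence of a polynomial with root \<open>diff_var v\<close> modulo \<open>M\<close>\<close>
      define rel where "rel v N c \<longleftrightarrow> c N \<noteq> 0 \<and> (\<Sum>i\<le>N. cst (c i) * diff_var v ^ i) \<in> pre M"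
        for v :: "nat \<times> 'p" and N and c :: "nat \<Rightarrow> 'k"
      have "\<forall>v\<in>?T. \<exists>x. rel v (fst x) (snd x)"
      proof
        fix v assume "v \<in> ?T"
        then obtain N c where "rel v N c"
          using zariski[OF fV pM pre_maximal_inverse[OF M] diff_var_polys[of v n P]] unfolding rel_def by blast
        then show "\<exists>x. rel v (fst x) (snd x)" by (intro exI[of _ "(N, c)"]) simp
      qed
      from bchoice[OF this] obtain x where x: "\<forall>v\<in>?T. rel v (fst (x v)) (snd (x v))" ..
      define N where "N v = fst (x v)" for v
      define c where "c v = snd (x v)" for v
      have Nc: "c v (N v) \<noteq> 0 \<and> (\<Sum>i\<le>N v. cst (c v i) * diff_var v ^ i) \<in> pre M" if "v \<in> ?T" for v
        using x that unfolding rel_def N_def c_def by blast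
      define g :: "nat \<times> 'p \<Rightarrow> (nat \<times> 'p, 'k) mpoly" where "g v = (\<Sum>i\<le>N v. cst (c v i) * var v ^ i)" for v
      have gs: "subst diff_var (g v) = (\<Sum>i\<le>N v. cst (c v i) * diff_var v ^ i)" for v
        by (simp add: g_def subst_sum subst_mult subst_power)
      have gA: "g v \<in> polys A" if "v \<in> A" for v A
        unfolding g_def
        by (intro polys_sum polys_mult cst_in_polys polys_power var_in_polys[OF that])
      have gS: "subst diff_var (g v) \<in> ?S" if "v \<in> ?T" for v by (rule subst_diff_polys[OF gA[OF that]])
      obtain vs where vs: "set vs = ?T" "distinct vs" using finite_distinct_list[OF fT] by blast
      define fs where "fs = map (\<lambda>v. proj (subst diff_var (g v))) vs"
      have fsM: "set fs \<subseteq> M" 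
      proof
        fix y assume "y \<in> set fs"
        then obtain v where v: "v \<in> ?T" "y = proj (subst diff_var (g v))" unfolding fs_def set_map vs(1) by blast
        have "subst diff_var (g v) \<in> pre M" unfolding gs using Nc[OF v(1)] by blast
        then show "y \<in> M" using v(2) by (simp only: pre_def mem_Collect_eq)
      qed
      have "regular_sequence Q fs"
        unfolding regular_sequence_def
      proof (intro conjI allI impI ballI)
        show fsQ: "set fs \<subseteq> carrier Q" using fsM additive_subgroup.a_subset[OF ideal.axioms(1)[OF MI]] by blast
        show "Idl\<^bsub>Q\<^esub> (set fs) \<noteq> carrier Q"
          using Q.genideal_minimal[OF MI fsM] maximalideal.I_notcarr[OF M] additive_subgroup.a_subset[OF ideal.axioms(1)[OF MI]] by blast
        fix i y assume i: "i < length fs" and y: "y \<in> carrier Q" "fs ! i \<otimes>\<^bsub>Q\<^esub> y \<in> Idl\<^bsub>Q\<^esub> (set (take i fs))"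
        have il: "i < length vs" using i by (simp add: fs_def)
        let ?v = "vs ! i" and ?G = "g ` set (take i vs)"
        have v: "?v \<in> ?T" using nth_mem[OF il] unfolding vs(1) .
        have notin: "w \<noteq> ?v" if "w \<in> set (take i vs)" for w
        proof
          assume "w = ?v"
          then obtain j where "j < i" "vs ! j = vs ! i" using \<open>w \<in> _\<close> il by (auto simp: in_set_conv_nth)
          then show False using vs(2) il by (simp add: nth_eq_iff_index_eq)
        qed
        have takeT: "set (take i vs) \<subseteq> ?T" using set_take_subset[of i vs] unfolding vs(1) .
        have "g w \<in> polys ?T" if "w \<in> set (take i vs)" for w
          by (rule gA) (rule subsetD[OF takeT that])
        then have G: "?G \<subseteq> polys ?T" by blast
        have "g w \<in> polys (- {?v})" if "w \<in> set (take i vs)" for w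
          by (rule gA) (simp add: notin[OF that])
        then have G': "?G \<subseteq> polys (- {?v})" by blast
        have eq: "set (take i fs) = proj ` (subst diff_var ` ?G)" by (simp add: fs_def take_map image_image)
        have GS: "subst diff_var ` ?G \<subseteq> ?S" using gS takeT by blast
        obtain a where a: "a \<in> ?S" "y = proj a" using y(1) carrier_Q by blast
        have fsi: "fs ! i = proj (subst diff_var (g ?v))" using il by (simp add: fs_def)
        have "proj (subst diff_var (g ?v) * a) \<in> Idl\<^bsub>Q\<^esub> (proj ` (subst diff_var ` ?G))"
          using y(2) unfolding eq fsi a(2) proj_simps(1)[OF gS[OF v] a(1)] .
        then have mem: "subst diff_var (g ?v) * a \<in> lspan ?S (subst diff_var ` ?G \<union> ?L)"
          using proj_Idl_iff[OF GS polys_mult[OF gS[OF v] a(1)]] by blast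
        have "a \<in> lspan ?S (subst diff_var ` ?G \<union> ?L)"
          by (rule regular_mod_dual[OF n P J G G' v conjunct1[OF Nc[OF v]] a(1) mem[unfolded gs]])
        then show "y \<in> Idl\<^bsub>Q\<^esub> (set (take i fs))"
          unfolding eq a(2) using proj_Idl_iff[OF GS a(1)] by blast
      qed
      then have "enat (length fs) \<le> depth Q M"
        unfolding depth_def using fsM by (intro SUP_upper) simp
      moreover have "length fs = card ?T" using distinct_card[OF vs(2)] vs(1) by (simp add: fs_def)
      ultimately show ?thesis by simp
    qed
    finally show "height Q M \<le> depth Q M" .
  qed
  then show ?thesis
    using L_ideal noeth Q.is_cring unfolding cohen_macaulay_ideal_def cohen_macaulay_ring_def mpoly_ring_eq by blast
qed

theorem theorem5p9:
  fixes n :: nat and P :: "'p::order set" and J :: "('p \<Rightarrow> nat) set"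
    and L :: "(nat \<times> 'p, 'k::field) mpoly set"
    and S :: "(nat \<times> 'p, 'k) mpoly ring"
  assumes "n \<ge> 1"
    and "finite P"
    and "poset_ideal (isotone_maps P {1..n}) (pointwise_le P) J"
    and S_def: "S = mpoly_ring ({1..n} \<times> P)"
    and L_def: "L = dual_letterplace_ideal n P J"
  shows "L = letterplace_ideal n P <+>\<^bsub>S\<^esub> K_ideal n P (isotone_maps P {1..n} - J)
    \<and> cohen_macaulay_ideal S L
    \<and> (J \<noteq> {} \<longrightarrow> codim S L = enat (card P))"
proof -
  have JH: "J \<subseteq> isotone_maps P {1..n}" using assms(3) by (simp add: poset_ideal_def)
  have L: "L = dual_ideal n P J" unfolding L_def by (rule dual_letterplace_ideal_eq[OF assms(2) JH])
  show ?thesis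
    unfolding L S_def
    using dual_ideal_eq_sum[OF assms(1-3)] cohen_macaulay_dual_ideal[OF assms(1-3)] codim_dual_ideal[OF assms(2) JH]
    by blast
qed

end
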